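(* Let $G$ be a connected ribbon graph with at least one edge, let $D(G)$ be its ribbon-graphic delta-matroid and let $G_m$ be its medial graph. Then $D(G)$ is $Z_3$-bipartite if and only if $G_m$ is bipartite.
   Context: All combinatorial structures are finite; graphs may have loops and multiple edges. $\triangle$ is symmetric difference. Ribbon graphs. A ribbon graph $G=(V(G),E(G))$ is a surface with boundary that is the union of a set $V(G)$ of topological discs (vertices) and a set $E(G)$ of topological discs (edges) such that vertices and edges intersect in disjoint line segments, each such segment lies on the boundary of exactly one vertex and exactly one edge, and every edge contains exactly two such segments. A spanning ribbon subgraph is obtained by deleting edges and keeping all vertex-discs; a quasi-tree is a connected ribbon graph with exactly one boundary component. For connected $G$, $D(G)=(E(G),\mathcal F(G))$, where $\mathcal F(G)$ consists of all $A\subseteq E(G)$ that are edge sets of spanning ribbon subgraphs which are quasi-trees. This is known to be a binary delta-matroid. Medial graph. A corner of $G$ is an arc of the boundary of a vertex-disc between two consecutive edge-ends (attaching segments). The medial graph $G_m$ has a vertex $v_e$ for each $e\in E(G)$ and one edge for each corner, joining $v_e$ and $v_f$ if the corner lies between an end of $e$ and an end of $f$ (possibly $e=f$). It is $4$-regular and connected. Delta-matroids. A delta-matroid is a pair $D=(E,\mathcal F)$ with $\varnothing\neq\mathcal F\subseteq 2^E$ (feasible sets) such that for all $X,Y\in\mathcal F$ and $u\in X\triangle Y$ there is $v\in X\triangle Y$ (possibly $v=u$) with $X\triangle\{u,v\}\in\mathcal F$. For a symmetric matrix $A$ over $\mathbb F_2$ indexed by $E$, $D(A)=(E,\{X\subseteq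 E: A[X]\text{ nonsingular}\})$ (principal submatrices; the empty matrix is nonsingular). $D$ is binary if for some $X\subseteq E$ the twist $D*X=(E,\{F\triangle X:F\in\mathcal F\})$ is isomorphic to some $D(A)$. Multimatroids. A carrier $(U,\Omega)$ is a set $U$ with a partition $\Omega$ into skew classes. A subtransversal (transversal) meets each skew class in at most (exactly) one element. A multimatroid $Z=(U,\Omega,\mathcal I)$ has $\mathcal I$ a family of subtransversals (independent sets) such that (1) for each transversal $T$, $\mathcal I\cap 2^T$ is the family of independent sets of a matroid on $T$; (2) for every $I\in\mathcal I$ and every two distinct elements $x,y$ of one skew class disjoint from $I$, $I\cup\{x\}\in\mathcal I$ or $I\cup\{y\}\in\mathcal I$. Bases are the maximal independent sets; circuits are the minimal subtransversals that are not independent. For $X\subseteq U$, $Z-X$ is the multimatroid on $U\setminus X$, with skew classes the nonempty sets $\omega\setminus X$, whose independent sets are those of $Z$ contained in $U\setminus X$. A $3$-matroid is a multimatroid all of whose skew classes have size $3$; it is tight if for every basis $X$ and skew class $\omega$, exactly one of the transversals $(X\setminus\omega)\cup\{u\}$, $u\in\omega$, is not a basis. The tight $3$-matroid $Z_3(D,\tau)$. For each $e\in E$ let $\omega_e=\{e_1,e_2,e_3\}$ (pairwise disjoint), $U=\bigcup_e\omega_e$, $\Omega=\{\omega_e:e\in E\}$, $T_i=\{e_i:e\in E\}$, $\tau=(T_1,T_2,T_3)$. For a tight $3$-matroid $Z$ on $(U,\Omega)$, $D_{Z,\tau}$ is the set system on $E$ in which $X$ is feasible iff $\{e_1:e\in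 E\setminus X\}\cup\{e_2:e\in X\}$ is a basis of $Z-T_3$. For a binary delta-matroid $D$ it is known that there is a unique tight $3$-matroid $Z$ on $(U,\Omega)$ with $D=D_{Z,\tau}$; it is denoted $Z_3(D,\tau)$. A binary delta-matroid $D$ is $Z_3$-bipartite if every circuit of $Z_3(D,\tau)$ has even cardinality. *)

theory Defs
  imports "HOL-Analysis.Analysis" "HOL-Library.Disjoint_Sets"
begin

section \<open>Surfaces with boundary\<close>

text \<open>The plane is modelled by the type of complex numbers.\<close>

definition surface_with_boundary :: "'a topology \<Rightarrow> bool" where
  "surface_with_boundary X \<longleftrightarrow>
     Hausdorff_space X \<and> second_countable X \<and>
     (\<forall>p\<in>topspace X. \<exists>U W. openin X U \<and> p \<in> U \<and>
        openin (top_of_set {z::complex. 0 \<le> Im z}) W \<and>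
        subtopology X U homeomorphic_space top_of_set W)"

definition surface_boundary :: "'a topology \<Rightarrow> 'a set" where
  "surface_boundary X = {p \<in> topspace X.
     \<not> (\<exists>U W. openin X U \<and> p \<in> U \<and> open (W :: complex set) \<and>
            subtopology X U homeomorphic_space top_of_set W)}"

definition boundary_components :: "'a topology \<Rightarrow> 'a set set" where
  "boundary_components X = connected_components_of (subtopology X (surface_boundary X))"

definition topological_disc :: "'a topology \<Rightarrow> 'a set \<Rightarrow> bool" where
  "topological_disc X D \<longleftrightarrow> D \<subseteq> topspace X \<and>
     subtopology X D homeomorphic_space top_of_set (cball (0::complex) 1)"

definition line_segment :: "'a topology \<Rightarrow> 'a set \<Rightarrow> bool" where
  "line_segment X s \<longleftrightarrow> s \<subseteq> topspace X \<and>
     subtopology X s homeomorphic_space top_of_set {0..1::real}"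

definition disc_boundary :: "'a topology \<Rightarrow> 'a set \<Rightarrow> 'a set" where
  "disc_boundary X D = surface_boundary (subtopology X D)"


section \<open>Ribbon graphs\<close>

text \<open>Vertices and edges are themselves the discs, that is, subsets of the surface.\<close>

record 'a ribbon_graph =
  surface :: "'a topology"
  rverts :: "'a set set"
  redges :: "'a set set"

text \<open>The set in which vertices and edges intersect is a disjoint union of line segments; these
  segments are therefore its connected components.\<close>

definition attaching_segments :: "'a ribbon_graph \<Rightarrow> 'a set set" where
  "attaching_segments G =
     connected_components_of (subtopology (surface G) (\<Union>(rverts G) \<inter> \<Union>(redges G)))"

definition ribbon_graph :: "'a ribbon_graph \<Rightarrow> bool" where
  "ribbon_graph G \<longleftrightarrow>
     surface_with_boundary (surface G) \<and>
     finite (rverts G) \<and> finite (redges G) \<and>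
     topspace (surface G) = \<Union>(rverts G) \<union> \<Union>(redges G) \<and>
     (\<forall>D \<in> rverts G \<union> redges G. topological_disc (surface G) D) \<and>
     disjoint (rverts G) \<and> disjoint (redges G) \<and>
     (\<forall>s \<in> attaching_segments G.
        line_segment (surface G) s \<and>
        (\<exists>!v. v \<in> rverts G \<and> s \<subseteq> disc_boundary (surface G) v) \<and>
        (\<exists>!e. e \<in> redges G \<and> s \<subseteq> disc_boundary (surface G) e)) \<and>
     (\<forall>e \<in> redges G. card {s \<in> attaching_segments G. s \<subseteq> e} = 2)"

definition connected_ribbon_graph :: "'a ribbon_graph \<Rightarrow> bool" where
  "connected_ribbon_graph G \<longleftrightarrow> ribbon_graph G \<and> connected_space (surface G)"

definition spanning_ribbon_subgraph :: "'a ribbon_graph \<Rightarrow> 'a set set \<Rightarrow> 'a ribbon_graph" where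
  "spanning_ribbon_subgraph G A =
     \<lparr>surface = subtopology (surface G) (\<Union>(rverts G) \<union> \<Union>A), rverts = rverts G, redges = A\<rparr>"

definition quasi_tree :: "'a ribbon_graph \<Rightarrow> bool" where
  "quasi_tree G \<longleftrightarrow> connected_ribbon_graph G \<and> card (boundary_components (surface G)) = 1"


section \<open>Set systems and the ribbon-graphic delta-matroid\<close>

text \<open>A set system is a pair of its ground set and its family of feasible sets.\<close>

type_synonym 'e set_system = "'e set \<times> 'e set set"

definition ribbon_delta_matroid :: "'a ribbon_graph \<Rightarrow> 'a set set_system" where
  "ribbon_delta_matroid G =
     (redges G, {A. A \<subseteq> redges G \<and> quasi_tree (spanning_ribbon_subgraph G A)})"


section \<open>Medial graph\<close>

text \<open>A multigraph assigns to each of its edges the set of the ends of that edge (a singleton for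
  a loop).\<close>

record ('v, 'c) multigraph =
  mverts :: "'v set"
  medges :: "'c set"
  mends :: "'c \<Rightarrow> 'v set"

definition bipartite :: "('v, 'c) multigraph \<Rightarrow> bool" where
  "bipartite H \<longleftrightarrow> (\<exists>A B. A \<union> B = mverts H \<and> A \<inter> B = {} \<and>
     (\<forall>c \<in> medges H. \<exists>a\<in>A. \<exists>b\<in>B. mends H c = {a, b}))"

text \<open>A corner is represented by the arc without its two end points, which belong to the attaching
  segments between which it lies. Corners therefore are the components of what remains of the
  boundary circle of a vertex once the attaching segments are removed. A vertex that meets no edge
  has no corner.\<close>

definition corners :: "'a ribbon_graph \<Rightarrow> 'a set set" where
  "corners G = (\<Union>v \<in> {v \<in> rverts G. v \<inter> \<Union>(redges G) \<noteq> {}}.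
     connected_components_of
       (subtopology (surface G) (disc_boundary (surface G) v - \<Union>(redges G))))"

text \<open>The medial vertex of an edge \<open>e\<close> is \<open>e\<close> itself.\<close>

definition medial_graph :: "'a ribbon_graph \<Rightarrow> ('a set, 'a set) multigraph" where
  "medial_graph G =
     \<lparr>mverts = redges G, medges = corners G,
      mends = (\<lambda>c. {e \<in> redges G. (surface G closure_of c) \<inter> e \<noteq> {}})\<rparr>"


section \<open>Multimatroids\<close>

definition matroid :: "'u set \<Rightarrow> 'u set set \<Rightarrow> bool" where
  "matroid T \<J> \<longleftrightarrow> finite T \<and> \<J> \<subseteq> Pow T \<and> {} \<in> \<J> \<and>
     (\<forall>I J. J \<in> \<J> \<and> I \<subseteq> J \<longrightarrow> I \<in> \<J>) \<and>
     (\<forall>I \<in> \<J>. \<forall>J \<in> \<J>. card I < card J \<longrightarrow> (\<exists>x \<in> J - I. insert x I \<in> \<J>))"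

record 'u multimatroid =
  carrier_set :: "'u set"
  skew_classes :: "'u set set"
  indeps :: "'u set set"

definition subtransversal :: "'u multimatroid \<Rightarrow> 'u set \<Rightarrow> bool" where
  "subtransversal Z S \<longleftrightarrow> S \<subseteq> carrier_set Z \<and> (\<forall>\<omega> \<in> skew_classes Z. card (S \<inter> \<omega>) \<le> 1)"

definition transversal :: "'u multimatroid \<Rightarrow> 'u set \<Rightarrow> bool" where
  "transversal Z T \<longleftrightarrow> T \<subseteq> carrier_set Z \<and> (\<forall>\<omega> \<in> skew_classes Z. card (T \<inter> \<omega>) = 1)"

definition multimatroid :: "'u multimatroid \<Rightarrow> bool" where
  "multimatroid Z \<longleftrightarrow>
     finite (carrier_set Z) \<and> partition_on (carrier_set Z) (skew_classes Z) \<and>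
     (\<forall>I \<in> indeps Z. subtransversal Z I) \<and>
     (\<forall>T. transversal Z T \<longrightarrow> matroid T (indeps Z \<inter> Pow T)) \<and>
     (\<forall>I \<in> indeps Z. \<forall>\<omega> \<in> skew_classes Z. \<forall>x \<in> \<omega>. \<forall>y \<in> \<omega>.
        x \<noteq> y \<and> \<omega> \<inter> I = {} \<longrightarrow> insert x I \<in> indeps Z \<or> insert y I \<in> indeps Z)"

definition basis :: "'u multimatroid \<Rightarrow> 'u set \<Rightarrow> bool" where
  "basis Z X \<longleftrightarrow> X \<in> indeps Z \<and> (\<forall>Y \<in> indeps Z. X \<subseteq> Y \<longrightarrow> Y = X)"

definition circuit :: "'u multimatroid \<Rightarrow> 'u set \<Rightarrow> bool" where
  "circuit Z C \<longleftrightarrow> subtransversal Z C \<and> C \<notin> indeps Z \<and>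
     (\<forall>S. S \<subset> C \<longrightarrow> S \<in> indeps Z)"

definition delete :: "'u multimatroid \<Rightarrow> 'u set \<Rightarrow> 'u multimatroid" where
  "delete Z X =
     \<lparr>carrier_set = carrier_set Z - X,
      skew_classes = {\<omega> - X | \<omega>. \<omega> \<in> skew_classes Z \<and> \<omega> - X \<noteq> {}},
      indeps = {I \<in> indeps Z. I \<subseteq> carrier_set Z - X}\<rparr>"

definition tight_3_matroid :: "'u multimatroid \<Rightarrow> bool" where
  "tight_3_matroid Z \<longleftrightarrow> multimatroid Z \<and> (\<forall>\<omega> \<in> skew_classes Z. card \<omega> = 3) \<and>
     (\<forall>X \<omega>. basis Z X \<and> \<omega> \<in> skew_classes Z \<longrightarrow>
        (\<exists>!u. u \<in> \<omega> \<and> \<not> basis Z (insert u (X - \<omega>))))"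


section \<open>The tight 3-matroid of a delta-matroid\<close>

text \<open>The element \<open>e\<^sub>i\<close> is the pair \<open>(e, i)\<close>, so that \<open>T\<^sub>i\<close> is \<open>E \<times> {i}\<close>.\<close>

definition Z3_carrier :: "'e set \<Rightarrow> ('e \<times> nat) set" where
  "Z3_carrier E = E \<times> {1, 2, 3}"

definition Z3_skew_classes :: "'e set \<Rightarrow> ('e \<times> nat) set set" where
  "Z3_skew_classes E = {{(e, 1), (e, 2), (e, 3)} | e. e \<in> E}"

definition induced_system :: "'e set \<Rightarrow> ('e \<times> nat) multimatroid \<Rightarrow> 'e set_system" where
  "induced_system E Z =
     (E, {X. X \<subseteq> E \<and> basis (delete Z (E \<times> {3})) ((E - X) \<times> {1} \<union> X \<times> {2})})"

text \<open>The description below is meaningful for those set systems for which such a tight 3-matroid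
  exists and is unique, in particular for all binary delta-matroids.\<close>

definition Z3 :: "'e set_system \<Rightarrow> ('e \<times> nat) multimatroid" where
  "Z3 D = (THE Z. tight_3_matroid Z \<and>
     carrier_set Z = Z3_carrier (fst D) \<and> skew_classes Z = Z3_skew_classes (fst D) \<and>
     induced_system (fst D) Z = D)"

definition Z3_bipartite :: "'e set_system \<Rightarrow> bool" where
  "Z3_bipartite D \<longleftrightarrow> (\<forall>C. circuit (Z3 D) C \<longrightarrow> even (card C))"

end

theory Submission
  imports Defs
begin

text \<open>The proof replaces the ribbon graph by a finite structure on its \<^emph>\<open>flags\<close>, the end points of the
  attaching segments. A flag has three partners: \<open>sigma\<close> leads to the other end of its segment, \<open>eps\<close>
  to the other end of the side of its edge, and \<open>kappa\<close> to the other end of its corner. The four flags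
  of an edge are the half-edges of the medial graph at that edge, the \<open>kappa\<close>-pairs are the medial
  edges, and \<open>sigma\<close>, \<open>eps\<close>, \<open>sigma \<circ> eps\<close> are the three ways to pair the half-edges at a medial vertex
  (its transitions).

  The topological part shows that these pairings are well defined and describe boundaries. The
  complement of finitely many arcs in a circle consists of open arcs, and each end of a given arc is
  an end of exactly one of them (\<open>gap_structure\<close>, \<open>ends_in_unique_gap\<close>). Points inside an attaching
  segment become interior when the edge is present (\<open>glued_discs_planar\<close>), so the boundary of the
  spanning ribbon subgraph on \<open>X\<close> consists of all corners, the segments of the edges outside \<open>X\<close> and
  the sides of the edges in \<open>X\<close>. Hence \<open>X\<close> is feasible iff the flags are connected under \<open>kappa\<close>,
  \<open>eps\<close> over \<open>X\<close> and \<open>sigma\<close> elsewhere (\<open>quasi_tree_iff\<close>).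

  The algebraic part studies the cycle space of the medial graph over the field with two elements: the
  sets \<open>F\<close> of flags closed under \<open>kappa\<close> that meet every edge evenly. At each medial vertex, \<open>F\<close> contains
  no half-edge, all of them, or one pair of exactly one transition; recording the last case gives a
  partial choice of transitions \<open>vec F\<close>. By connectedness only the two trivial cycles have an empty
  vector. A partial choice of transitions is declared independent if it contains no nonempty
  \<open>vec F\<close>. Since two cycles share an even number of flags, the cycle space is totally isotropic
  (\<open>isotropic\<close>), which makes this a multimatroid; since the cycle space is large
  (\<open>exists_nontrivial_cycle\<close>), the multimatroid is tight. A transversal choosing only \<open>sigma\<close> and \<open>eps\<close> is
  a basis iff the flags are connected under it and \<open>kappa\<close>, so the multimatroid induces \<open>D(G)\<close>. A tight
  3-matroid is determined by the bases that avoid one transversal (\<open>tight_3_matroid_unique\<close>), hence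
  it is \<open>Z\<^sub>3(D(G))\<close>.

  The circuits are the minimal nonempty vectors of cycles, so all of them are even iff all vectors are. The size
  of \<open>vec F\<close> has the same parity as the number of medial edges in \<open>F\<close> (\<open>even_card_vec_iff\<close>), and a connected
  graph is bipartite iff all members of its cycle space have evenly many edges.\<close>

(* The indices 1, 2, 3 are treated alike, so 1 must not be rewritten to a successor. *)
declare One_nat_def [simp del]

section \<open>Local structure of surfaces\<close>

text \<open>With \<open>A\<close> the whole plane or the closed half-plane, this is the local condition on interior points and
  on arbitrary points of a surface; sharing one definition lets localisation be proved once.\<close>

definition locally_like :: "complex set \<Rightarrow> 'a topology \<Rightarrow> 'a \<Rightarrow> bool" where
  "locally_like A X p \<longleftrightarrow> (\<exists>U W. openin X U \<and> p \<in> U \<and> openin (top_of_set A) W \<and>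
     subtopology X U homeomorphic_space top_of_set W)"

abbreviation half_plane :: "complex set" where "half_plane \<equiv> {z. 0 \<le> Im z}"

lemma surface_boundary_iff:
  "p \<in> surface_boundary X \<longleftrightarrow> p \<in> topspace X \<and> \<not> locally_like UNIV X p"
  by (simp add: surface_boundary_def locally_like_def)

lemma surface_with_boundary_iff:
  "surface_with_boundary X \<longleftrightarrow> Hausdorff_space X \<and> second_countable X \<and>
     (\<forall>p \<in> topspace X. locally_like half_plane X p)"
  by (simp add: surface_with_boundary_def locally_like_def)

lemma locally_like_restrict:
  assumes "locally_like A X p" "openin X N" "p \<in> N"
  shows "locally_like A (subtopology X N) p"
proof -
  obtain U W f where U: "openin X U" "p \<in> U" "openin (top_of_set A) W"
    and f: "homeomorphic_map (subtopology X U) (top_of_set W) f"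
    using assms(1) unfolding locally_like_def homeomorphic_space by blast
  have Usub: "U \<subseteq> topspace X" using U openin_subset by blast
  have UN: "openin (subtopology X U) (U \<inter> N)"
    using assms(2) by (metis inf_commute openin_subtopology_Int)
  then have "openin (top_of_set W) (f ` (U \<inter> N))"
    using homeomorphic_map_openness_eq[OF f] by blast
  then have W': "openin (top_of_set A) (f ` (U \<inter> N))" using U(3) openin_trans by blast
  have sub: "f ` (U \<inter> N) \<subseteq> W"
    using homeomorphic_imp_surjective_map[OF f] Usub by auto
  have "homeomorphic_map (subtopology (subtopology X U) N) (subtopology (top_of_set W) (f ` (U \<inter> N))) f"
    using f by (rule homeomorphic_map_subtopologies) (use Usub sub in auto)
  then have "homeomorphic_map (subtopology X (U \<inter> N)) (top_of_set (f ` (U \<inter> N))) f"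
    using sub by (simp add: subtopology_subtopology Int_absorb1)
  moreover have "subtopology (subtopology X N) (U \<inter> N) = subtopology X (U \<inter> N)"
    by (simp add: subtopology_subtopology Int_commute Int_left_commute)
  moreover have "openin (subtopology X N) (U \<inter> N)"
    using U(1) by (rule openin_subtopology_Int)
  ultimately show ?thesis
    unfolding locally_like_def homeomorphic_space using W' U(2) assms(3) by (metis IntI)
qed

lemma locally_like_extend:
  assumes "locally_like A (subtopology X N) p" "openin X N"
  shows "locally_like A X p"
proof -
  obtain U W where U: "openin (subtopology X N) U" "p \<in> U" "openin (top_of_set A) W"
    and h: "subtopology (subtopology X N) U homeomorphic_space top_of_set W"
    using assms(1) unfolding locally_like_def by blast
  have "U \<subseteq> N" using openin_subset[OF U(1)] by simp
  then have "subtopology (subtopology X N) U = subtopology X U"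
    by (simp add: subtopology_subtopology Int_absorb1)
  moreover have "openin X U" using U(1) assms(2) openin_trans_full by blast
  ultimately show ?thesis unfolding locally_like_def using U h by metis
qed

lemma locally_like_open_iff:
  "openin X N \<Longrightarrow> p \<in> N \<Longrightarrow> locally_like A (subtopology X N) p \<longleftrightarrow> locally_like A X p"
  using locally_like_restrict locally_like_extend by metis

text \<open>This reduces local questions about a union of discs to the few discs that contain the point: the
  others form a closed set, whose complement serves as \<open>N\<close>.\<close>

lemma locally_like_cong:
  assumes "openin X N" "M \<inter> N = M' \<inter> N" "p \<in> M \<inter> N" "M \<subseteq> topspace X" "M' \<subseteq> topspace X"
  shows "locally_like A (subtopology X M) p \<longleftrightarrow> locally_like A (subtopology X M') p"
proof -
  have *: "locally_like A (subtopology X M) p \<longleftrightarrow> locally_like A (subtopology X (M \<inter> N)) p"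
    if "p \<in> M \<inter> N" "M \<subseteq> topspace X" for M
  proof -
    have "openin (subtopology X M) (M \<inter> N)" using assms(1) by (metis inf_commute openin_subtopology_Int)
    from locally_like_open_iff[OF this, of p A] show ?thesis using that
      by (simp add: subtopology_subtopology Int_absorb1)
  qed
  show ?thesis using *[of M] *[of M'] assms by simp
qed

lemma surface_boundary_cong:
  assumes "openin X N" "M \<inter> N = M' \<inter> N" "p \<in> M \<inter> N" "M \<subseteq> topspace X" "M' \<subseteq> topspace X"
  shows "p \<in> surface_boundary (subtopology X M) \<longleftrightarrow> p \<in> surface_boundary (subtopology X M')"
  using locally_like_cong[OF assms, of UNIV] assms by (auto simp: surface_boundary_iff)

lemma closedin_surface_boundary: "closedin X (surface_boundary X)"
proof -
  have "openin X (topspace X - surface_boundary X)"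
  proof (subst openin_subopen, intro ballI)
    fix p assume p: "p \<in> topspace X - surface_boundary X"
    then have "locally_like UNIV X p" by (simp add: surface_boundary_iff)
    then obtain U W where U: "openin X U" "p \<in> U" "openin (top_of_set (UNIV::complex set)) W"
      "subtopology X U homeomorphic_space top_of_set W"
      unfolding locally_like_def by auto
    have "locally_like UNIV X q" if "q \<in> U" for q
      unfolding locally_like_def using U that by (intro exI[of _ U] exI[of _ W]) simp
    then have "U \<subseteq> topspace X - surface_boundary X"
      using openin_subset[OF U(1)] by (auto simp: surface_boundary_iff)
    then show "\<exists>T. openin X T \<and> p \<in> T \<and> T \<subseteq> topspace X - surface_boundary X" 
      using U(1,2) by (intro exI[of _ U] conjI)
  qed
  moreover have "surface_boundary X \<subseteq> topspace X" by (auto simp: surface_boundary_def)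
  ultimately show ?thesis by (simp add: closedin_def)
qed

section \<open>Discs\<close>

lemma homeomorphic_map_top_of_set:
  assumes "homeomorphism A B f g"
  shows "homeomorphic_map (top_of_set A) (top_of_set B) f"
proof -
  have "homeomorphic_maps (top_of_set A) (top_of_set B) f g"
    using assms unfolding homeomorphism_def homeomorphic_maps_def
    by (auto simp: continuous_map_in_subtopology)
  then show ?thesis by (auto simp: homeomorphic_map_maps)
qed

text \<open>By invariance of domain a point on the unit circle has no planar neighbourhood in the disc.\<close>

lemma disc_boundary_eq:
  assumes D: "D \<subseteq> topspace X" and h: "homeomorphic_map (subtopology X D) (top_of_set (cball (0::complex) 1)) h"
  shows "disc_boundary X D = {p \<in> D. norm (h p) = 1}"
proof -
  have top: "topspace (subtopology X D) = D" using D by auto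
  have img: "h ` D = cball 0 1" using homeomorphic_imp_surjective_map[OF h] top by simp
  have inj: "inj_on h D" using homeomorphic_imp_injective_map[OF h] top by simp
  have "locally_like UNIV (subtopology X D) p \<longleftrightarrow> norm (h p) < 1" if p: "p \<in> D" for p
  proof
    assume "norm (h p) < 1"
    let ?U = "{q \<in> D. h q \<in> ball 0 1}"
    have im: "h ` ?U = ball 0 1" using img by (auto simp: image_iff set_eq_iff) (metis less_eq_real_def)
    have "openin (subtopology X D) ?U"
    proof -
      have "continuous_map (subtopology X D) euclidean h"
        using homeomorphic_imp_continuous_map[OF h] continuous_map_in_subtopology by blast
      from openin_continuous_map_preimage[OF this, of "ball 0 1"] show ?thesis
        unfolding top by simp
    qed
    moreover have hom: "homeomorphic_map (subtopology (subtopology X D) ?U)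
        (subtopology (top_of_set (cball 0 1)) (ball 0 1)) h"
      using h by (rule homeomorphic_map_subtopologies) (use im top ball_subset_cball in \<open>auto simp: Int_absorb1\<close>)
    then have "subtopology (subtopology X D) ?U homeomorphic_space top_of_set (ball (0::complex) 1)"
    proof -
      have "cball 0 1 \<inter> ball 0 1 = ball (0::complex) 1" using ball_subset_cball by blast
      then show ?thesis
        using homeomorphic_map_imp_homeomorphic_space[OF hom] by (simp add: subtopology_subtopology)
    qed
    ultimately show "locally_like UNIV (subtopology X D) p"
      unfolding locally_like_def using p \<open>norm (h p) < 1\<close> 
      by (intro exI[of _ ?U] exI[of _ "ball 0 1"]) auto
  next
    assume "locally_like UNIV (subtopology X D) p"
    then obtain U W f where U: "openin (subtopology X D) U" "p \<in> U" "open (W :: complex set)"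
      and f: "homeomorphic_map (subtopology (subtopology X D) U) (top_of_set W) f"
      unfolding locally_like_def homeomorphic_space by auto
    obtain g where fg: "homeomorphic_maps (subtopology (subtopology X D) U) (top_of_set W) f g"
      using f homeomorphic_map_maps by blast
    have UD: "U \<subseteq> D" using openin_subset[OF U(1)] top by simp
    have topU: "topspace (subtopology (subtopology X D) U) = U" using UD D by auto
    have gW: "g ` W = U" "inj_on g W"
    proof -
      have "homeomorphic_map (top_of_set W) (subtopology (subtopology X D) U) g"
        using fg homeomorphic_maps_map by blast
      then show "g ` W = U" "inj_on g W"
        using homeomorphic_imp_surjective_map homeomorphic_imp_injective_map topU by fastforce+
    qed
    have "continuous_map (top_of_set W) (subtopology X D) g"
      using fg unfolding homeomorphic_maps_def using continuous_map_in_subtopology by blast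
    moreover have "continuous_map (subtopology X D) euclidean h"
      using homeomorphic_imp_continuous_map[OF h] continuous_map_in_subtopology by blast
    ultimately have "continuous_map (top_of_set W) euclidean (h \<circ> g)"
      by (rule continuous_map_compose)
    then have cont: "continuous_on W (h \<circ> g)" by simp
    have "inj_on (h \<circ> g) W" using gW UD inj by (simp add: comp_inj_on inj_on_subset)
    then have "open ((h \<circ> g) ` W)" using invariance_of_domain[OF cont U(3)] by blast
    moreover have "(h \<circ> g) ` W = h ` U" using gW(1) by (metis image_comp)
    moreover have "h ` U \<subseteq> cball 0 1" using img UD by auto
    ultimately have "h ` U \<subseteq> interior (cball 0 1)" by (intro interior_maximal) simp_all
    then show "norm (h p) < 1" using U(2) by auto
  qed
  moreover have "norm (h p) \<le> 1" if "p \<in> D" for p using img that by auto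
  ultimately show ?thesis
    unfolding disc_boundary_def set_eq_iff surface_boundary_iff top by force
qed

text \<open>The map \<open>z \<mapsto> \<i> (a + z) / (a - z)\<close> is the Cayley transform sending \<open>a\<close> to infinity; its imaginary
  part has the sign of \<open>1 - norm z\<close>.\<close>

lemma Im_Cayley:
  assumes "norm a = 1"
  shows "Im (\<i> * (a + z) / (a - z)) = (1 - (norm z)\<^sup>2) / (norm (a - z))\<^sup>2"
proof -
  have "(Re a + Re z) * (Re a - Re z) + (Im a + Im z) * (Im a - Im z) = (norm a)\<^sup>2 - (norm z)\<^sup>2"
    unfolding cmod_power2 by (simp add: algebra_simps power2_eq_square)
  then have "(Re a + Re z) * (Re a - Re z) + (Im a + Im z) * (Im a - Im z) = 1 - (norm z)\<^sup>2"
    using assms by simp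
  moreover have "Im (\<i> * (a + z) / (a - z)) =
      ((Re a + Re z) * (Re a - Re z) + (Im a + Im z) * (Im a - Im z)) / (norm (a - z))\<^sup>2"
    unfolding Im_divide cmod_power2 by (simp add: algebra_simps)
  ultimately show ?thesis by simp
qed

lemma Cayley_homeomorphism:
  assumes "norm a = 1"
  shows "homeomorphism (cball 0 1 - {a}) half_plane
    (\<lambda>z. \<i> * (a + z) / (a - z)) (\<lambda>y. a * (y - \<i>) / (y + \<i>))"
proof -
  have a0: "a \<noteq> 0" using assms by auto
  have y: "y + \<i> \<noteq> 0" if "0 \<le> Im y" for y using that by (auto simp: complex_eq_iff)
  have norm_le: "norm (y - \<i>) \<le> norm (y + \<i>)" if "0 \<le> Im y" for y
  proof (rule power2_le_imp_le)
    show "(norm (y - \<i>))\<^sup>2 \<le> (norm (y + \<i>))\<^sup>2"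
      unfolding cmod_power2 using that by (simp add: algebra_simps power2_eq_square)
  qed simp
  have inv1: "a * (w - \<i>) / (w + \<i>) = z" if "w = \<i> * (a + z) / (a - z)" "z \<noteq> a" for z w
  proof -
    have "w * (a - z) = \<i> * (a + z)" using that by simp
    then have "a * (w - \<i>) = z * (w + \<i>)" by (simp add: algebra_simps)
    moreover have "w + \<i> \<noteq> 0"
    proof
      assume "w + \<i> = 0"
      then have "- \<i> * (a - z) = \<i> * (a + z)" using \<open>w * (a - z) = _\<close> by (metis add_eq_0_iff2)
      then have "\<i> * a = 0" by (simp add: algebra_simps)
      then show False using a0 by simp
    qed
    ultimately show ?thesis by simp
  qed
  have ne: "a * (y - \<i>) / (y + \<i>) \<noteq> a" if "0 \<le> Im y" for y
    using y[OF that] a0 by (simp add: divide_eq_eq)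
  have inv2: "\<i> * (a + z) / (a - z) = y" if z: "z = a * (y - \<i>) / (y + \<i>)" "0 \<le> Im y" for z y
  proof -
    have "z * (y + \<i>) = a * (y - \<i>)" using z y[OF z(2)] by simp
    then have "\<i> * (a + z) = y * (a - z)" by (simp add: algebra_simps)
    moreover have "a - z \<noteq> 0" using ne[OF z(2)] z(1) by simp
    ultimately show ?thesis by simp
  qed
  show ?thesis
  proof (rule homeomorphismI)
    show "continuous_on (cball 0 1 - {a}) (\<lambda>z. \<i> * (a + z) / (a - z))"
      by (intro continuous_intros) auto
    show "continuous_on half_plane (\<lambda>y. a * (y - \<i>) / (y + \<i>))"
      using y by (intro continuous_intros) auto
    show "(\<lambda>z. \<i> * (a + z) / (a - z)) ` (cball 0 1 - {a}) \<subseteq> half_plane"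
      unfolding image_subset_iff mem_Collect_eq Im_Cayley[OF assms] by (auto simp: power_le_one)
    show "(\<lambda>y. a * (y - \<i>) / (y + \<i>)) ` half_plane \<subseteq> cball 0 1 - {a}"
    proof (rule image_subsetI)
      fix w :: complex assume "w \<in> half_plane"
      then have w: "0 \<le> Im w" by simp
      have "norm (a * (w - \<i>) / (w + \<i>)) \<le> 1"
        using norm_le[OF w] y[OF w] assms by (simp add: norm_mult norm_divide divide_le_eq)
      then show "a * (w - \<i>) / (w + \<i>) \<in> cball 0 1 - {a}" using ne[OF w] by simp
    qed
    show "a * (\<i> * (a + z) / (a - z) - \<i>) / (\<i> * (a + z) / (a - z) + \<i>) = z"
      if "z \<in> cball 0 1 - {a}" for z using inv1[OF refl] that by blast
    show "\<i> * (a + a * (w - \<i>) / (w + \<i>)) / (a - a * (w - \<i>) / (w + \<i>)) = w"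
      if "w \<in> half_plane" for w using inv2[OF refl] that by blast
  qed
qed

text \<open>This is the Cayley transform in a parametrisation of the disc; it makes the boundary a straight line.\<close>

lemma disc_chart:
  assumes D: "topological_disc X D" and q: "q \<in> disc_boundary X D"
  obtains f where "homeomorphic_map (subtopology X (D - {q})) (top_of_set half_plane) f"
    "\<And>z. z \<in> D - {q} \<Longrightarrow> z \<in> disc_boundary X D \<longleftrightarrow> Im (f z) = 0"
proof -
  have DX: "D \<subseteq> topspace X" using D by (simp add: topological_disc_def)
  obtain h where h: "homeomorphic_map (subtopology X D) (top_of_set (cball (0::complex) 1)) h"
    using D unfolding topological_disc_def homeomorphic_space by blast
  have bd: "disc_boundary X D = {p \<in> D. norm (h p) = 1}" using disc_boundary_eq[OF DX h] .
  have qD: "q \<in> D" and a: "norm (h q) = 1" using q bd by auto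
  have img: "h ` D = cball 0 1" and inj: "inj_on h D"
    using homeomorphic_imp_surjective_map[OF h] homeomorphic_imp_injective_map[OF h] DX 
    by (simp_all add: Int_absorb1)
  let ?c = "\<lambda>z. \<i> * (h q + z) / (h q - z)"
  have "h ` (D - {q}) = cball 0 1 - {h q}" using img inj qD by (auto simp: inj_on_def)
  then have "homeomorphic_map (subtopology (subtopology X D) (D - {q}))
      (subtopology (top_of_set (cball 0 1)) (cball 0 1 - {h q})) h"
    using DX by (intro homeomorphic_map_subtopologies[OF h]) (auto simp: Int_absorb1)
  then have "homeomorphic_map (subtopology X (D - {q})) (top_of_set (cball 0 1 - {h q})) h"
    by (simp only: subtopology_subtopology Diff_Int_distrib[symmetric] Int_absorb1 Diff_subset)
  then have "homeomorphic_map (subtopology X (D - {q})) (top_of_set half_plane) (?c \<circ> h)"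
    using homeomorphic_map_top_of_set[OF Cayley_homeomorphism[OF a]] by (rule homeomorphic_map_compose)
  moreover have "z \<in> disc_boundary X D \<longleftrightarrow> Im ((?c \<circ> h) z) = 0" if z: "z \<in> D - {q}" for z
  proof -
    have ne: "h q - h z \<noteq> 0" using z inj qD by (auto simp: inj_on_def)
    have "Im (?c (h z)) = (1 - (norm (h z))\<^sup>2) / (norm (h q - h z))\<^sup>2"
      by (rule Im_Cayley[OF a])
    then have "Im (?c (h z)) = 0 \<longleftrightarrow> (norm (h z))\<^sup>2 = 1" using ne by auto
    also have "\<dots> \<longleftrightarrow> norm (h z) = 1" by (simp add: power2_eq_1_iff) (smt (verit) norm_ge_zero)
    finally show ?thesis using bd z by simp
  qed
  ultimately show thesis using that by blast
qed

lemma disc_boundary_has_other_point: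
  assumes "topological_disc X D"
  obtains q where "q \<in> disc_boundary X D" "q \<noteq> p"
proof -
  have DX: "D \<subseteq> topspace X" using assms by (simp add: topological_disc_def)
  obtain h where h: "homeomorphic_map (subtopology X D) (top_of_set (cball (0::complex) 1)) h"
    using assms unfolding topological_disc_def homeomorphic_space by blast
  have bd: "disc_boundary X D = {p \<in> D. norm (h p) = 1}" using disc_boundary_eq[OF DX h] .
  have img: "h ` D = cball 0 1"
    using homeomorphic_imp_surjective_map[OF h] DX by (simp add: Int_absorb1)
  have "1 \<in> h ` D" "-1 \<in> h ` D" using img by auto
  then obtain x y where xy: "x \<in> D" "h x = 1" "y \<in> D" "h y = -1" by fastforce
  then have "x \<noteq> y" by auto
  moreover have "x \<in> disc_boundary X D" "y \<in> disc_boundary X D" using xy bd by auto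
  ultimately show thesis using that by metis
qed

lemma disc_boundary_subset: "disc_boundary X D \<subseteq> D"
  by (auto simp: disc_boundary_def surface_boundary_def)

lemma disc_compactin: "topological_disc X D \<Longrightarrow> compactin X D"
  unfolding topological_disc_def
  by (metis compact_cball compact_space_subtopology compactin_subspace homeomorphic_compact_space compactin_euclidean_iff)

lemma disc_connectedin: "topological_disc X D \<Longrightarrow> connectedin X D"
  unfolding topological_disc_def connectedin_def
  by (metis connected_cball connectedin_def connectedin_iff_connected homeomorphic_connected_space)

lemma disc_locally_half_plane:
  assumes D: "topological_disc X D" and H: "Hausdorff_space X" and p: "p \<in> D"
  shows "locally_like half_plane (subtopology X D) p"
proof -
  have DX: "D \<subseteq> topspace X" using D by (simp add: topological_disc_def)
  obtain q where q: "q \<in> disc_boundary X D" "q \<noteq> p" using disc_boundary_has_other_point[OF D] .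
  obtain f where f: "homeomorphic_map (subtopology X (D - {q})) (top_of_set half_plane) f"
    using disc_chart[OF D q(1)] by metis
  have qD: "q \<in> D" using q(1) subsetD[OF disc_boundary_subset] by metis
  then have "closedin X {q}" using H DX by (simp add: closedin_Hausdorff_singleton subset_iff)
  then have "openin (subtopology X D) (D - {q})"
    using DX qD by (metis closedin_subset_topspace insert_subset empty_subsetI openin_diff openin_topspace topspace_subtopology_subset)
  moreover have "subtopology (subtopology X D) (D - {q}) = subtopology X (D - {q})"
    by (simp only: subtopology_subtopology Int_absorb1 Diff_subset)
  then have "subtopology (subtopology X D) (D - {q}) homeomorphic_space top_of_set half_plane"
    using homeomorphic_map_imp_homeomorphic_space[OF f] by simp
  moreover have "p \<in> D - {q}" using p q(2) by simp
  ultimately show ?thesis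
    unfolding locally_like_def
    by (intro exI[of _ "D - {q}"] exI[of _ half_plane] conjI openin_subtopology_self)
qed


section \<open>Arcs on a topological circle\<close>

lemma chart_connectedin:
  assumes "homeomorphic_map (subtopology X A) (top_of_set B) h" "A \<subseteq> topspace X" "U \<subseteq> A"
  shows "connectedin X U \<longleftrightarrow> connected (h ` U)"
proof -
  have "h ` U \<subseteq> B"
    using homeomorphic_imp_surjective_map[OF assms(1)] assms(2,3) by auto
  then show ?thesis
    using homeomorphic_map_connectedness[OF assms(1), of U] assms(2,3)
    by (auto simp: connectedin_subtopology)
qed

lemma chart_compactin:
  assumes "homeomorphic_map (subtopology X A) (top_of_set B) h" "A \<subseteq> topspace X" "U \<subseteq> A"
  shows "compactin X U \<longleftrightarrow> compact (h ` U)"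
proof -
  have "h ` U \<subseteq> B"
    using homeomorphic_imp_surjective_map[OF assms(1)] assms(2,3) by auto
  then show ?thesis
    using homeomorphic_map_compactness[OF assms(1), of U] assms(2,3)
    by (auto simp: compactin_subtopology)
qed

lemma chart_inj:
  assumes "homeomorphic_map (subtopology X A) (top_of_set B) h" "A \<subseteq> topspace X"
  shows "inj_on h A" "h ` A = B"
  using homeomorphic_imp_injective_map[OF assms(1)] homeomorphic_imp_surjective_map[OF assms(1)] assms(2)
  by (simp_all add: Int_absorb1)

lemma chart_closure_of:
  fixes r :: "'a \<Rightarrow> real"
  assumes r: "homeomorphic_map (subtopology X A) (top_of_set UNIV) r" and A: "A \<subseteq> topspace X"
    and U: "U \<subseteq> A" and z: "z \<in> A" "r z \<in> closure (r ` U)"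
  shows "z \<in> X closure_of U"
proof -
  have "closure (r ` U) = r ` (subtopology X A closure_of U)"
    using homeomorphic_map_closure_of[OF r, of U] A U by (simp add: Int_absorb1)
  then obtain y where y: "y \<in> subtopology X A closure_of U" "r z = r y" using z(2) by auto
  have "y \<in> A" using y(1) closure_of_subset_topspace[of "subtopology X A" U] A by auto
  then have "y = z" using inj_onD[OF chart_inj(1)[OF r A]] y(2) z(1) by metis
  then show ?thesis using y(1) closure_of_subtopology_subset[of X A U] by auto
qed

text \<open>Describing end points as the points that do not disconnect the arc makes them independent of a
  parametrisation and of the surrounding disc, so that a segment has the same ends in its vertex and
  in its edge.\<close>

definition ends :: "'a topology \<Rightarrow> 'a set \<Rightarrow> 'a set" where
  "ends X s = {p \<in> s. connectedin X (s - {p})}"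

lemma ends_subset: "ends X s \<subseteq> s" by (auto simp: ends_def)

lemma connected_Icc_minus_iff:
  assumes "(a::real) < b" "x \<in> {a..b}"
  shows "connected ({a..b} - {x}) \<longleftrightarrow> x = a \<or> x = b"
proof
  assume c: "connected ({a..b} - {x})"
  show "x = a \<or> x = b"
  proof (rule ccontr)
    assume "\<not> (x = a \<or> x = b)"
    then have "x \<in> {a..b} - {x}" using connectedD_interval[OF c, of a b x] assms by auto
    then show False by simp
  qed
next
  assume "x = a \<or> x = b"
  then have "{a..b} - {x} = {a<..b} \<or> {a..b} - {x} = {a..<b}" by auto
  then show "connected ({a..b} - {x})" by (elim disjE) simp_all
qed

lemma line_segment_subset: "line_segment X s \<Longrightarrow> s \<subseteq> topspace X"
  by (simp add: line_segment_def)

text \<open>A chart maps an arc to a compact connected set of reals, hence to an interval, and the two end points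
  of an interval are its only points whose removal leaves it connected.\<close>

lemma line_segment_image:
  fixes h :: "'a \<Rightarrow> real"
  assumes s: "line_segment X s" and h: "homeomorphic_map (subtopology X A) (top_of_set B) h"
    and A: "A \<subseteq> topspace X" "s \<subseteq> A"
  obtains a b where "a < b" "h ` s = {a..b}" "\<And>p. p \<in> s \<Longrightarrow> p \<in> ends X s \<longleftrightarrow> h p = a \<or> h p = b"
proof -
  obtain k where k: "homeomorphic_map (subtopology X s) (top_of_set {0..1::real}) k"
    using s unfolding line_segment_def homeomorphic_space by auto
  have sX: "s \<subseteq> topspace X" using s by (rule line_segment_subset)
  have ks: "inj_on k s" "k ` s = {0..1}" using chart_inj[OF k sX] .
  have inj: "inj_on h s" using chart_inj[OF h A(1)] A(2) inj_on_subset by blast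
  have "connectedin X s" "compactin X s"
    using chart_connectedin[OF k sX, of s] chart_compactin[OF k sX, of s] ks by simp_all
  then have "connected (h ` s)" "compact (h ` s)"
    using chart_connectedin[OF h A] chart_compactin[OF h A] by simp_all
  then obtain a b where ab: "h ` s = {a..b}" using connected_compact_interval_1 by metis
  have "infinite s" using ks(2) by (metis finite_imageI infinite_Icc zero_less_one)
  then have "infinite {a..b}" using inj ab by (metis finite_imageD)
  then have less: "a < b" by (simp add: infinite_Icc_iff)
  have "p \<in> ends X s \<longleftrightarrow> h p = a \<or> h p = b" if p: "p \<in> s" for p
  proof -
    have "h ` (s - {p}) = {a..b} - {h p}" using inj p ab by (simp add: inj_on_image_set_diff[of h s])
    moreover have "h p \<in> {a..b}" using ab p by blast
    ultimately show ?thesis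
      using chart_connectedin[OF h A(1), of "s - {p}"] A(2) p connected_Icc_minus_iff[OF less]
      by (auto simp: ends_def)
  qed
  then show thesis using that less ab by metis
qed

lemma line_segment_properties:
  assumes "line_segment X s"
  shows "compactin X s" "connectedin X s" "\<exists>p q. p \<noteq> q \<and> ends X s = {p, q}" "s \<noteq> ends X s"
proof -
  obtain k where k: "homeomorphic_map (subtopology X s) (top_of_set {0..1::real}) k"
    using assms unfolding line_segment_def homeomorphic_space by auto
  have sX: "s \<subseteq> topspace X" using assms by (rule line_segment_subset)
  obtain a b where ab: "a < b" "k ` s = {a..b}" "\<And>p. p \<in> s \<Longrightarrow> p \<in> ends X s \<longleftrightarrow> k p = a \<or> k p = b"
    using line_segment_image[OF assms k sX order_refl] by metis
  have inj: "inj_on k s" using chart_inj[OF k sX] by simp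
  show "compactin X s" "connectedin X s"
    using chart_compactin[OF k sX order_refl] chart_connectedin[OF k sX order_refl] ab(2) by simp_all
  have "a \<in> k ` s" "b \<in> k ` s" "(a + b) / 2 \<in> k ` s" using ab(1,2) by auto
  then obtain p q m where pq: "p \<in> s" "k p = a" "q \<in> s" "k q = b" "m \<in> s" "k m = (a + b) / 2" by auto
  have "ends X s = {p, q}"
  proof (intro set_eqI iffI)
    fix x assume "x \<in> ends X s"
    then show "x \<in> {p, q}" using ab(3)[of x] ends_subset[of X s] pq inj by (auto simp: inj_on_def)
  next
    fix x assume "x \<in> {p, q}"
    then show "x \<in> ends X s" using ab(3) pq by auto
  qed
  moreover have "p \<noteq> q" using pq ab(1) by auto
  ultimately show "\<exists>p q. p \<noteq> q \<and> ends X s = {p, q}" by blast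
  have "m \<notin> ends X s" using ab(1) ab(3)[OF pq(5)] pq(6) by (auto simp: field_simps)
  then show "s \<noteq> ends X s" using pq(5) by auto
qed

text \<open>The one property of a circle on which all arguments rest is that removing any of its points leaves a
  copy of the real line.\<close>

locale topological_circle =
  fixes X :: "'a topology" and C :: "'a set"
  assumes Hausdorff: "Hausdorff_space X" and compact_C: "compactin X C" and C_nonempty: "C \<noteq> {}"
    and chart: "q \<in> C \<Longrightarrow> \<exists>r. homeomorphic_map (subtopology X (C - {q})) (top_of_set (UNIV::real set)) r"
begin

lemma C_subset: "C \<subseteq> topspace X"
  using compact_C by (simp add: compactin_def)

lemma closed_C: "closedin X C"
  using Hausdorff compact_C by (rule compactin_imp_closedin)

lemma openin_punctured: "openin (subtopology X C) (C - {q})"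
proof (cases "q \<in> C")
  case True
  have "closedin (subtopology X C) {q}"
    using Hausdorff C_subset True
    by (metis Hausdorff_space_subtopology closedin_Hausdorff_singleton topspace_subtopology_subset)
  then show ?thesis
    using C_subset by (metis closedin_def topspace_subtopology_subset)
next
  case False
  then show ?thesis using C_subset openin_topspace[of "subtopology X C"] by (simp add: Int_absorb1)
qed

lemma chart_openin:
  assumes r: "homeomorphic_map (subtopology X (C - {q})) (top_of_set (UNIV::real set)) r" and U: "U \<subseteq> C - {q}"
  shows "openin (subtopology X C) U \<longleftrightarrow> open (r ` U)"
proof -
  have "openin (subtopology X (C - {q})) U \<longleftrightarrow> open (r ` U)"
    using homeomorphic_map_openness[OF r, of U] U C_subset by auto
  moreover have "subtopology X (C - {q}) = subtopology (subtopology X C) (C - {q})"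
    by (simp only: subtopology_subtopology Int_absorb1 Diff_subset)
  ultimately show ?thesis using U openin_open_subtopology[OF openin_punctured, of q U] by simp
qed

lemma punctured_connected: "q \<in> C \<Longrightarrow> connectedin X (C - {q})"
proof -
  assume "q \<in> C"
  then obtain r where r: "homeomorphic_map (subtopology X (C - {q})) (top_of_set (UNIV::real set)) r" 
    using chart by blast
  have sub: "C - {q} \<subseteq> topspace X" using C_subset by blast
  show ?thesis using chart_connectedin[OF r sub order_refl] chart_inj[OF r sub] by simp
qed

lemma connected_C: "connectedin X C"
proof -
  obtain q where q: "q \<in> C" using C_nonempty by blast
  obtain r where r: "homeomorphic_map (subtopology X (C - {q})) (top_of_set (UNIV::real set)) r" 
    using chart[OF q] by blast
  have sub: "C - {q} \<subseteq> topspace X" using C_subset by blast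
  have "r ` (C - {q}) = UNIV" using chart_inj[OF r sub] by simp
  then have "0 \<in> r ` (C - {q})" "1 \<in> r ` (C - {q})" by simp_all
  then obtain x y where xy: "x \<in> C - {q}" "y \<in> C - {q}" "r x = 0" "r y = 1" by (metis imageE)
  then have "x \<noteq> y" by auto
  have "connectedin X ((C - {q}) \<union> (C - {x}))"
    using punctured_connected q xy \<open>x \<noteq> y\<close> by (intro connectedin_Un) auto
  moreover have "(C - {q}) \<union> (C - {x}) = C" using xy by auto
  ultimately show ?thesis by simp
qed

text \<open>An arc is not the whole circle, because a circle has no cut points and an arc has; so the circle can
  be opened at a point outside the arc. Normalising the given end to the origin avoids treating left and
  right ends separately.\<close>

lemma arc_chart:
  assumes s: "line_segment X s" "s \<subseteq> C" and p: "p \<in> ends X s"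
  obtains q r b where "q \<in> C - s"
    "homeomorphic_map (subtopology X (C - {q})) (top_of_set (UNIV::real set)) r"
    "r p = 0" "b > 0" "r ` s = {0..b}" "r ` (s - ends X s) = {0<..<b}"
proof -
  have "s \<noteq> C"
  proof
    assume "s = C"
    then have "ends X s = s" using punctured_connected by (auto simp: ends_def)
    then show False using line_segment_properties(4)[OF s(1)] by simp
  qed
  then obtain q where q: "q \<in> C - s" using s(2) by blast
  then obtain r where r: "homeomorphic_map (subtopology X (C - {q})) (top_of_set (UNIV::real set)) r"
    using chart by blast
  have sub: "C - {q} \<subseteq> topspace X" "s \<subseteq> C - {q}" using C_subset s q by auto
  obtain a b where ab: "a < b" "r ` s = {a..b}" "\<And>p. p \<in> s \<Longrightarrow> p \<in> ends X s \<longleftrightarrow> r p = a \<or> r p = b"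
    using line_segment_image[OF s(1) r sub] by metis
  have ps: "p \<in> s" using p ends_subset by fast
  (* Translate, and reflect if p is the right end. *)
  define k where "k = (if r p = a then (\<lambda>x. x - a) else (\<lambda>x. b - x))"
  have "homeomorphism UNIV UNIV k (if r p = a then (\<lambda>x. x + a) else (\<lambda>x. b - x))"
    unfolding k_def by (auto intro!: homeomorphismI continuous_intros)
  then have "homeomorphic_map (top_of_set UNIV) (top_of_set UNIV) k"
    by (rule homeomorphic_map_top_of_set)
  with r have kr: "homeomorphic_map (subtopology X (C - {q})) (top_of_set (UNIV::real set)) (k \<circ> r)"
    by (rule homeomorphic_map_compose)
  have kp: "(k \<circ> r) p = 0" using ab(3)[OF ps] p by (auto simp: k_def)
  obtain a' b' where ab': "a' < b'" "(k \<circ> r) ` s = {a'..b'}"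
      "\<And>p. p \<in> s \<Longrightarrow> p \<in> ends X s \<longleftrightarrow> (k \<circ> r) p = a' \<or> (k \<circ> r) p = b'"
    using line_segment_image[OF s(1) kr sub] by metis
  have nonneg: "0 \<le> (k \<circ> r) x" if "x \<in> s" for x
  proof -
    have "r x \<in> {a..b}" using that ab(2) by blast
    then show ?thesis by (auto simp: k_def)
  qed
  have "a' \<in> (k \<circ> r) ` s" using ab' by auto
  then have "0 \<le> a'" using nonneg by auto
  moreover have "0 \<in> {a'..b'}" using kp ps ab'(2) by (metis image_eqI)
  ultimately have a': "a' = 0" by simp
  have "(k \<circ> r) ` (s - ends X s) = {0<..<b'}"
  proof (intro set_eqI iffI)
    fix x assume "x \<in> (k \<circ> r) ` (s - ends X s)"
    then obtain y where y: "y \<in> s" "y \<notin> ends X s" "x = (k \<circ> r) y" by auto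
    then have "x \<noteq> 0" "x \<noteq> b'" using ab'(3)[OF y(1)] a' by auto
    moreover have "x \<in> {0..b'}" using y ab'(2) a' by blast
    ultimately show "x \<in> {0<..<b'}" by auto
  next
    fix x assume x: "x \<in> {0<..<b'}"
    then have "x \<in> (k \<circ> r) ` s" using ab'(2) a' by auto
    then obtain y where y: "y \<in> s" "x = (k \<circ> r) y" by auto
    then have "y \<notin> ends X s" using ab'(3)[OF y(1)] x a' by auto
    then show "x \<in> (k \<circ> r) ` (s - ends X s)" using y by blast
  qed
  then show thesis using that[OF q kr kp] ab' a' by simp
qed

lemma arc_interior_open:
  assumes s: "line_segment X s" "s \<subseteq> C"
  shows "openin (subtopology X C) (s - ends X s)"
proof -
  obtain p where "p \<in> ends X s" using line_segment_properties(3)[OF s(1)] by blast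
  then obtain q r b where q: "q \<in> C - s"
    "homeomorphic_map (subtopology X (C - {q})) (top_of_set (UNIV::real set)) r"
    "r ` (s - ends X s) = {0<..<b}"
    using arc_chart[OF s] by metis
  have "s - ends X s \<subseteq> C - {q}" using q(1) s(2) by auto
  from chart_openin[OF q(2) this] show ?thesis using q(3) by simp
qed

end

lemma connected_open_bounded_real:
  fixes U :: "real set"
  assumes "connected U" "open U" "bounded U" "U \<noteq> {}"
  obtains x y where "x < y" "U = {x<..<y}"
proof -
  have "connected (closure U)" "compact (closure U)"
    using assms by (auto intro: connected_imp_connected_closure)
  then obtain x y where xy: "closure U = {x..y}" using connected_compact_interval_1 by metis
  have "convex U" using assms(1) by (simp add: connected_convex_1)
  then have "U = interior {x..y}" using convex_interior_closure[of U] assms(2) xy by (simp add: interior_open)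
  then have U: "U = {x<..<y}" by simp
  then have "x < y" using assms(4) by auto
  then show thesis using that U by blast
qed

locale arcs_on_circle = topological_circle +
  fixes \<S> :: "'a set set"
  assumes finite_arcs: "finite \<S>" and arcs_nonempty: "\<S> \<noteq> {}"
    and arc: "s \<in> \<S> \<Longrightarrow> line_segment X s" and arc_subset: "s \<in> \<S> \<Longrightarrow> s \<subseteq> C"
    and arcs_disjoint: "s \<in> \<S> \<Longrightarrow> s' \<in> \<S> \<Longrightarrow> s \<noteq> s' \<Longrightarrow> s \<inter> s' = {}"
begin

definition gaps :: "'a set set" where
  "gaps = connected_components_of (subtopology X (C - \<Union>\<S>))"

lemma arc_closed: "s \<in> \<S> \<Longrightarrow> closedin X s"
  using arc line_segment_properties(1) Hausdorff compactin_imp_closedin by blast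

lemma closed_arcs: "closedin X (\<Union>\<S>)"
  using finite_arcs arc_closed by (intro closedin_Union) auto

lemma complement_open: "openin (subtopology X C) (C - \<Union>\<S>)"
proof -
  have "C - \<Union>\<S> = C \<inter> (topspace X - \<Union>\<S>)" using C_subset by blast
  then show ?thesis using closed_arcs by (metis openin_diff openin_subtopology_Int2 openin_topspace)
qed

lemma gap_subset: "c \<in> gaps \<Longrightarrow> c \<subseteq> C - \<Union>\<S>"
  unfolding gaps_def using connected_components_of_subset by fastforce

lemma gap_nonempty: "c \<in> gaps \<Longrightarrow> c \<noteq> {}"
  unfolding gaps_def by (rule nonempty_connected_components_of)

lemma gap_connected: "c \<in> gaps \<Longrightarrow> connectedin X c"
  unfolding gaps_def using connectedin_connected_components_of connectedin_subtopology by blast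

lemma gap_maximal: "c \<in> gaps \<Longrightarrow> connectedin X T \<Longrightarrow> T \<subseteq> C - \<Union>\<S> \<Longrightarrow> c \<inter> T \<noteq> {} \<Longrightarrow> T \<subseteq> c"
  unfolding gaps_def using connected_components_of_maximal
  by (metis connectedin_subtopology disjnt_def)

lemma gaps_cover: "\<Union>gaps = C - \<Union>\<S>"
  unfolding gaps_def Union_connected_components_of using C_subset by auto

lemma gaps_eq: "c \<in> gaps \<Longrightarrow> c' \<in> gaps \<Longrightarrow> c \<inter> c' \<noteq> {} \<Longrightarrow> c = c'"
  using gap_maximal[of c c'] gap_maximal[of c' c] gap_connected gap_subset by (metis Int_commute subset_antisym)

text \<open>Cutting the circle inside one of the arcs maps the complement of the arcs to a bounded open
  subset of the line, whose components are bounded intervals.\<close>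

lemma gap_structure:
  assumes c: "c \<in> gaps"
  shows "openin (subtopology X C) c"
    "\<exists>p q. p \<noteq> q \<and> p \<in> \<Union>(ends X ` \<S>) \<and> q \<in> \<Union>(ends X ` \<S>) \<and> X closure_of c = insert p (insert q c)"
proof -
  obtain s0 where s0: "s0 \<in> \<S>" using arcs_nonempty by blast
  obtain q where q: "q \<in> s0" "q \<notin> ends X s0"
    using line_segment_properties(4)[OF arc[OF s0]] ends_subset[of X s0] by auto
  have qC: "q \<in> C" using q(1) arc_subset[OF s0] by auto
  obtain r where r: "homeomorphic_map (subtopology X (C - {q})) (top_of_set (UNIV::real set)) r"
    using chart[OF qC] by blast
  have sub: "C - {q} \<subseteq> topspace X" using C_subset by blast
  have inj: "inj_on r (C - {q})" and surj: "r ` (C - {q}) = UNIV" using chart_inj[OF r sub] by simp_all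
  let ?N = "C - \<Union>\<S>"
  have Nq: "?N \<subseteq> C - {q}" using q s0 by blast
  have cN: "c \<subseteq> ?N" using gap_subset[OF c] .
  have openN: "open (r ` ?N)" using chart_openin[OF r Nq] complement_open by simp
  have bddN: "bounded (r ` ?N)"
  proof -
    have "closedin (subtopology X C) (C - (s0 - ends X s0))"
      using arc_interior_open[OF arc arc_subset] s0 C_subset by (metis closedin_diff closedin_topspace topspace_subtopology_subset)
    then have "closedin X (C - (s0 - ends X s0))" using closed_C closedin_trans_full by blast
    then have "compactin X (C - (s0 - ends X s0))" using closed_compactin[OF compact_C] by blast
    moreover have sub': "C - (s0 - ends X s0) \<subseteq> C - {q}" using q by blast
    ultimately have "compact (r ` (C - (s0 - ends X s0)))" using chart_compactin[OF r sub sub'] by simp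
    moreover have "?N \<subseteq> C - (s0 - ends X s0)" using s0 by blast
    ultimately show ?thesis by (meson bounded_subset compact_imp_bounded image_mono)
  qed
  have comp: "r ` c \<in> components (r ` ?N)"
    unfolding in_components_maximal
  proof (intro conjI allI impI)
    show "r ` c \<noteq> {}" using gap_nonempty[OF c] by simp
    show "r ` c \<subseteq> r ` ?N" using cN by blast
    show "connected (r ` c)" using chart_connectedin[OF r sub, of c] gap_connected[OF c] cN Nq by blast
    fix D assume D: "D \<noteq> {} \<and> r ` c \<subseteq> D \<and> D \<subseteq> r ` ?N \<and> connected D"
    define T where "T = {x \<in> ?N. r x \<in> D}"
    have rT: "r ` T = D" using D by (auto simp: T_def)
    have "T \<subseteq> C - {q}" using Nq by (auto simp: T_def)
    then have "connectedin X T" using chart_connectedin[OF r sub] rT D by simp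
    moreover have "c \<subseteq> T" using D cN by (auto simp: T_def)
    ultimately have "T \<subseteq> c" using gap_maximal[OF c, of T] gap_nonempty[OF c] by (auto simp: T_def)
    then show "D = r ` c" using rT D by blast
  qed
  have opn: "open (r ` c)" using open_components[OF openN comp] .
  then show openc: "openin (subtopology X C) c" using chart_openin[OF r, of c] cN Nq by blast
  have "connected (r ` c)" "r ` c \<noteq> {}" "bounded (r ` c)"
    using comp in_components_connected in_components_nonempty bounded_subset[OF bddN] in_components_subset by blast+
  then obtain x y where xy: "x < y" "r ` c = {x<..<y}" using connected_open_bounded_real opn by metis
  obtain p p' where p: "p \<in> C - {q}" "r p = x" and p': "p' \<in> C - {q}" "r p' = y"
    using surj by (metis UNIV_I imageE)
  (* An end point of the interval outside the arcs could be added to the component. *)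
  have notN: "z \<notin> r ` ?N" if z: "z = x \<or> z = y" for z
  proof
    assume zN: "z \<in> r ` ?N"
    have "insert z {x<..<y} = {x..<y} \<or> insert z {x<..<y} = {x<..y}" using z xy(1) by auto
    then have "connected (insert z (r ` c))" unfolding xy(2) by (elim disjE) simp_all
    moreover have "insert z (r ` c) \<subseteq> r ` ?N" using zN cN by blast
    moreover have "r ` c \<subseteq> insert z (r ` c)" "insert z (r ` c) \<noteq> {}" by auto
    moreover have "\<And>D. D \<noteq> {} \<and> r ` c \<subseteq> D \<and> D \<subseteq> r ` ?N \<and> connected D \<Longrightarrow> D = r ` c"
      using comp by (simp add: in_components_maximal)
    ultimately have "insert z (r ` c) = r ` c" by simp
    then show False using xy(2) z by auto
  qed
  let ?K = "insert p (insert p' c)"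
  have Kq: "?K \<subseteq> C - {q}" using p p' cN Nq by blast
  have rK: "r ` ?K = {x..y}" using xy p p' by auto
  have "compactin X ?K" using chart_compactin[OF r sub Kq] rK by simp
  then have closedK: "closedin X ?K" using Hausdorff compactin_imp_closedin by blast
  have dense: "z \<in> X closure_of c" if "z \<in> ?K" for z
  proof -
    have "r z \<in> closure (r ` c)" using that rK xy by (metis closure_greaterThanLessThan image_eqI)
    then show ?thesis using chart_closure_of[OF r sub, of c z] cN Nq that Kq by blast
  qed
  have closure: "X closure_of c = ?K"
    using closure_of_minimal[OF _ closedK, of c] dense by blast
  have ends: "z \<in> \<Union>(ends X ` \<S>)" if z: "z \<in> C - {q}" "z \<notin> ?N" "z \<in> X closure_of c" for z
  proof -
    obtain s where s: "s \<in> \<S>" "z \<in> s" using z by blast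
    have "z \<notin> s - ends X s"
    proof
      assume zs: "z \<in> s - ends X s"
      obtain V where V: "openin X V" "s - ends X s = V \<inter> C"
        using arc_interior_open[OF arc[OF s(1)] arc_subset[OF s(1)]] by (auto simp: openin_subtopology)
      then have "V \<inter> c \<noteq> {}" using z(3) zs unfolding in_closure_of by blast
      then show False using V cN s(1) by blast
    qed
    then show ?thesis using s by blast
  qed
  have "p \<notin> ?N" "p' \<notin> ?N" using notN p p' by blast+
  then have "p \<in> \<Union>(ends X ` \<S>)" "p' \<in> \<Union>(ends X ` \<S>)"
    using ends p p' dense by blast+
  moreover have "p \<noteq> p'" using p p' xy(1) by auto
  ultimately show "\<exists>p q. p \<noteq> q \<and> p \<in> \<Union>(ends X ` \<S>) \<and> q \<in> \<Union>(ends X ` \<S>) \<and> X closure_of c = insert p (insert q c)"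
    using closure by blast
qed

text \<open>Immediately outside an end of an arc lies a short interval that avoids all arcs, since these are closed
  and disjoint. It belongs to one gap, and any gap approaching the end must meet it.\<close>

lemma ends_in_unique_gap:
  assumes s: "s \<in> \<S>" and p: "p \<in> ends X s"
  shows "\<exists>!c. c \<in> gaps \<and> p \<in> X closure_of c"
proof -
  obtain q r b where q: "q \<in> C - s"
    and r: "homeomorphic_map (subtopology X (C - {q})) (top_of_set (UNIV::real set)) r"
    and rs: "r p = 0" "b > 0" "r ` s = {0..b}" "r ` (s - ends X s) = {0<..<b}"
    using arc_chart[OF arc[OF s] arc_subset[OF s] p] .
  have sub: "C - {q} \<subseteq> topspace X" using C_subset by blast
  have inj: "inj_on r (C - {q})" and surj: "r ` (C - {q}) = UNIV" using chart_inj[OF r sub] by simp_all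
  have ps: "p \<in> s" using p ends_subset by fast
  have sq: "s \<subseteq> C - {q}" using q s arc_subset by blast
  let ?M = "(C - {q}) - \<Union>(\<S> - {s})"
  have "openin (subtopology X C) ?M"
  proof -
    have "closedin X (\<Union>(\<S> - {s}))" using finite_arcs arc_closed by (intro closedin_Union) auto
    then have "openin (subtopology X C) (C \<inter> (topspace X - \<Union>(\<S> - {s})))"
      by (metis openin_diff openin_subtopology_Int2 openin_topspace)
    then have "openin (subtopology X C) ((C - {q}) \<inter> (C \<inter> (topspace X - \<Union>(\<S> - {s}))))"
      using openin_punctured by (rule openin_Int[rotated])
    moreover have "(C - {q}) \<inter> (C \<inter> (topspace X - \<Union>(\<S> - {s}))) = ?M" using C_subset by blast
    ultimately show ?thesis by simp
  qed
  then have "open (r ` ?M)" using chart_openin[OF r, of ?M] by blast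
  moreover have "p \<in> ?M" using ps sq arcs_disjoint[OF s] by blast
  then have "0 \<in> r ` ?M" using rs(1) by (metis (no_types, lifting) image_eqI)
  ultimately obtain d0 where d0: "d0 > 0" "ball 0 d0 \<subseteq> r ` ?M" using open_contains_ball by metis
  (* The bound by b keeps the neighbourhood short of the other end of the arc. *)
  define d where "d = min d0 b"
  have d: "d > 0" "d \<le> b" "{-d<..<d} \<subseteq> r ` ?M"
    using d0 rs(2) by (auto simp: d_def subset_iff dist_real_def)
  define J where "J = {x \<in> C - {q}. r x \<in> {-d<..<0}}"
  have Jq: "J \<subseteq> C - {q}" by (auto simp: J_def)
  have rJ: "r ` J = {-d<..<0}"
  proof
    show "{-d<..<0} \<subseteq> r ` J"
    proof
      fix t assume t: "t \<in> {-d<..<0}"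
      then obtain x where "x \<in> C - {q}" "r x = t" using surj by (metis UNIV_I imageE)
      then show "t \<in> r ` J" using t unfolding J_def by blast
    qed
  qed (auto simp: J_def)
  have J_N: "J \<subseteq> C - \<Union>\<S>"
  proof
    fix x assume x: "x \<in> J"
    then have xq: "x \<in> C - {q}" and rx: "r x < 0" "r x \<in> {-d<..<d}" by (auto simp: J_def)
    then obtain y where y: "y \<in> ?M" "r y = r x" using subsetD[OF d(3) rx(2)] by (metis imageE)
    then have "y = x" using inj_onD[OF inj y(2)] xq by blast
    then have "x \<in> ?M" using y(1) by simp
    moreover have "x \<notin> s" using rs(3) rx(1) by (metis atLeastAtMost_iff image_eqI not_le)
    ultimately show "x \<in> C - \<Union>\<S>" by blast
  qed
  have "connectedin X J" using chart_connectedin[OF r sub Jq] rJ by simp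
  have "J \<noteq> {}" using rJ d(1) by auto
  then obtain c where c: "c \<in> gaps" "c \<inter> J \<noteq> {}" using J_N gaps_cover by blast
  then have Jc: "J \<subseteq> c" using gap_maximal \<open>connectedin X J\<close> J_N by blast
  have "p \<in> X closure_of J"
  proof -
    have "(0::real) \<in> closure {-d<..<0}" using d(1) by simp
    then show ?thesis using chart_closure_of[OF r sub Jq, of p] rJ rs(1) ps sq by auto
  qed
  then have pc: "p \<in> X closure_of c" using closure_of_mono[OF Jc] by blast
  have "c' = c" if c': "c' \<in> gaps" "p \<in> X closure_of c'" for c'
  proof -
    define U where "U = {x \<in> C - {q}. r x \<in> {-d<..<b}}"
    have Uq: "U \<subseteq> C - {q}" by (auto simp: U_def)
    have "r ` U = {-d<..<b}"
    proof
      show "{-d<..<b} \<subseteq> r ` U"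
      proof
        fix t assume t: "t \<in> {-d<..<b}"
        then obtain x where "x \<in> C - {q}" "r x = t" using surj by (metis UNIV_I imageE)
        then show "t \<in> r ` U" using t unfolding U_def by blast
      qed
    qed (auto simp: U_def)
    then have "openin (subtopology X C) U" using chart_openin[OF r Uq] by simp
    then obtain V where V: "openin X V" "U = V \<inter> C" by (auto simp: openin_subtopology)
    have "p \<in> U" using ps sq rs(1,2) d(1) by (auto simp: U_def)
    then have "V \<inter> c' \<noteq> {}" using V c'(2) unfolding in_closure_of by blast
    then obtain x where x: "x \<in> c'" "x \<in> U" using V gap_subset[OF c'(1)] by blast
    have xN: "x \<in> C - \<Union>\<S>" using x(1) gap_subset[OF c'(1)] by blast
    have "r x \<notin> {0..b}"
    proof
      assume "r x \<in> {0..b}"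
      then obtain z where "z \<in> s" "r z = r x" using rs(3) by (metis imageE)
      then have "x \<in> s" using inj sq x(2) Uq by (metis inj_onD subsetD)
      then show False using xN s by blast
    qed
    then have "x \<in> J" using x(2) by (auto simp: U_def J_def)
    then show ?thesis using x(1) Jc gaps_eq[OF c'(1) c(1)] by blast
  qed
  then show ?thesis using c(1) pc by blast
qed

end

context topological_circle
begin

text \<open>A single arc has just two ends; each gap uses both of them and each end belongs to one gap, so there is
  only one gap.\<close>

lemma arc_complement_connected:
  assumes s: "line_segment X s" "s \<subseteq> C"
  shows "connectedin X (C - s)"
proof -
  interpret A: arcs_on_circle X C "{s}" by unfold_locales (use s in auto)
  obtain a b where ab: "a \<noteq> b" "ends X s = {a, b}" using line_segment_properties(3)[OF s(1)] by blast
  have same: "c = c'" if c: "c \<in> A.gaps" "c' \<in> A.gaps" for c c'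
  proof -
    obtain p q where pq: "p \<noteq> q" "p \<in> {a, b}" "q \<in> {a, b}" "X closure_of c = insert p (insert q c)"
      using A.gap_structure(2)[OF c(1)] ab(2) by auto
    obtain p' q' where pq': "p' \<noteq> q'" "p' \<in> {a, b}" "q' \<in> {a, b}" "X closure_of c' = insert p' (insert q' c')"
      using A.gap_structure(2)[OF c(2)] ab(2) by auto
    have "a \<in> X closure_of c" "a \<in> X closure_of c'" using pq pq' by auto
    then show ?thesis using A.ends_in_unique_gap[of s a] ab c by auto
  qed
  obtain c where c: "c \<in> A.gaps" using A.ends_in_unique_gap[of s a] ab by auto
  have "\<Union>A.gaps = c" using same c by blast
  then have "c = C - s" using A.gaps_cover by simp
  then show ?thesis using A.gap_connected[OF c] by simp
qed

end

context arcs_on_circle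
begin

text \<open>If both ends of a gap lie on the arc \<open>s\<close>, the gap is open and closed in the complement of \<open>s\<close>, which is
  connected; so the gap fills that complement and leaves no room for other arcs.\<close>

lemma gap_within_one_arc:
  assumes c: "c \<in> gaps" and s: "s \<in> \<S>" and cl: "X closure_of c \<subseteq> c \<union> s"
  shows "\<S> = {s}"
proof -
  have cs: "c \<subseteq> C - s" using gap_subset[OF c] s by blast
  have "openin (subtopology X C) c" by (rule gap_structure(1)[OF c])
  then have "openin (subtopology (subtopology X C) (C - s)) c"
    using cs by (metis Int_absorb2 openin_subtopology_Int)
  then have o: "openin (subtopology X (C - s)) c"
    by (simp only: subtopology_subtopology Int_absorb1 Diff_subset)
  have "c = (C - s) \<inter> X closure_of c"
    using cs cl closure_of_subset[of c X] C_subset by blast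
  then have "closedin (subtopology X (C - s)) c"
    by (metis closedin_closure_of closedin_subtopology_Int_closed inf_commute)
  moreover have "connected_space (subtopology X (C - s))"
    using arc_complement_connected[OF arc[OF s] arc_subset[OF s]] by (simp add: connectedin_def)
  ultimately have "c = topspace (subtopology X (C - s))"
    using o gap_nonempty[OF c] unfolding connected_space_clopen_in by blast
  then have "c = C - s" using C_subset by auto
  then have "\<Union>\<S> \<subseteq> s" using gap_subset[OF c] arc_subset by blast
  then have "s' = s" if "s' \<in> \<S>" for s'
    using arcs_disjoint[OF that s] that line_segment_properties(3)[OF arc[OF that]] ends_subset[of X s'] by blast
  then show ?thesis using s by blast
qed

end


section \<open>Gluing two discs along an arc\<close>

text \<open>A pasting lemma for homeomorphisms: with closed pieces on both sides, the union of two closed maps is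
  closed, so the inverse is continuous without being constructed.\<close>

lemma homeomorphic_map_glue:
  assumes X: "closedin X A" "closedin X B" "topspace X = A \<union> B"
    and Y: "closedin Y A'" "closedin Y B'" "topspace Y = A' \<union> B'"
    and f: "homeomorphic_map (subtopology X A) (subtopology Y A') f"
    and g: "homeomorphic_map (subtopology X B) (subtopology Y B') g"
    and agree: "\<And>x. x \<in> A \<Longrightarrow> x \<in> B \<Longrightarrow> f x = g x"
    and sep: "\<And>x y. x \<in> A \<Longrightarrow> y \<in> B \<Longrightarrow> f x = g y \<Longrightarrow> x = y"
  shows "homeomorphic_map X Y (\<lambda>x. if x \<in> A then f x else g x)" (is "homeomorphic_map X Y ?h")
proof (rule bijective_closed_imp_homeomorphic_map)
  have top: "topspace (subtopology X A) = A" "topspace (subtopology X B) = B"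
    "topspace (subtopology Y A') = A'" "topspace (subtopology Y B') = B'"
    using X(3) Y(3) by auto
  have fA: "f ` A = A'" "inj_on f A" and gB: "g ` B = B'" "inj_on g B"
    using homeomorphic_imp_surjective_map[OF f] homeomorphic_imp_injective_map[OF f]
      homeomorphic_imp_surjective_map[OF g] homeomorphic_imp_injective_map[OF g] unfolding top by simp_all
  have hB: "?h x = g x" if "x \<in> B" for x using agree that by simp
  have him: "?h ` K = f ` (K \<inter> A) \<union> g ` (K \<inter> B)" if "K \<subseteq> A \<union> B" for K
  proof -
    have "?h ` (K \<inter> A) = f ` (K \<inter> A)" by (rule image_cong) auto
    moreover have "?h ` (K \<inter> B) = g ` (K \<inter> B)" using hB by (intro image_cong) auto
    moreover have K: "K = (K \<inter> A) \<union> (K \<inter> B)" using that by blast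
    have "?h ` K = ?h ` (K \<inter> A) \<union> ?h ` (K \<inter> B)"
      using arg_cong[OF K, of "image ?h"] by (simp only: image_Un)
    ultimately show ?thesis by simp
  qed
  show "continuous_map X Y ?h"
  proof (rule pasting_lemma_closed[where I = "UNIV :: bool set" and T = "\<lambda>b. if b then A else B"
        and f = "\<lambda>b. if b then f else g"])
    show "continuous_map (subtopology X (if b then A else B)) Y (if b then f else g)" for b
      using homeomorphic_imp_continuous_map[OF f] homeomorphic_imp_continuous_map[OF g]
      by (cases b) (simp_all add: continuous_map_in_subtopology)
    show "\<exists>j. j \<in> (UNIV::bool set) \<and> x \<in> (if j then A else B) \<and> ?h x = (if j then f else g) x"
      if "x \<in> topspace X" for x
      using that X(3) by (intro exI[of _ "x \<in> A"]) auto
  qed (use X agree in \<open>auto split: if_splits\<close>)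
  show "closed_map X Y ?h"
    unfolding closed_map_def
  proof (intro allI impI)
    fix K assume K: "closedin X K"
    have "closedin (subtopology X A) (K \<inter> A)" "closedin (subtopology X B) (K \<inter> B)"
      using K by (simp_all add: closedin_subtopology_Int_closed Int_commute)
    then have "closedin (subtopology Y A') (f ` (K \<inter> A))" "closedin (subtopology Y B') (g ` (K \<inter> B))"
      using homeomorphic_map_closedness_eq[OF f] homeomorphic_map_closedness_eq[OF g] by simp_all
    then have "closedin Y (f ` (K \<inter> A))" "closedin Y (g ` (K \<inter> B))"
      using Y closedin_trans_full by metis+
    moreover have "K \<subseteq> A \<union> B" using closedin_subset[OF K] X(3) by simp
    ultimately show "closedin Y (?h ` K)" by (simp only: him closedin_Un)
  qed
  show "?h ` topspace X = topspace Y" unfolding X(3) Y(3) him[OF order_refl]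
    using fA(1) gB(1) by (simp add: Int_absorb1)
  show "inj_on ?h (topspace X)"
  proof (rule inj_onI)
    fix x y assume xy: "x \<in> topspace X" "y \<in> topspace X" "?h x = ?h y"
    then consider "x \<in> A" "y \<in> A" | "x \<in> A" "y \<in> B" "y \<notin> A" | "x \<in> B" "x \<notin> A" "y \<in> A" | "x \<in> B" "y \<in> B" "x \<notin> A" "y \<notin> A"
      using X(3) by blast
    then show "x = y"
    proof cases
      case 1 then show ?thesis using xy(3) fA(2) by (simp add: inj_on_def)
    next
      case 2 then show ?thesis using xy(3) sep[of x y] by simp
    next
      case 3 then show ?thesis using xy(3) sep[of y x] by simp
    next
      case 4 then show ?thesis using xy(3) gB(2) by (simp add: inj_on_def)
    qed
  qed
qed

lemma homeomorphism_of_top_of_set: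
  assumes "homeomorphic_map (top_of_set A) (top_of_set B) f"
  obtains g where "homeomorphism A B f g"
proof -
  obtain g where g: "homeomorphic_maps (top_of_set A) (top_of_set B) f g"
    using assms homeomorphic_map_maps by blast
  have "homeomorphism A B f g"
    using g unfolding homeomorphic_maps_def continuous_map_in_subtopology
    by (intro homeomorphismI) auto
  then show thesis by (rule that)
qed

lemma disc_boundary_compactin:
  assumes D: "topological_disc X D"
  shows "compactin X (disc_boundary X D)"
proof -
  have DX: "D \<subseteq> topspace X" using D by (simp add: topological_disc_def)
  have "closedin (subtopology X D) (disc_boundary X D)"
    unfolding disc_boundary_def by (rule closedin_surface_boundary)
  moreover have "compactin (subtopology X D) D"
    using disc_compactin[OF D] by (simp add: compactin_subtopology)
  ultimately have "compactin (subtopology X D) (disc_boundary X D)"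
    using closed_compactin[OF _ disc_boundary_subset] by metis
  then show ?thesis by (simp add: compactin_subtopology)
qed

lemma disc_boundary_chart:
  assumes D: "topological_disc X D" and f: "homeomorphic_map (subtopology X (D - {q})) (top_of_set half_plane) f"
    and bd: "\<And>z. z \<in> D - {q} \<Longrightarrow> z \<in> disc_boundary X D \<longleftrightarrow> Im (f z) = 0"
  shows "homeomorphic_map (subtopology X (disc_boundary X D - {q})) (top_of_set UNIV) (Re \<circ> f)"
proof -
  have DX: "D \<subseteq> topspace X" using D by (simp add: topological_disc_def)
  have "homeomorphic_map (subtopology (subtopology X (D - {q})) (disc_boundary X D - {q}))
      (subtopology (top_of_set half_plane) {z. Im z = 0}) f"
  proof (rule homeomorphic_map_subtopologies_alt[OF f])
    fix x assume "x \<in> topspace (subtopology X (D - {q}))"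
    then have "x \<in> D - {q}" by simp
    then show "f x \<in> {z. Im z = 0} \<longleftrightarrow> x \<in> disc_boundary X D - {q}" using bd by auto
  qed
  moreover have "(D - {q}) \<inter> (disc_boundary X D - {q}) = disc_boundary X D - {q}"
    using disc_boundary_subset[of X D] by blast
  moreover have "half_plane \<inter> {z. Im z = 0} = {z. Im z = 0}" by auto
  ultimately have "homeomorphic_map (subtopology X (disc_boundary X D - {q})) (top_of_set {z. Im z = 0}) f"
    by (simp only: subtopology_subtopology)
  moreover have "homeomorphism {z. Im z = 0} UNIV Re complex_of_real"
    by (rule homeomorphismI) (auto intro!: continuous_intros simp: complex_eq_iff)
  ultimately show ?thesis using homeomorphic_map_top_of_set homeomorphic_map_compose by blast
qed

lemma disc_boundary_circle:
  assumes D: "topological_disc X D" and H: "Hausdorff_space X"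
  shows "topological_circle X (disc_boundary X D)"
proof
  show "Hausdorff_space X" by (rule H)
  show "compactin X (disc_boundary X D)" using D by (rule disc_boundary_compactin)
  show "disc_boundary X D \<noteq> {}" using disc_boundary_has_other_point[OF D] by blast
  fix q assume "q \<in> disc_boundary X D"
  then obtain f where "homeomorphic_map (subtopology X (D - {q})) (top_of_set half_plane) f"
    "\<And>z. z \<in> D - {q} \<Longrightarrow> z \<in> disc_boundary X D \<longleftrightarrow> Im (f z) = 0"
    using disc_chart[OF D] by metis
  then show "\<exists>r. homeomorphic_map (subtopology X (disc_boundary X D - {q})) (top_of_set (UNIV::real set)) r"
    using disc_boundary_chart[OF D] by blast
qed

abbreviation half_strip :: "real \<Rightarrow> real \<Rightarrow> complex set" where
  "half_strip a b \<equiv> {w. a < Re w \<and> Re w < b \<and> 0 \<le> Im w}"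

text \<open>In a half-plane chart the points above an arc of the boundary form a half-strip.\<close>

lemma disc_half_strip:
  assumes D: "topological_disc X D" and H: "Hausdorff_space X"
    and s: "line_segment X s" "s \<subseteq> disc_boundary X D"
  obtains U f a b where "U \<subseteq> D" "closedin X (D - U)" "a < b"
    "homeomorphic_map (subtopology X U) (top_of_set (half_strip a b)) f"
    "U \<inter> disc_boundary X D = s - ends X s" "\<forall>x\<in>U. Im (f x) = 0 \<longleftrightarrow> x \<in> s"
    "homeomorphic_map (subtopology X (s - ends X s)) (top_of_set {a<..<b}) (Re \<circ> f)"
proof -
  interpret topological_circle X "disc_boundary X D" using D H by (rule disc_boundary_circle)
  have DX: "D \<subseteq> topspace X" using D by (simp add: topological_disc_def)
  obtain p where "p \<in> ends X s" using line_segment_properties(3)[OF s(1)] by blast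
  then obtain q where q: "q \<in> disc_boundary X D" "q \<notin> s" using arc_chart[OF s] by (metis DiffE)
  have qD: "q \<in> D" using q(1) disc_boundary_subset[of X D] by blast
  obtain f where f: "homeomorphic_map (subtopology X (D - {q})) (top_of_set half_plane) f"
    and bd: "\<And>z. z \<in> D - {q} \<Longrightarrow> z \<in> disc_boundary X D \<longleftrightarrow> Im (f z) = 0"
    using disc_chart[OF D q(1)] by metis
  have subD: "D - {q} \<subseteq> topspace X" using DX by blast
  note inj = chart_inj[OF f subD]
  have Rf: "homeomorphic_map (subtopology X (disc_boundary X D - {q})) (top_of_set UNIV) (Re \<circ> f)"
    using disc_boundary_chart[OF D f bd] .
  have sub: "disc_boundary X D - {q} \<subseteq> topspace X" using C_subset by blast
  have sq: "s \<subseteq> disc_boundary X D - {q}" using s(2) q(2) by blast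
  obtain a b where ab: "a < b" "(Re \<circ> f) ` s = {a..b}"
    "\<And>p. p \<in> s \<Longrightarrow> p \<in> ends X s \<longleftrightarrow> (Re \<circ> f) p = a \<or> (Re \<circ> f) p = b"
    using line_segment_image[OF s(1) Rf sub sq] by metis
  note Rinj = chart_inj[OF Rf sub]
  define U where "U = {x \<in> D - {q}. a < Re (f x) \<and> Re (f x) < b}"
  have UD: "U \<subseteq> D - {q}" by (auto simp: U_def)
  have arc_iff: "x \<in> s - ends X s \<longleftrightarrow> a < Re (f x) \<and> Re (f x) < b" if x: "x \<in> disc_boundary X D - {q}" for x
  proof
    assume xs: "x \<in> s - ends X s"
    then have "(Re \<circ> f) x \<in> {a..b}" using ab(2) by blast
    moreover have "(Re \<circ> f) x \<noteq> a" "(Re \<circ> f) x \<noteq> b" using xs ab(3) by auto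
    ultimately show "a < Re (f x) \<and> Re (f x) < b" by auto
  next
    assume less: "a < Re (f x) \<and> Re (f x) < b"
    then have "(Re \<circ> f) x \<in> (Re \<circ> f) ` s" unfolding ab(2) by simp
    then obtain y where y: "y \<in> s" "(Re \<circ> f) x = (Re \<circ> f) y" by blast
    then have "x = y" using inj_onD[OF Rinj(1) y(2)] x sq by blast
    then show "x \<in> s - ends X s" using y(1) ab(3)[of x] less by auto
  qed
  have int: "U \<inter> disc_boundary X D = s - ends X s"
  proof (intro set_eqI iffI)
    fix x assume "x \<in> U \<inter> disc_boundary X D"
    then show "x \<in> s - ends X s" using arc_iff[of x] by (auto simp: U_def)
  next
    fix x assume x: "x \<in> s - ends X s"
    then have "x \<in> disc_boundary X D - {q}" using sq by blast
    then show "x \<in> U \<inter> disc_boundary X D"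
      using arc_iff[of x] x disc_boundary_subset[of X D] by (auto simp: U_def)
  qed
  have "homeomorphic_map (subtopology (subtopology X (D - {q})) U) (subtopology (top_of_set half_plane) (half_strip a b)) f"
  proof (rule homeomorphic_map_subtopologies_alt[OF f])
    fix x assume "x \<in> topspace (subtopology X (D - {q}))" "f x \<in> topspace (top_of_set half_plane)"
    then show "f x \<in> half_strip a b \<longleftrightarrow> x \<in> U" by (auto simp: U_def)
  qed
  moreover have "half_plane \<inter> half_strip a b = half_strip a b" by auto
  ultimately have fU: "homeomorphic_map (subtopology X U) (top_of_set (half_strip a b)) f"
    using UD by (simp only: subtopology_subtopology Int_absorb1)
  have "closedin X (D - U)"
  proof -
    have "continuous_map (subtopology X (D - {q})) euclidean f"
      using homeomorphic_imp_continuous_map[OF f] by (simp add: continuous_map_in_subtopology)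
    moreover have "open {w. a < Re w \<and> Re w < b}"
      using open_halfspace_Re_gt[of a] open_halfspace_Re_lt[of b] by (simp add: open_Int Collect_conj_eq)
    then have "openin euclidean {w. a < Re w \<and> Re w < b}" by (simp only: open_openin)
    ultimately have "openin (subtopology X (D - {q})) {x \<in> topspace (subtopology X (D - {q})). f x \<in> {w. a < Re w \<and> Re w < b}}"
      by (rule openin_continuous_map_preimage)
    moreover have "{x \<in> topspace (subtopology X (D - {q})). f x \<in> {w. a < Re w \<and> Re w < b}} = U"
      using DX by (auto simp: U_def)
    ultimately have "openin (subtopology X (D - {q})) U" by simp
    moreover have "subtopology X (D - {q}) = subtopology (subtopology X D) (D - {q})"
      by (simp only: subtopology_subtopology Int_absorb1 Diff_subset)
    moreover have "openin (subtopology X D) (D - {q})"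
    proof -
      have "closedin X {q}" using H qD DX by (simp add: closedin_Hausdorff_singleton subset_iff)
      then have "openin (subtopology X D) (D \<inter> (topspace X - {q}))"
        by (metis openin_diff openin_subtopology_Int2 openin_topspace)
      moreover have "D \<inter> (topspace X - {q}) = D - {q}" using DX by blast
      ultimately show ?thesis by simp
    qed
    ultimately have "openin (subtopology X D) U" using openin_trans_full by metis
    then have "closedin (subtopology X D) (D - U)"
      using DX by (metis closedin_diff closedin_topspace topspace_subtopology_subset)
    moreover have "closedin X D" using compactin_imp_closedin[OF H disc_compactin[OF D]] .
    ultimately show ?thesis by (rule closedin_trans_full)
  qed
  moreover have "Im (f x) = 0 \<longleftrightarrow> x \<in> s" if x: "x \<in> U" for x
  proof -
    have xD: "x \<in> D - {q}" using x UD by blast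
    show ?thesis
    proof
      assume "Im (f x) = 0"
      then have "x \<in> U \<inter> disc_boundary X D" using bd[OF xD] x by blast
      then show "x \<in> s" using int by blast
    next
      assume "x \<in> s"
      then show "Im (f x) = 0" using bd[OF xD] s(2) by blast
    qed
  qed
  moreover have "homeomorphic_map (subtopology X (s - ends X s)) (top_of_set {a<..<b}) (Re \<circ> f)"
  proof -
    have "homeomorphic_map (subtopology (subtopology X (disc_boundary X D - {q})) (s - ends X s))
        (subtopology (top_of_set UNIV) {a<..<b}) (Re \<circ> f)"
    proof (rule homeomorphic_map_subtopologies_alt[OF Rf])
      fix x assume "x \<in> topspace (subtopology X (disc_boundary X D - {q}))"
      then show "(Re \<circ> f) x \<in> {a<..<b} \<longleftrightarrow> x \<in> s - ends X s" using arc_iff[of x] by auto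
    qed
    moreover have "s - ends X s \<subseteq> disc_boundary X D - {q}" using sq by blast
    ultimately show ?thesis by (simp only: subtopology_subtopology Int_absorb1 Int_UNIV_left)
  qed
  moreover have "U \<subseteq> D" using UD by blast
  ultimately show thesis by (intro that[of U a b f] ballI ab(1) fU int) simp_all
qed

text \<open>A reparametrisation of the bounding interval extends to the half-strip by leaving heights alone. The
  reflection prepares for gluing below another half-strip.\<close>

lemma stretch_half_strip:
  assumes "homeomorphism {c<..<d} {a<..<b} \<theta> \<theta>'"
  shows "homeomorphic_map (top_of_set (half_strip c d)) (top_of_set {w. a < Re w \<and> Re w < b \<and> Im w \<le> 0})
    (\<lambda>w. Complex (\<theta> (Re w)) (- Im w))"
proof (rule homeomorphic_map_top_of_set)
  have t: "continuous_on {c<..<d} \<theta>" "continuous_on {a<..<b} \<theta>'"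
    and im: "\<And>x. x \<in> {c<..<d} \<Longrightarrow> \<theta> x \<in> {a<..<b}" "\<And>y. y \<in> {a<..<b} \<Longrightarrow> \<theta>' y \<in> {c<..<d}"
    and inv: "\<And>x. x \<in> {c<..<d} \<Longrightarrow> \<theta>' (\<theta> x) = x" "\<And>y. y \<in> {a<..<b} \<Longrightarrow> \<theta> (\<theta>' y) = y"
    using assms unfolding homeomorphism_def by blast+
  let ?A = "half_strip c d" and ?B = "{w. a < Re w \<and> Re w < b \<and> Im w \<le> 0}"
  show "homeomorphism ?A ?B (\<lambda>w. Complex (\<theta> (Re w)) (- Im w)) (\<lambda>w. Complex (\<theta>' (Re w)) (- Im w))"
  proof (rule homeomorphismI)
    have "continuous_on ?A (\<lambda>w. \<theta> (Re w))"
      by (rule continuous_on_compose2[OF t(1)]) (auto intro!: continuous_intros)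
    then show "continuous_on ?A (\<lambda>w. Complex (\<theta> (Re w)) (- Im w))"
      by (intro continuous_on_Complex continuous_intros)
    have "continuous_on ?B (\<lambda>w. \<theta>' (Re w))"
      by (rule continuous_on_compose2[OF t(2)]) (auto intro!: continuous_intros)
    then show "continuous_on ?B (\<lambda>w. Complex (\<theta>' (Re w)) (- Im w))"
      by (intro continuous_on_Complex continuous_intros)
  qed (use im inv in auto)
qed

text \<open>Two half-strips above the common arc are glued to a full strip. Their charts induce different
  parametrisations of the arc, so the second one is first stretched to match the first.\<close>

lemma glued_discs_planar:
  assumes H: "Hausdorff_space X" and v: "topological_disc X v" and e: "topological_disc X e"
    and s: "line_segment X s" "s \<subseteq> disc_boundary X v" "s \<subseteq> disc_boundary X e"
    and int: "v \<inter> e \<subseteq> disc_boundary X v" "v \<inter> e \<subseteq> disc_boundary X e"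
    and z: "z \<in> s - ends X s"
  shows "locally_like UNIV (subtopology X (v \<union> e)) z"
proof -
  obtain U f a b where U: "U \<subseteq> v" "closedin X (v - U)" "a < b"
    and f: "homeomorphic_map (subtopology X U) (top_of_set (half_strip a b)) f"
    and Us: "U \<inter> disc_boundary X v = s - ends X s" and f0: "\<forall>x\<in>U. Im (f x) = 0 \<longleftrightarrow> x \<in> s"
    and fs: "homeomorphic_map (subtopology X (s - ends X s)) (top_of_set {a<..<b}) (Re \<circ> f)"
    by (rule disc_half_strip[OF v H s(1,2)]) (rule that)
  obtain V g c d where V: "V \<subseteq> e" "closedin X (e - V)" "c < d"
    and g: "homeomorphic_map (subtopology X V) (top_of_set (half_strip c d)) g"
    and Vs: "V \<inter> disc_boundary X e = s - ends X s" and g0: "\<forall>x\<in>V. Im (g x) = 0 \<longleftrightarrow> x \<in> s"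
    and gs: "homeomorphic_map (subtopology X (s - ends X s)) (top_of_set {c<..<d}) (Re \<circ> g)"
    by (rule disc_half_strip[OF e H s(1,3)]) (rule that)
  have vX: "v \<subseteq> topspace X" "e \<subseteq> topspace X" using v e by (simp_all add: topological_disc_def)
  have closed_ve: "closedin X v" "closedin X e"
    using compactin_imp_closedin[OF H disc_compactin] v e by blast+
  have UX: "U \<subseteq> topspace X" "V \<subseteq> topspace X" using vX U(1) V(1) by auto
  have sX: "s - ends X s \<subseteq> topspace X" using line_segment_subset[OF s(1)] by blast
  have UV: "U \<inter> e \<subseteq> s - ends X s" "V \<inter> v \<subseteq> s - ends X s" "s - ends X s \<subseteq> U" "s - ends X s \<subseteq> V"
    using Us Vs U(1) V(1) int by blast+
  obtain k where k: "homeomorphic_maps (subtopology X (s - ends X s)) (top_of_set {c<..<d}) (Re \<circ> g) k"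
    using gs homeomorphic_map_maps by blast
  have kinv: "k (Re (g x)) = x" if "x \<in> s - ends X s" for x
    using k that sX by (auto simp: homeomorphic_maps_def)
  have "homeomorphic_map (top_of_set {c<..<d}) (subtopology X (s - ends X s)) k"
    using k homeomorphic_maps_map by blast
  from homeomorphic_map_compose[OF this fs]
  obtain \<theta>' where th: "homeomorphism {c<..<d} {a<..<b} (Re \<circ> f \<circ> k) \<theta>'"
    using homeomorphism_of_top_of_set by blast
  let ?T = "\<lambda>w. Complex ((Re \<circ> f \<circ> k) (Re w)) (- Im w)"
  let ?S = "{w. a < Re w \<and> Re w < b}" and ?A = "half_strip a b" and ?B = "{w. a < Re w \<and> Re w < b \<and> Im w \<le> 0}"
  have g': "homeomorphic_map (subtopology X V) (top_of_set ?B) (?T \<circ> g)"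
    using g stretch_half_strip[OF th] by (rule homeomorphic_map_compose)
  let ?X = "subtopology X (U \<union> V)" and ?Y = "top_of_set ?S"
  have g'_s: "(?T \<circ> g) x = f x" if x: "x \<in> s - ends X s" for x
  proof -
    have "Im (g x) = 0" "Im (f x) = 0" using f0 g0 x UV by blast+
    then show ?thesis using kinv[OF x] by (simp add: complex_eq_iff)
  qed
  have "homeomorphic_map ?X ?Y (\<lambda>x. if x \<in> U then f x else (?T \<circ> g) x)"
  proof (rule homeomorphic_map_glue[where A' = ?A and B' = ?B])
    have "U = (U \<union> V) \<inter> v" "V = (U \<union> V) \<inter> e" using UV U(1) V(1) by blast+
    then show "closedin ?X U" "closedin ?X V"
      using closed_ve by (metis closedin_subtopology_Int_closed)+
    show "topspace ?X = U \<union> V" using UX by auto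
    show "topspace ?Y = ?A \<union> ?B" by auto
    have "closed {w. 0 \<le> Im w}" "closed {w. Im w \<le> 0}" by (simp_all add: closed_halfspace_Im_ge closed_halfspace_Im_le)
    then have "closedin ?Y (?S \<inter> {w. 0 \<le> Im w})" "closedin ?Y (?S \<inter> {w. Im w \<le> 0})"
      by (simp_all only: closedin_closed_Int)
    moreover have "?A = ?S \<inter> {w. 0 \<le> Im w}" "?B = ?S \<inter> {w. Im w \<le> 0}" by auto
    ultimately show "closedin ?Y ?A" "closedin ?Y ?B" by simp_all
    have "subtopology ?X U = subtopology X U" "subtopology ?X V = subtopology X V"
      by (simp_all only: subtopology_subtopology Int_absorb1 Un_upper1 Un_upper2)
    moreover have "subtopology ?Y ?A = top_of_set ?A" "subtopology ?Y ?B = top_of_set ?B"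
      by (simp_all add: subtopology_subtopology Int_absorb1 Collect_mono)
    ultimately show "homeomorphic_map (subtopology ?X U) (subtopology ?Y ?A) f"
      "homeomorphic_map (subtopology ?X V) (subtopology ?Y ?B) (?T \<circ> g)"
      using f g' by simp_all
    show "f x = (?T \<circ> g) x" if "x \<in> U" "x \<in> V" for x
      using g'_s[of x] that UV(1) V(1) by force
    show "x = y" if xy: "x \<in> U" "y \<in> V" "f x = (?T \<circ> g) y" for x y
    proof -
      have "f x \<in> ?A" using chart_inj(2)[OF f UX(1)] xy(1) by blast
      moreover have "(?T \<circ> g) y \<in> ?B" using chart_inj(2)[OF g' UX(2)] xy(2) by blast
      ultimately have "Im (f x) = 0" "Im ((?T \<circ> g) y) = 0" using xy(3) by auto
      then have "x \<in> s" "y \<in> s" using f0[rule_format, OF xy(1)] g0[rule_format, OF xy(2)] by auto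
      then have xs: "x \<in> s - ends X s" "y \<in> s - ends X s" using Us Vs xy(1,2) s(2,3) by blast+
      then have "(Re \<circ> f) x = (Re \<circ> f) y" using g'_s[OF xs(2)] xy(3) by simp
      then show "x = y" using inj_onD[OF chart_inj(1)[OF fs sX]] xs by blast
    qed
  qed
  then have "?X homeomorphic_space ?Y" by (rule homeomorphic_map_imp_homeomorphic_space)
  moreover have "subtopology (subtopology X (v \<union> e)) (U \<union> V) = ?X"
  proof -
    have "(v \<union> e) \<inter> (U \<union> V) = U \<union> V" using U(1) V(1) by blast
    then show ?thesis by (simp only: subtopology_subtopology)
  qed
  moreover have "openin (subtopology X (v \<union> e)) (U \<union> V)"
  proof -
    have "closedin X ((v - U) \<union> (e - V))" using U(2) V(2) by (rule closedin_Un)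
    moreover have "(v - U) \<union> (e - V) = (v \<union> e) - (U \<union> V)" using UV U(1) V(1) by blast
    ultimately have "closedin X ((v \<union> e) - (U \<union> V))" by simp
    then have "openin (subtopology X (v \<union> e)) ((v \<union> e) \<inter> (topspace X - ((v \<union> e) - (U \<union> V))))"
      by (metis openin_diff openin_subtopology_Int2 openin_topspace)
    moreover have "(v \<union> e) \<inter> (topspace X - ((v \<union> e) - (U \<union> V))) = U \<union> V" using vX U(1) V(1) by blast
    ultimately show ?thesis by simp
  qed
  moreover have "open ?S"
    using open_halfspace_Re_gt[of a] open_halfspace_Re_lt[of b] by (simp add: open_Int Collect_conj_eq)
  moreover have "z \<in> U \<union> V" using z UV(3) by blast
  ultimately show ?thesis
    unfolding locally_like_def by (intro exI[of _ "U \<union> V"] exI[of _ ?S]) simp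
qed

section \<open>Connected unions of closed pieces\<close>

text \<open>The right-hand side says that the intersection graph is connected. It is phrased with 2-colourings because
  these correspond to separations: a colouring that is constant on adjacent pieces splits the union into
  two disjoint closed sets, and a separation colours every piece.\<close>

lemma connectedin_Union_iff:
  assumes fin: "finite \<A>" and A: "\<And>A. A \<in> \<A> \<Longrightarrow> closedin X A \<and> connectedin X A \<and> A \<noteq> {}"
  shows "connectedin X (\<Union>\<A>) \<longleftrightarrow>
    (\<forall>g :: 'a set \<Rightarrow> bool. (\<forall>A\<in>\<A>. \<forall>B\<in>\<A>. A \<inter> B \<noteq> {} \<longrightarrow> g A = g B) \<longrightarrow> (\<forall>A\<in>\<A>. \<forall>B\<in>\<A>. g A = g B))"
    (is "_ \<longleftrightarrow> (\<forall>g. ?consistent g \<longrightarrow> ?constant g)")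
proof
  assume conn: "connectedin X (\<Union>\<A>)"
  show "\<forall>g. ?consistent g \<longrightarrow> ?constant g"
  proof (intro allI impI)
    fix g :: "'a set \<Rightarrow> bool" assume g: "?consistent g"
    define E1 where "E1 = \<Union>{A \<in> \<A>. g A}"
    define E2 where "E2 = \<Union>{A \<in> \<A>. \<not> g A}"
    have "closedin X E1" "closedin X E2" unfolding E1_def E2_def using fin A by (auto intro!: closedin_Union)
    moreover have "\<Union>\<A> \<subseteq> E1 \<union> E2" "E1 \<inter> E2 \<inter> \<Union>\<A> = {}" unfolding E1_def E2_def using g by blast+
    ultimately have "\<not> (E1 \<inter> \<Union>\<A> \<noteq> {} \<and> E2 \<inter> \<Union>\<A> \<noteq> {})"
      using conn unfolding connectedin_closedin by blast
    then have empty: "E1 = {} \<or> E2 = {}" unfolding E1_def E2_def by blast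
    have 1: "A \<subseteq> E1" if "A \<in> \<A>" "g A" for A unfolding E1_def using that by blast
    have 2: "A \<subseteq> E2" if "A \<in> \<A>" "\<not> g A" for A unfolding E2_def using that by blast
    show "?constant g"
    proof (intro ballI)
      fix S T assume ST: "S \<in> \<A>" "T \<in> \<A>"
      show "g S = g T" using empty 1[OF ST(1)] 1[OF ST(2)] 2[OF ST(1)] 2[OF ST(2)] A[OF ST(1)] A[OF ST(2)]
        by (metis subset_empty)
    qed
  qed
next
  assume const: "\<forall>g. ?consistent g \<longrightarrow> ?constant g"
  show "connectedin X (\<Union>\<A>)"
    unfolding connectedin_closedin
  proof (intro conjI notI)
    have "A \<subseteq> topspace X" if "A \<in> \<A>" for A using A[OF that] closedin_subset by blast
    then show "\<Union>\<A> \<subseteq> topspace X" by blast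
    assume "\<exists>E1 E2. closedin X E1 \<and> closedin X E2 \<and> \<Union>\<A> \<subseteq> E1 \<union> E2 \<and> E1 \<inter> E2 \<inter> \<Union>\<A> = {} \<and>
      E1 \<inter> \<Union>\<A> \<noteq> {} \<and> E2 \<inter> \<Union>\<A> \<noteq> {}"
    then obtain E1 E2 where E: "closedin X E1" "closedin X E2" "\<Union>\<A> \<subseteq> E1 \<union> E2" "E1 \<inter> E2 \<inter> \<Union>\<A> = {}"
      "E1 \<inter> \<Union>\<A> \<noteq> {}" "E2 \<inter> \<Union>\<A> \<noteq> {}" by metis
    have side: "B \<subseteq> E1 \<and> B \<inter> E2 = {} \<or> B \<subseteq> E2 \<and> B \<inter> E1 = {}" if B: "B \<in> \<A>" for B
    proof -
      have "B \<subseteq> E1 \<union> E2" "E1 \<inter> E2 \<inter> B = {}" using E(3,4) B by blast+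
      moreover from this have "E1 \<inter> B = {} \<or> E2 \<inter> B = {}"
        using A[OF B] E(1,2) unfolding connectedin_closedin by metis
      ultimately show ?thesis by blast
    qed
    define g where "g B \<longleftrightarrow> B \<subseteq> E1" for B
    have ne: "B \<noteq> {}" if "B \<in> \<A>" for B using A[OF that] by blast
    have "?consistent g"
    proof (intro ballI impI)
      fix S T assume "S \<in> \<A>" "T \<in> \<A>" "S \<inter> T \<noteq> {}"
      then show "g S = g T" using side[of S] side[of T] unfolding g_def by blast
    qed
    then have g: "?constant g" by (rule const[THEN spec, THEN mp])
    obtain S T where ST: "S \<in> \<A>" "E1 \<inter> S \<noteq> {}" "T \<in> \<A>" "E2 \<inter> T \<noteq> {}" using E(5,6) by blast
    then have "g S" "\<not> g T" using side[of S] side[of T] ne[of T] unfolding g_def by blast+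
    then show False using g ST by blast
  qed
qed


lemma connected_components_of_disjoint_closed_Union:
  assumes fin: "finite \<A>" and A: "\<And>A. A \<in> \<A> \<Longrightarrow> closedin X A \<and> connectedin X A \<and> A \<noteq> {}"
    and disj: "\<And>A B. A \<in> \<A> \<Longrightarrow> B \<in> \<A> \<Longrightarrow> A \<noteq> B \<Longrightarrow> A \<inter> B = {}"
  shows "connected_components_of (subtopology X (\<Union>\<A>)) = \<A>"
proof -
  let ?T = "subtopology X (\<Union>\<A>)"
  have sub: "\<Union>\<A> \<subseteq> topspace X" using A closedin_subset by blast
  have conn: "connectedin ?T A" if "A \<in> \<A>" for A
    using A[OF that] that by (simp add: connectedin_subtopology Union_upper)
  have in_A: "c = A" if c: "c \<in> connected_components_of ?T" and AA: "A \<in> \<A>" "c \<inter> A \<noteq> {}" for c A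
  proof
    show "A \<subseteq> c"
      using connected_components_of_maximal[OF c conn[OF AA(1)]] AA(2) by (simp add: disjnt_def)
    have cc: "connectedin X c" "c \<subseteq> \<Union>\<A>"
      using connectedin_connected_components_of[OF c] by (simp_all add: connectedin_subtopology)
    have "closedin X A" "closedin X (\<Union>(\<A> - {A}))"
      using A AA(1) fin by (auto intro!: closedin_Union)
    moreover have "c \<subseteq> A \<union> \<Union>(\<A> - {A})" using cc(2) by blast
    moreover have "A \<inter> \<Union>(\<A> - {A}) \<inter> c = {}" using disj[OF AA(1)] by blast
    ultimately have "A \<inter> c = {} \<or> \<Union>(\<A> - {A}) \<inter> c = {}"
      using cc(1) unfolding connectedin_closedin by metis
    then show "c \<subseteq> A" using AA(2) cc(2) by blast
  qed
  show ?thesis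
  proof (intro set_eqI iffI)
    fix c assume c: "c \<in> connected_components_of ?T"
    then have "c \<noteq> {}" "c \<subseteq> \<Union>\<A>"
      using nonempty_connected_components_of connected_components_of_subset[OF c] sub by auto
    then obtain A where "A \<in> \<A>" "c \<inter> A \<noteq> {}" by blast
    then show "c \<in> \<A>" using in_A[OF c] by blast
  next
    fix A assume AA: "A \<in> \<A>"
    then obtain x where x: "x \<in> A" using A by blast
    then have "x \<in> \<Union>(connected_components_of ?T)"
      using AA sub unfolding Union_connected_components_of by auto
    then obtain c where "c \<in> connected_components_of ?T" "x \<in> c" by blast
    then show "A \<in> connected_components_of ?T" using in_A[OF _ AA] x by blast
  qed
qed

section \<open>Pairings\<close>

definition pairing :: "'a set \<Rightarrow> 'a set set \<Rightarrow> bool" where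
  "pairing P \<A> \<longleftrightarrow> (\<forall>A\<in>\<A>. \<exists>p q. p \<noteq> q \<and> A \<inter> P = {p, q}) \<and> (\<forall>p\<in>P. \<exists>!A. A \<in> \<A> \<and> p \<in> A)"

definition mate :: "'a set \<Rightarrow> 'a set set \<Rightarrow> 'a \<Rightarrow> 'a" where
  "mate P \<A> p = (THE q. \<exists>A\<in>\<A>. p \<in> A \<and> A \<inter> P = {p, q} \<and> q \<noteq> p)"

lemma pairing_mate:
  assumes "pairing P \<A>" "A \<in> \<A>" "p \<in> A" "p \<in> P"
  shows "A \<inter> P = {p, mate P \<A> p}" "mate P \<A> p \<noteq> p"
proof -
  obtain x y where xy: "x \<noteq> y" "A \<inter> P = {x, y}" using assms unfolding pairing_def by metis
  then have "p = x \<or> p = y" using assms by blast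
  then obtain q where q: "A \<inter> P = {p, q}" "q \<noteq> p" using xy by blast
  have uniq: "B = A" if "B \<in> \<A>" "p \<in> B" for B using assms that unfolding pairing_def by metis
  have "mate P \<A> p = q"
    unfolding mate_def
  proof (rule the_equality)
    show "\<exists>A\<in>\<A>. p \<in> A \<and> A \<inter> P = {p, q} \<and> q \<noteq> p" using q assms by blast
    fix r assume "\<exists>A\<in>\<A>. p \<in> A \<and> A \<inter> P = {p, r} \<and> r \<noteq> p"
    then have "A \<inter> P = {p, r}" "r \<noteq> p" using uniq by blast+
    then show "r = q" using q(1) by blast
  qed
  then show "A \<inter> P = {p, mate P \<A> p}" "mate P \<A> p \<noteq> p" using q by simp_all
qed

lemma pairing_piece:
  assumes "pairing P \<A>" "p \<in> P"
  obtains A where "A \<in> \<A>" "p \<in> A"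
  using assms unfolding pairing_def by metis

lemma pairing_involution:
  assumes "pairing P \<A>" "p \<in> P"
  shows "mate P \<A> p \<in> P" "mate P \<A> p \<noteq> p" "mate P \<A> (mate P \<A> p) = p"
proof -
  obtain A where A: "A \<in> \<A>" "p \<in> A" using pairing_piece[OF assms] .
  note m = pairing_mate[OF assms(1) A assms(2)]
  have mA: "mate P \<A> p \<in> A" "mate P \<A> p \<in> P" using m(1) by blast+
  then show "mate P \<A> p \<in> P" "mate P \<A> p \<noteq> p" using m(2) by blast+
  note m' = pairing_mate[OF assms(1) A(1) mA]
  have "p \<in> {mate P \<A> p, mate P \<A> (mate P \<A> p)}" using m'(1) A(2) assms(2) by blast
  then show "mate P \<A> (mate P \<A> p) = p" using m(2) by auto
qed

text \<open>When distinct pieces meet only in marked points, a colouring of the pieces is the same as a colouring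
  of the marked points that is constant on each piece.\<close>

lemma connectedin_pieces_iff:
  assumes fin: "finite \<A>" and A: "\<And>A. A \<in> \<A> \<Longrightarrow> closedin X A \<and> connectedin X A \<and> A \<inter> P \<noteq> {}"
    and int: "\<And>A B. A \<in> \<A> \<Longrightarrow> B \<in> \<A> \<Longrightarrow> A \<noteq> B \<Longrightarrow> A \<inter> B \<subseteq> P"
  shows "connectedin X (\<Union>\<A>) \<longleftrightarrow>
    (\<forall>F \<subseteq> P \<inter> \<Union>\<A>. (\<forall>A\<in>\<A>. A \<inter> P \<subseteq> F \<or> A \<inter> F = {}) \<longrightarrow> F = {} \<or> F = P \<inter> \<Union>\<A>)"
    (is "_ \<longleftrightarrow> ?R")
proof -
  have iff: "connectedin X (\<Union>\<A>) \<longleftrightarrow>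
    (\<forall>g :: 'a set \<Rightarrow> bool. (\<forall>A\<in>\<A>. \<forall>B\<in>\<A>. A \<inter> B \<noteq> {} \<longrightarrow> g A = g B) \<longrightarrow> (\<forall>A\<in>\<A>. \<forall>B\<in>\<A>. g A = g B))"
    using fin by (rule connectedin_Union_iff) (use A in blast)
  show ?thesis
    unfolding iff
  proof (intro iffI allI impI)
    fix F
    assume c: "\<forall>g :: 'a set \<Rightarrow> bool. (\<forall>A\<in>\<A>. \<forall>B\<in>\<A>. A \<inter> B \<noteq> {} \<longrightarrow> g A = g B) \<longrightarrow> (\<forall>A\<in>\<A>. \<forall>B\<in>\<A>. g A = g B)"
      and F: "F \<subseteq> P \<inter> \<Union>\<A>" "\<forall>A\<in>\<A>. A \<inter> P \<subseteq> F \<or> A \<inter> F = {}"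
    have "\<forall>A\<in>\<A>. \<forall>B\<in>\<A>. A \<inter> B \<noteq> {} \<longrightarrow> (A \<inter> F \<noteq> {}) = (B \<inter> F \<noteq> {})"
    proof (intro ballI impI)
      fix A B assume AB: "A \<in> \<A>" "B \<in> \<A>" "A \<inter> B \<noteq> {}"
      show "(A \<inter> F \<noteq> {}) = (B \<inter> F \<noteq> {})"
      proof (cases "A = B")
        case False
        then obtain z where "z \<in> A" "z \<in> B" "z \<in> P" using AB int by blast
        then show ?thesis using F(2) AB by blast
      qed simp
    qed
    from c[THEN spec, THEN mp, OF this]
    have g: "(A \<inter> F \<noteq> {}) = (B \<inter> F \<noteq> {})" if "A \<in> \<A>" "B \<in> \<A>" for A B using that by blast
    show "F = {} \<or> F = P \<inter> \<Union>\<A>"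
    proof (cases "F = {}")
      case False
      then obtain A where "A \<in> \<A>" "A \<inter> F \<noteq> {}" using F(1) by blast
      then have "B \<inter> P \<subseteq> F" if "B \<in> \<A>" for B using g[OF _ that] F(2) that by blast
      then show ?thesis using F(1) by blast
    qed simp
  next
    fix g :: "'a set \<Rightarrow> bool"
    assume c: ?R and g: "\<forall>A\<in>\<A>. \<forall>B\<in>\<A>. A \<inter> B \<noteq> {} \<longrightarrow> g A = g B"
    define F where "F = {p \<in> P. \<exists>A\<in>\<A>. p \<in> A \<and> g A}"
    have gF: "p \<in> F \<longleftrightarrow> g A" if "A \<in> \<A>" "p \<in> A" "p \<in> P" for A p
      unfolding F_def using g that by blast
    have "F \<subseteq> P \<inter> \<Union>\<A>" by (auto simp: F_def)
    moreover have "\<forall>A\<in>\<A>. A \<inter> P \<subseteq> F \<or> A \<inter> F = {}"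
    proof
      fix A assume "A \<in> \<A>"
      then show "A \<inter> P \<subseteq> F \<or> A \<inter> F = {}" using gF[of A] by (cases "g A") (auto simp: F_def)
    qed
    ultimately have or: "F = {} \<or> F = P \<inter> \<Union>\<A>" using c by simp
    have "g A \<longleftrightarrow> F \<noteq> {}" if AA: "A \<in> \<A>" for A
    proof -
      obtain p where p: "p \<in> A" "p \<in> P" using A[OF AA] by blast
      then show ?thesis using gF[OF AA p] or AA by blast
    qed
    then show "\<forall>A\<in>\<A>. \<forall>B\<in>\<A>. g A = g B" by simp
  qed
qed

section \<open>Flags of a ribbon graph\<close>

locale ribbon =
  fixes G :: "'a ribbon_graph"
  assumes ribbon_graph: "ribbon_graph G"
begin

abbreviation "S \<equiv> surface G"
abbreviation "V \<equiv> rverts G"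
abbreviation "E \<equiv> redges G"
abbreviation "segs \<equiv> attaching_segments G"
abbreviation "bd \<equiv> disc_boundary S"

definition segs_in :: "'a set \<Rightarrow> 'a set set" where "segs_in D = {s \<in> segs. s \<subseteq> D}"

definition P :: "'a set" where "P = \<Union>(ends S ` segs)"

definition disc_gaps :: "'a set \<Rightarrow> 'a set set" where
  "disc_gaps D = connected_components_of (subtopology S (bd D - \<Union>segs))"

lemma surface: "surface_with_boundary S"
  using ribbon_graph by (simp add: ribbon_graph_def)

lemma Hausdorff: "Hausdorff_space S"
  using surface by (simp add: surface_with_boundary_def)

lemma finite_V: "finite V" and finite_E: "finite E"
  using ribbon_graph by (simp_all add: ribbon_graph_def)

lemma topspace_S: "topspace S = \<Union>V \<union> \<Union>E"
  using ribbon_graph by (simp add: ribbon_graph_def)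

lemma disc: "D \<in> V \<union> E \<Longrightarrow> topological_disc S D"
  using ribbon_graph by (simp add: ribbon_graph_def)

lemma disc_closed: "D \<in> V \<union> E \<Longrightarrow> closedin S D"
  using disc disc_compactin Hausdorff compactin_imp_closedin by metis

lemma disc_subset: "D \<in> V \<union> E \<Longrightarrow> D \<subseteq> topspace S"
  using disc_closed closedin_subset by metis

lemma bd_subset: "bd D \<subseteq> D" by (rule disc_boundary_subset)

lemma disc_nonempty: "D \<in> V \<union> E \<Longrightarrow> D \<noteq> {}"
  using disc_boundary_has_other_point[OF disc] bd_subset by (metis empty_iff subsetD)

lemma disc_connected: "D \<in> V \<union> E \<Longrightarrow> connectedin S D"
  using disc disc_connectedin by metis

lemma V_disjoint: "v \<in> V \<Longrightarrow> v' \<in> V \<Longrightarrow> x \<in> v \<Longrightarrow> x \<in> v' \<Longrightarrow> v = v'"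
proof -
  have "disjoint V" using ribbon_graph by (simp add: ribbon_graph_def)
  then show "v \<in> V \<Longrightarrow> v' \<in> V \<Longrightarrow> x \<in> v \<Longrightarrow> x \<in> v' \<Longrightarrow> v = v'"
    using disjointD[of V v v'] by blast
qed

lemma E_disjoint: "e \<in> E \<Longrightarrow> e' \<in> E \<Longrightarrow> x \<in> e \<Longrightarrow> x \<in> e' \<Longrightarrow> e = e'"
proof -
  have "disjoint E" using ribbon_graph by (simp add: ribbon_graph_def)
  then show "e \<in> E \<Longrightarrow> e' \<in> E \<Longrightarrow> x \<in> e \<Longrightarrow> x \<in> e' \<Longrightarrow> e = e'"
    using disjointD[of E e e'] by blast
qed

lemma Union_segs: "\<Union>segs = \<Union>V \<inter> \<Union>E"
proof -
  have "\<Union>V \<inter> \<Union>E \<subseteq> topspace S" using topspace_S by blast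
  then show ?thesis
    unfolding attaching_segments_def Union_connected_components_of by (simp add: Int_absorb1)
qed

lemma seg: "s \<in> segs \<Longrightarrow> line_segment S s"
  using ribbon_graph by (simp add: ribbon_graph_def)

lemma seg_vertex: "s \<in> segs \<Longrightarrow> \<exists>v\<in>V. s \<subseteq> bd v"
  using ribbon_graph unfolding ribbon_graph_def by metis

lemma seg_edge: "s \<in> segs \<Longrightarrow> \<exists>e\<in>E. s \<subseteq> bd e"
  using ribbon_graph unfolding ribbon_graph_def by metis

lemma seg_disjoint: "s \<in> segs \<Longrightarrow> s' \<in> segs \<Longrightarrow> x \<in> s \<Longrightarrow> x \<in> s' \<Longrightarrow> s = s'"
  unfolding attaching_segments_def
  using pairwise_disjoint_connected_components_of by (metis disjnt_iff pairwiseD)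

lemma seg_nonempty: "s \<in> segs \<Longrightarrow> s \<noteq> {}"
  unfolding attaching_segments_def by (rule nonempty_connected_components_of)

lemma seg_closed: "s \<in> segs \<Longrightarrow> closedin S s"
  using seg line_segment_properties(1) Hausdorff compactin_imp_closedin by metis

lemma seg_in_bd:
  assumes "s \<in> segs" "D \<in> V \<union> E" "x \<in> s" "x \<in> D"
  shows "s \<subseteq> bd D"
proof (cases "D \<in> V")
  case True
  obtain v where v: "v \<in> V" "s \<subseteq> bd v" using seg_vertex[OF assms(1)] by metis
  then have "x \<in> v" using bd_subset assms(3) by fast
  then have "v = D" using V_disjoint[OF v(1) True] assms(4) by simp
  then show ?thesis using v by simp
next
  case False
  then have DE: "D \<in> E" using assms(2) by simp
  obtain e where e: "e \<in> E" "s \<subseteq> bd e" using seg_edge[OF assms(1)] by metis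
  then have "x \<in> e" using bd_subset assms(3) by fast
  then have "e = D" using E_disjoint[OF e(1) DE] assms(4) by simp
  then show ?thesis using e by simp
qed

lemma seg_in_disc: "s \<in> segs \<Longrightarrow> D \<in> V \<union> E \<Longrightarrow> x \<in> s \<Longrightarrow> x \<in> D \<Longrightarrow> s \<in> segs_in D"
  using seg_in_bd bd_subset unfolding segs_in_def by blast

lemma segs_in_bd: "D \<in> V \<union> E \<Longrightarrow> s \<in> segs_in D \<Longrightarrow> s \<in> segs \<and> s \<subseteq> bd D"
  using seg_in_bd[of s D] seg_nonempty unfolding segs_in_def by blast

lemma bd_minus_segs: "D \<in> V \<union> E \<Longrightarrow> bd D - \<Union>segs = bd D - \<Union>(segs_in D)"
  using seg_in_disc[of _ D] bd_subset[of D] unfolding segs_in_def by blast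

lemma card_segs_in: "e \<in> E \<Longrightarrow> card (segs_in e) = 2"
  using ribbon_graph by (simp add: ribbon_graph_def segs_in_def)

lemma finite_segs: "finite segs"
proof -
  have "segs \<subseteq> \<Union>(segs_in ` E)"
  proof
    fix s assume s: "s \<in> segs"
    then obtain e where e: "e \<in> E" "s \<subseteq> bd e" using seg_edge by blast
    then have "s \<in> segs_in e" using s bd_subset[of e] by (auto simp: segs_in_def)
    then show "s \<in> \<Union>(segs_in ` E)" using e(1) by blast
  qed
  moreover have "finite (\<Union>(segs_in ` E))"
    using finite_E card_segs_in by (metis card.infinite finite_UN_I zero_neq_numeral)
  ultimately show ?thesis by (rule finite_subset)
qed

lemma finite_segs_in: "finite (segs_in D)"
  using finite_segs unfolding segs_in_def by simp

lemma vertex_edge_int: "v \<in> V \<Longrightarrow> e \<in> E \<Longrightarrow> v \<inter> e \<subseteq> bd v \<and> v \<inter> e \<subseteq> bd e"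
proof -
  assume ve: "v \<in> V" "e \<in> E"
  have "x \<in> bd v \<and> x \<in> bd e" if x: "x \<in> v" "x \<in> e" for x
  proof -
    have "x \<in> \<Union>segs" using x ve Union_segs by blast
    then obtain s where s: "s \<in> segs" "x \<in> s" by blast
    then show ?thesis using seg_in_bd[OF s(1) _ s(2)] ve x by blast
  qed
  then show ?thesis by blast
qed

lemma circle: "D \<in> V \<union> E \<Longrightarrow> topological_circle S (bd D)"
  using disc_boundary_circle disc Hausdorff by metis

lemma arcs: 
  assumes "D \<in> V \<union> E" "segs_in D \<noteq> {}"
  shows "arcs_on_circle S (bd D) (segs_in D)"
proof -
  interpret topological_circle S "bd D" using assms(1) by (rule circle)
  show ?thesis
  proof
    show "s \<inter> s' = {}" if "s \<in> segs_in D" "s' \<in> segs_in D" "s \<noteq> s'" for s s'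
      using that seg_disjoint unfolding segs_in_def by blast
  qed (use assms segs_in_bd seg finite_segs_in in auto)
qed

lemma disc_gaps_eq:
  assumes "D \<in> V \<union> E" "segs_in D \<noteq> {}"
  shows "disc_gaps D = arcs_on_circle.gaps S (bd D) (segs_in D)"
  using arcs_on_circle.gaps_def[OF arcs[OF assms]] bd_minus_segs[OF assms(1)] by (simp add: disc_gaps_def)

lemma ends_P: "s \<in> segs \<Longrightarrow> ends S s = s \<inter> P"
proof
  assume s: "s \<in> segs"
  show "ends S s \<subseteq> s \<inter> P" using s ends_subset[of S s] by (auto simp: P_def)
  show "s \<inter> P \<subseteq> ends S s"
  proof
    fix p assume p: "p \<in> s \<inter> P"
    then obtain s' where s': "s' \<in> segs" "p \<in> ends S s'" by (auto simp: P_def)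
    then have "s' = s" using seg_disjoint[OF s'(1) s] p ends_subset by fast
    then show "p \<in> ends S s" using s' by simp
  qed
qed

lemma P_seg: "p \<in> P \<Longrightarrow> \<exists>s\<in>segs. p \<in> s"
  using ends_subset by (fastforce simp: P_def)

lemma finite_P: "finite P"
proof -
  have "finite (ends S s)" if "s \<in> segs" for s using line_segment_properties(3)[OF seg[OF that]] by force
  then show ?thesis unfolding P_def using finite_segs by blast
qed

lemma gap_subset: 
  assumes "D \<in> V \<union> E" "c \<in> disc_gaps D"
  shows "c \<subseteq> bd D - \<Union>segs"
  using connected_components_of_subset[of c "subtopology S (bd D - \<Union>segs)"] assms(2)
  unfolding disc_gaps_def by auto

lemma gap_closure:
  assumes D: "D \<in> V \<union> E" "segs_in D \<noteq> {}" and c: "c \<in> disc_gaps D"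
  obtains p q where "p \<noteq> q" "p \<in> P" "q \<in> P" "S closure_of c = insert p (insert q c)" "S closure_of c \<inter> P = {p, q}"
    "S closure_of c \<subseteq> bd D" "p \<in> D" "q \<in> D"
proof -
  interpret A: arcs_on_circle S "bd D" "segs_in D" using D by (rule arcs)
  have "c \<in> A.gaps" using c disc_gaps_eq[OF D] by simp
  then obtain p q where pq: "p \<noteq> q" "p \<in> \<Union>(ends S ` segs_in D)" "q \<in> \<Union>(ends S ` segs_in D)"
    "S closure_of c = insert p (insert q c)"
    using A.gap_structure(2) by blast
  have P: "p \<in> P" "q \<in> P" using pq(2,3) unfolding P_def segs_in_def by blast+
  have "x \<in> bd D" if "x \<in> \<Union>(ends S ` segs_in D)" for x
    using that segs_in_bd[OF D(1)] ends_subset by fast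
  then have b: "p \<in> bd D" "q \<in> bd D" using pq by blast+
  have "c \<inter> P = {}" using gap_subset[OF D(1) c] P_seg by blast
  then have "S closure_of c \<inter> P = {p, q}" using pq(4) P by auto
  moreover have "S closure_of c \<subseteq> bd D" using pq(4) b gap_subset[OF D(1) c] by auto
  ultimately show thesis using that pq P b bd_subset[of D] by blast
qed

lemma flag_gap:
  assumes D: "D \<in> V \<union> E" and p: "p \<in> P" "p \<in> D"
  shows "segs_in D \<noteq> {}" "\<exists>!c. c \<in> disc_gaps D \<and> p \<in> S closure_of c"
proof -
  obtain s where s: "s \<in> segs" "p \<in> s" using P_seg[OF p(1)] by blast
  then have sD: "s \<in> segs_in D" using seg_in_disc D p(2) by blast
  then show ne: "segs_in D \<noteq> {}" by blast
  interpret A: arcs_on_circle S "bd D" "segs_in D" using D ne by (rule arcs)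
  have "p \<in> ends S s" using ends_P s p(1) by blast
  then show "\<exists>!c. c \<in> disc_gaps D \<and> p \<in> S closure_of c"
    using A.ends_in_unique_gap[OF sD] disc_gaps_eq[OF D ne] by simp
qed

lemma gaps_disjoint: "c \<in> disc_gaps D \<Longrightarrow> c' \<in> disc_gaps D \<Longrightarrow> x \<in> c \<Longrightarrow> x \<in> c' \<Longrightarrow> c = c'"
  unfolding disc_gaps_def using pairwise_disjoint_connected_components_of by (metis disjnt_iff pairwiseD)

text \<open>Every gap has a flag in its closure and no flag belongs to two gaps of the same disc.\<close>

lemma finite_disc_gaps:
  assumes D: "D \<in> V \<union> E" "segs_in D \<noteq> {}"
  shows "finite (disc_gaps D)"
proof -
  have "disc_gaps D \<subseteq> (\<lambda>p. THE c. c \<in> disc_gaps D \<and> p \<in> S closure_of c) ` P"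
  proof
    fix c assume c: "c \<in> disc_gaps D"
    obtain p where p: "p \<in> P" "p \<in> D" "p \<in> S closure_of c"
      using gap_closure[OF D c] by (metis insertI1)
    have "(THE c. c \<in> disc_gaps D \<and> p \<in> S closure_of c) = c"
      using flag_gap(2)[OF D(1) p(1,2)] c p(3) by (intro the1_equality) auto
    then show "c \<in> (\<lambda>p. THE c. c \<in> disc_gaps D \<and> p \<in> S closure_of c) ` P" using p(1) by force
  qed
  then show ?thesis using finite_P finite_surj by blast
qed

text \<open>The closed gaps and the segments are the pieces from which all boundaries are assembled.\<close>

definition arcs_of :: "'a set \<Rightarrow> 'a set set" where
  "arcs_of D = (\<lambda>c. S closure_of c) ` disc_gaps D"

definition nonisolated :: "'a set set" where "nonisolated = {D \<in> V \<union> E. segs_in D \<noteq> {}}"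

definition pieces :: "'a set set" where "pieces = segs \<union> \<Union>(arcs_of ` nonisolated)"

lemma edge_nonisolated: "e \<in> E \<Longrightarrow> e \<in> nonisolated"
  using card_segs_in[of e] by (auto simp: nonisolated_def)

lemma finite_pieces: "finite pieces"
proof -
  have "finite nonisolated" using finite_V finite_E by (simp add: nonisolated_def)
  moreover have "finite (arcs_of D)" if "D \<in> nonisolated" for D
    using that finite_disc_gaps[of D] by (simp add: arcs_of_def nonisolated_def)
  ultimately show ?thesis unfolding pieces_def using finite_segs by blast
qed

lemma piece_flags: "A \<in> pieces \<Longrightarrow> \<exists>p q. p \<noteq> q \<and> A \<inter> P = {p, q}"
proof -
  assume "A \<in> pieces"
  then consider "A \<in> segs" | D c where "D \<in> nonisolated" "c \<in> disc_gaps D" "A = S closure_of c"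
    unfolding pieces_def arcs_of_def by blast
  then show ?thesis
  proof cases
    case 1
    then show ?thesis using line_segment_properties(3)[OF seg] ends_P by metis
  next
    case 2
    have D: "D \<in> V \<union> E" "segs_in D \<noteq> {}" using 2(1) by (simp_all add: nonisolated_def)
    show ?thesis using gap_closure[OF D 2(2)] 2(3) by metis
  qed
qed

lemma piece_closed_connected: "A \<in> pieces \<Longrightarrow> closedin S A \<and> connectedin S A"
proof -
  assume "A \<in> pieces"
  then consider "A \<in> segs" | D c where "c \<in> disc_gaps D" "A = S closure_of c"
    unfolding pieces_def arcs_of_def by blast
  then show ?thesis
  proof cases
    case 1
    then show ?thesis using line_segment_properties(2)[OF seg] seg_closed by blast
  next
    case 2
    have "connectedin S c"
      using 2(1) connectedin_connected_components_of unfolding disc_gaps_def by (metis connectedin_subtopology)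
    then show ?thesis using 2(2) by (simp add: connectedin_closure_of)
  qed
qed

lemma arc_minus_P:
  assumes "D \<in> nonisolated" "c \<in> disc_gaps D" "z \<in> S closure_of c" "z \<notin> P"
  shows "z \<in> c" "z \<in> D" "z \<notin> \<Union>segs"
proof -
  have D: "D \<in> V \<union> E" "segs_in D \<noteq> {}" using assms(1) by (auto simp: nonisolated_def)
  show "z \<in> c" using gap_closure[OF D assms(2)] assms(3,4) by (metis insert_iff)
  then show "z \<in> D" "z \<notin> \<Union>segs" using gap_subset[OF D(1) assms(2)] bd_subset[of D] by blast+
qed

text \<open>Interior points of a gap avoid the segments and therefore lie in just one disc; interior points of a
  segment lie in no other segment and in no gap.\<close>

lemma pieces_int:
  assumes "A \<in> pieces" "B \<in> pieces" "A \<noteq> B"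
  shows "A \<inter> B \<subseteq> P"
proof (rule ccontr)
  assume "\<not> A \<inter> B \<subseteq> P"
  then obtain z where z: "z \<in> A" "z \<in> B" "z \<notin> P" by blast
  have cases: "(A \<in> segs \<and> z \<in> \<Union>segs) \<or> (\<exists>D c. D \<in> nonisolated \<and> c \<in> disc_gaps D \<and> A = S closure_of c \<and> z \<in> c \<and> z \<in> D \<and> z \<notin> \<Union>segs)"
    if A: "A \<in> pieces" "z \<in> A" for A
  proof (cases "A \<in> segs")
    case False
    then obtain D c where "D \<in> nonisolated" "c \<in> disc_gaps D" "A = S closure_of c"
      using A unfolding pieces_def arcs_of_def by blast
    moreover from this have "z \<in> c" "z \<in> D" "z \<notin> \<Union>segs" using arc_minus_P[of D c z] A(2) z(3) by simp_all
    ultimately show ?thesis by (intro disjI2 exI[of _ D] exI[of _ c] conjI)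
  qed (use A in blast)
  from cases[OF assms(1) z(1)] cases[OF assms(2) z(2)] show False
  proof (elim disjE exE conjE)
    assume "A \<in> segs" "B \<in> segs"
    then show False using seg_disjoint z assms(3) by blast
  next
    fix D c D' c'
    assume A: "D \<in> nonisolated" "c \<in> disc_gaps D" "A = S closure_of c" "z \<in> c" "z \<in> D" "z \<notin> \<Union>segs"
      and B: "D' \<in> nonisolated" "c' \<in> disc_gaps D'" "B = S closure_of c'" "z \<in> c'" "z \<in> D'"
    have "D \<in> V \<union> E" "D' \<in> V \<union> E" using A(1) B(1) by (simp_all add: nonisolated_def)
    moreover have "\<not> (z \<in> \<Union>V \<and> z \<in> \<Union>E)" using A(6) Union_segs by blast
    ultimately have "D = D'" using A(5) B(5) V_disjoint E_disjoint by blast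
    then have "c = c'" using gaps_disjoint A B by blast
    then show False using A B assms(3) by simp
  qed simp_all
qed

lemma connected_pieces_iff:
  assumes "\<A> \<subseteq> pieces"
  shows "connectedin S (\<Union>\<A>) \<longleftrightarrow>
    (\<forall>F \<subseteq> P \<inter> \<Union>\<A>. (\<forall>A\<in>\<A>. A \<inter> P \<subseteq> F \<or> A \<inter> F = {}) \<longrightarrow> F = {} \<or> F = P \<inter> \<Union>\<A>)"
proof (rule connectedin_pieces_iff)
  show "finite \<A>" using finite_pieces assms by (rule rev_finite_subset)
  show "closedin S A \<and> connectedin S A \<and> A \<inter> P \<noteq> {}" if "A \<in> \<A>" for A
  proof -
    have "A \<in> pieces" using that assms by blast
    then show ?thesis using piece_closed_connected[of A] piece_flags[of A] by auto
  qed
  show "A \<inter> B \<subseteq> P" if "A \<in> \<A>" "B \<in> \<A>" "A \<noteq> B" for A B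
    using pieces_int that assms by blast
qed

definition corner_arcs :: "'a set set" where "corner_arcs = \<Union>(arcs_of ` (V \<inter> nonisolated))"
definition side_arcs :: "'a set set" where "side_arcs = \<Union>(arcs_of ` E)"

definition kappa :: "'a \<Rightarrow> 'a" where "kappa = mate P corner_arcs"
definition sigma :: "'a \<Rightarrow> 'a" where "sigma = mate P segs"
definition eps :: "'a \<Rightarrow> 'a" where "eps = mate P side_arcs"
definition ed :: "'a \<Rightarrow> 'a set" where "ed p = (THE e. e \<in> E \<and> p \<in> e)"
definition vt :: "'a \<Rightarrow> 'a set" where "vt p = (THE v. v \<in> V \<and> p \<in> v)"

lemma flag_in_VE: "p \<in> P \<Longrightarrow> p \<in> \<Union>V \<and> p \<in> \<Union>E"
  using P_seg Union_segs by blast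

lemma ed_eq: "e \<in> E \<Longrightarrow> p \<in> e \<Longrightarrow> ed p = e"
  unfolding ed_def using E_disjoint by (intro the_equality) auto

lemma vt_eq: "v \<in> V \<Longrightarrow> p \<in> v \<Longrightarrow> vt p = v"
  unfolding vt_def using V_disjoint by (intro the_equality) auto

lemma ed: "p \<in> P \<Longrightarrow> ed p \<in> E \<and> p \<in> ed p"
proof -
  assume "p \<in> P"
  then obtain e where "e \<in> E" "p \<in> e" using flag_in_VE by blast
  then show ?thesis using ed_eq by metis
qed

lemma vt: "p \<in> P \<Longrightarrow> vt p \<in> V \<and> p \<in> vt p"
proof -
  assume "p \<in> P"
  then obtain v where "v \<in> V" "p \<in> v" using flag_in_VE by blast
  then show ?thesis using vt_eq by metis
qed

text \<open>Vertices are pairwise disjoint, and so are edges, so two gap closures around discs of the same kind that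
  share a flag lie in the same disc.\<close>

lemma arc_of_flag_unique:
  assumes D: "D \<in> nonisolated" "D' \<in> nonisolated" "A \<in> arcs_of D" "A' \<in> arcs_of D'" and p: "p \<in> P" "p \<in> A" "p \<in> A'"
    and same: "D \<in> V \<and> D' \<in> V \<or> D \<in> E \<and> D' \<in> E"
  shows "A = A'"
proof -
  obtain c c' where c: "c \<in> disc_gaps D" "A = S closure_of c" "c' \<in> disc_gaps D'" "A' = S closure_of c'"
    using D(3,4) by (auto simp: arcs_of_def)
  have DD: "D \<in> V \<union> E" "segs_in D \<noteq> {}" "D' \<in> V \<union> E" "segs_in D' \<noteq> {}" using D by (auto simp: nonisolated_def)
  have "A \<subseteq> D" using gap_closure[OF DD(1,2) c(1)] c(2) bd_subset[of D] by (metis subset_trans)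
  moreover have "A' \<subseteq> D'" using gap_closure[OF DD(3,4) c(3)] c(4) bd_subset[of D'] by (metis subset_trans)
  ultimately have "p \<in> D" "p \<in> D'" using p by blast+
  then have "D = D'" using same V_disjoint E_disjoint by blast
  then have "c = c'" using flag_gap(2)[OF DD(1) p(1) \<open>p \<in> D\<close>] c p(2,3) by blast
  then show ?thesis using c by simp
qed

lemma arc_of_flag:
  assumes "D \<in> V \<union> E" "p \<in> P" "p \<in> D"
  shows "D \<in> nonisolated" "\<exists>A\<in>arcs_of D. p \<in> A"
proof -
  show "D \<in> nonisolated" using flag_gap(1)[OF assms] assms(1) by (simp add: nonisolated_def)
  show "\<exists>A\<in>arcs_of D. p \<in> A" using flag_gap(2)[OF assms] unfolding arcs_of_def by blast
qed

lemma pairing_corner_arcs: "pairing P corner_arcs"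
  unfolding pairing_def
proof (intro conjI ballI)
  show "\<exists>p q. p \<noteq> q \<and> A \<inter> P = {p, q}" if "A \<in> corner_arcs" for A
    using that piece_flags unfolding corner_arcs_def pieces_def by blast
  fix p assume p: "p \<in> P"
  note v = vt[OF p]
  obtain A where A: "A \<in> arcs_of (vt p)" "p \<in> A" "vt p \<in> nonisolated"
    using arc_of_flag[of "vt p" p] p v by blast
  show "\<exists>!A. A \<in> corner_arcs \<and> p \<in> A"
  proof (rule ex1I[of _ A])
    show "A \<in> corner_arcs \<and> p \<in> A" using A v unfolding corner_arcs_def by blast
    fix B assume "B \<in> corner_arcs \<and> p \<in> B"
    then obtain D where "D \<in> V" "D \<in> nonisolated" "B \<in> arcs_of D" "p \<in> B" unfolding corner_arcs_def by blast
    then show "B = A" using arc_of_flag_unique[of D "vt p" B A p] A v p by simp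
  qed
qed

lemma pairing_side_arcs: "pairing P side_arcs"
  unfolding pairing_def
proof (intro conjI ballI)
  show "\<exists>p q. p \<noteq> q \<and> A \<inter> P = {p, q}" if "A \<in> side_arcs" for A
    using that piece_flags edge_nonisolated unfolding side_arcs_def pieces_def by blast
  fix p assume p: "p \<in> P"
  note v = ed[OF p]
  obtain A where A: "A \<in> arcs_of (ed p)" "p \<in> A" "ed p \<in> nonisolated"
    using arc_of_flag[of "ed p" p] p v by blast
  show "\<exists>!A. A \<in> side_arcs \<and> p \<in> A"
  proof (rule ex1I[of _ A])
    show "A \<in> side_arcs \<and> p \<in> A" using A v unfolding side_arcs_def by blast
    fix B assume "B \<in> side_arcs \<and> p \<in> B"
    then obtain D where "D \<in> E" "D \<in> nonisolated" "B \<in> arcs_of D" "p \<in> B"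
      using edge_nonisolated unfolding side_arcs_def by blast
    then show "B = A" using arc_of_flag_unique[of D "ed p" B A p] A v p by simp
  qed
qed

lemma pairing_segs: "pairing P segs"
  unfolding pairing_def
proof (intro conjI ballI)
  show "\<exists>p q. p \<noteq> q \<and> A \<inter> P = {p, q}" if "A \<in> segs" for A
    using that piece_flags unfolding pieces_def by blast
  fix p assume p: "p \<in> P"
  then show "\<exists>!A. A \<in> segs \<and> p \<in> A" using P_seg seg_disjoint by blast
qed

lemma arc_subset_disc: "D \<in> nonisolated \<Longrightarrow> A \<in> arcs_of D \<Longrightarrow> A \<subseteq> bd D"
proof -
  assume D: "D \<in> nonisolated" and "A \<in> arcs_of D"
  then obtain c where c: "c \<in> disc_gaps D" "A = S closure_of c" by (auto simp: arcs_of_def)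
  have D': "D \<in> V \<union> E" "segs_in D \<noteq> {}" using D by (simp_all add: nonisolated_def)
  show ?thesis using gap_closure[OF D' c(1)] c(2) by metis
qed

lemma mate_in_piece:
  assumes "pairing P \<A>" "p \<in> P"
  obtains A where "A \<in> \<A>" "p \<in> A" "mate P \<A> p \<in> A" "A \<inter> P = {p, mate P \<A> p}"
proof -
  obtain A where A: "A \<in> \<A>" "p \<in> A" using pairing_piece[OF assms] .
  note m = pairing_mate(1)[OF assms(1) A assms(2)]
  then have "mate P \<A> p \<in> A" by blast
  then show thesis using that A m by blast
qed

lemma kappa: "p \<in> P \<Longrightarrow> kappa p \<in> P \<and> kappa p \<noteq> p \<and> kappa (kappa p) = p \<and> vt (kappa p) = vt p"
proof -
  assume p: "p \<in> P"
  obtain A where A: "A \<in> corner_arcs" "p \<in> A" "mate P corner_arcs p \<in> A"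
    using mate_in_piece[OF pairing_corner_arcs p] by metis
  then obtain v where v: "v \<in> V" "v \<in> nonisolated" "A \<in> arcs_of v" unfolding corner_arcs_def by blast
  then have "A \<subseteq> v" using arc_subset_disc bd_subset by blast
  then have "vt (kappa p) = v" "vt p = v" using A vt_eq[OF v(1)] unfolding kappa_def by blast+
  then show ?thesis using pairing_involution[OF pairing_corner_arcs p] unfolding kappa_def by simp
qed

lemma sigma: "p \<in> P \<Longrightarrow> sigma p \<in> P \<and> sigma p \<noteq> p \<and> sigma (sigma p) = p \<and> ed (sigma p) = ed p \<and> vt (sigma p) = vt p"
proof -
  assume p: "p \<in> P"
  obtain s where s: "s \<in> segs" "p \<in> s" "mate P segs p \<in> s"
    using mate_in_piece[OF pairing_segs p] by metis
  have "s \<subseteq> ed p" "s \<subseteq> vt p"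
    using seg_in_disc[OF s(1) _ s(2)] ed[OF p] vt[OF p] unfolding segs_in_def by blast+
  then have "ed (sigma p) = ed p" "vt (sigma p) = vt p"
    using s(3) ed_eq vt_eq ed[OF p] vt[OF p] unfolding sigma_def by blast+
  then show ?thesis using pairing_involution[OF pairing_segs p] unfolding sigma_def by simp
qed

lemma eps: "p \<in> P \<Longrightarrow> eps p \<in> P \<and> eps p \<noteq> p \<and> eps (eps p) = p \<and> ed (eps p) = ed p"
proof -
  assume p: "p \<in> P"
  obtain A where A: "A \<in> side_arcs" "p \<in> A" "mate P side_arcs p \<in> A"
    using mate_in_piece[OF pairing_side_arcs p] by metis
  then obtain e where e: "e \<in> E" "A \<in> arcs_of e" unfolding side_arcs_def by blast
  then have "A \<subseteq> e" using arc_subset_disc bd_subset edge_nonisolated by blast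
  then have "ed (eps p) = e" "ed p = e" using A ed_eq[OF e(1)] unfolding eps_def by blast+
  then show ?thesis using pairing_involution[OF pairing_side_arcs p] unfolding eps_def by simp
qed

text \<open>A side with both ends on one segment would leave no room for the second segment of the edge.\<close>

lemma eps_other_seg:
  assumes p: "p \<in> P" and s: "s \<in> segs" "p \<in> s"
  shows "eps p \<notin> s"
proof
  assume es: "eps p \<in> s"
  obtain A where A: "A \<in> side_arcs" "p \<in> A" "A \<inter> P = {p, eps p}"
    using mate_in_piece[OF pairing_side_arcs p] unfolding eps_def by metis
  then obtain e c where e: "e \<in> E" "c \<in> disc_gaps e" "A = S closure_of c" unfolding side_arcs_def arcs_of_def by blast
  have D: "e \<in> V \<union> E" "segs_in e \<noteq> {}" using edge_nonisolated[OF e(1)] by (auto simp: nonisolated_def)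
  have pe: "p \<in> e" using arc_subset_disc[OF edge_nonisolated[OF e(1)]] A(2) e bd_subset[of e] unfolding arcs_of_def by blast
  interpret A: arcs_on_circle S "bd e" "segs_in e" using D by (rule arcs)
  have "S closure_of c \<subseteq> c \<union> s"
  proof
    fix z assume z: "z \<in> S closure_of c"
    show "z \<in> c \<union> s"
    proof (cases "z \<in> P")
      case True
      then have "z \<in> {p, eps p}" using z e(3) A(3) by blast
      then show ?thesis using s es by blast
    next
      case False
      then show ?thesis using arc_minus_P(1)[OF edge_nonisolated[OF e(1)] e(2) z] by blast
    qed
  qed
  moreover have "s \<in> segs_in e" using seg_in_disc[OF s(1) D(1) s(2) pe] .
  ultimately have "segs_in e = {s}" using A.gap_within_one_arc[of c s] e(2) disc_gaps_eq[OF D] by simp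
  then show False using card_segs_in[OF e(1)] by simp
qed

lemma segs_of_edge:
  assumes p: "p \<in> P"
  obtains s s' where "segs_in (ed p) = {s, s'}" "s \<noteq> s'" "s \<in> segs" "s' \<in> segs" "s \<inter> P = {p, sigma p}" "s' \<inter> P = {eps p, sigma (eps p)}"
proof -
  note e = ed[OF p]
  obtain s where s: "s \<in> segs" "p \<in> s" "s \<inter> P = {p, sigma p}"
    using mate_in_piece[OF pairing_segs p] unfolding sigma_def by metis
  have ep: "eps p \<in> P" using eps[OF p] by blast
  obtain s' where s': "s' \<in> segs" "eps p \<in> s'" "s' \<inter> P = {eps p, sigma (eps p)}"
    using mate_in_piece[OF pairing_segs ep] unfolding sigma_def by metis
  have ne: "s \<noteq> s'" using eps_other_seg[OF p s(1,2)] s'(2) by blast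
  have "eps p \<in> ed p" using eps[OF p] ed[OF ep] by simp
  then have sub: "{s, s'} \<subseteq> segs_in (ed p)"
    using seg_in_disc s s' e by blast
  have "card {s, s'} = card (segs_in (ed p))" using ne card_segs_in e by simp
  then have "segs_in (ed p) = {s, s'}" using sub finite_segs_in card_subset_eq by metis
  then show thesis using that ne s s' by blast
qed

lemma sigma_ne_eps: "p \<in> P \<Longrightarrow> sigma p \<noteq> eps p"
proof
  assume p: "p \<in> P" and eq: "sigma p = eps p"
  obtain s where s: "s \<in> segs" "p \<in> s" "s \<inter> P = {p, sigma p}"
    using mate_in_piece[OF pairing_segs p] unfolding sigma_def by metis
  then show False using eps_other_seg[OF p s(1,2)] eq by auto
qed

text \<open>An edge has exactly two segments, and a side leaves the segment from which it starts; so the four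
  listed flags exhaust the ends of both segments.\<close>

lemma edge_flags: "p \<in> P \<Longrightarrow> q \<in> P \<Longrightarrow> ed q = ed p \<Longrightarrow> q \<in> {p, sigma p, eps p, sigma (eps p)}"
proof -
  assume p: "p \<in> P" and q: "q \<in> P" "ed q = ed p"
  obtain s s' where s: "segs_in (ed p) = {s, s'}" "s \<inter> P = {p, sigma p}" "s' \<inter> P = {eps p, sigma (eps p)}"
    using segs_of_edge[OF p] by metis
  obtain t where t: "t \<in> segs" "q \<in> t" using P_seg[OF q(1)] by blast
  then have "t \<in> segs_in (ed p)" using seg_in_disc[OF t(1) _ t(2), of "ed q"] ed[OF q(1)] q(2) by simp
  then show ?thesis using s t(2) q(1) by blast
qed

text \<open>Among the four flags of the edge, \<open>eps (sigma p)\<close> can only be the one not yet reached.\<close>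

lemma sigma_eps_commute: "p \<in> P \<Longrightarrow> sigma (eps p) = eps (sigma p)"
proof -
  assume p: "p \<in> P"
  note sp = sigma[OF p]
  then have sP: "sigma p \<in> P" by blast
  note esp = eps[OF sP]
  have "eps (sigma p) \<in> {p, sigma p, eps p, sigma (eps p)}" using edge_flags[OF p, of "eps (sigma p)"] esp sp by simp
  moreover have "eps (sigma p) \<noteq> sigma p" using esp by blast
  moreover have "eps (sigma p) \<noteq> p" using sigma_ne_eps[OF sP] sp by auto
  moreover have "eps (sigma p) \<noteq> eps p" using esp eps[OF p] sp by metis
  ultimately show ?thesis by simp
qed

lemma edge_has_flag: "e \<in> E \<Longrightarrow> \<exists>p\<in>P. ed p = e"
proof -
  assume e: "e \<in> E"
  then obtain s where s: "s \<in> segs" "s \<subseteq> e" using edge_nonisolated[OF e] by (auto simp: nonisolated_def segs_in_def)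
  then obtain p where "p \<in> s \<inter> P" using piece_flags[of s] unfolding pieces_def by blast
  then show ?thesis using ed_eq[OF e] s by blast
qed

text \<open>The circle around a vertex visits all its flags, moving along segments and corners.\<close>

lemma vertex_flags:
  assumes v: "v \<in> V" and F: "F \<subseteq> P" "\<And>p. p \<in> F \<Longrightarrow> kappa p \<in> F \<and> sigma p \<in> F"
    and p: "p \<in> F" "p \<in> v" and q: "q \<in> P" "q \<in> v"
  shows "q \<in> F"
proof -
  have pP: "p \<in> P" using p F by blast
  have ni: "v \<in> nonisolated" using arc_of_flag(1)[of v p] v p pP by blast
  have D: "v \<in> V \<union> E" "segs_in v \<noteq> {}" using ni by (auto simp: nonisolated_def)
  let ?A = "segs_in v \<union> arcs_of v"
  have sub: "?A \<subseteq> pieces" using ni unfolding pieces_def segs_in_def by blast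
  have Un: "\<Union>?A = bd v"
  proof
    show "\<Union>?A \<subseteq> bd v" using segs_in_bd[OF D(1)] arc_subset_disc[OF ni] by blast
    show "bd v \<subseteq> \<Union>?A"
    proof
      fix x assume x: "x \<in> bd v"
      show "x \<in> \<Union>?A"
      proof (cases "x \<in> \<Union>segs")
        case True
        then obtain s where "s \<in> segs" "x \<in> s" by blast
        then show ?thesis using seg_in_disc[OF _ D(1)] x bd_subset[of v] by blast
      next
        case False
        have "\<Union>(disc_gaps v) = bd v - \<Union>segs"
          unfolding disc_gaps_def Union_connected_components_of using disc_subset[OF D(1)] bd_subset[of v] by auto
        then obtain c where c: "c \<in> disc_gaps v" "x \<in> c" using x False by blast
        have "c \<subseteq> topspace S" using gap_subset[OF D(1) c(1)] disc_subset[OF D(1)] bd_subset[of v] by blast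
        then have "x \<in> S closure_of c" using c(2) closure_of_subset by blast
        then show ?thesis using c(1) unfolding arcs_of_def by blast
      qed
    qed
  qed
  interpret C: topological_circle S "bd v" using D(1) by (rule circle)
  have "connectedin S (bd v)" by (rule C.connected_C)
  then have conn: "\<forall>F \<subseteq> P \<inter> bd v. (\<forall>A\<in>?A. A \<inter> P \<subseteq> F \<or> A \<inter> F = {}) \<longrightarrow> F = {} \<or> F = P \<inter> bd v"
    by (rule connected_pieces_iff[OF sub, unfolded Un, THEN iffD1])
  have Pv: "x \<in> bd v" if "x \<in> P" "x \<in> v" for x
    using that P_seg[of x] seg_in_bd[OF _ D(1)] by blast
  have "\<forall>A\<in>?A. A \<inter> P \<subseteq> F \<inter> bd v \<or> A \<inter> (F \<inter> bd v) = {}"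
  proof
    fix A assume A: "A \<in> ?A"
    show "A \<inter> P \<subseteq> F \<inter> bd v \<or> A \<inter> (F \<inter> bd v) = {}"
    proof (cases "A \<inter> (F \<inter> bd v) = {}")
      case False
      then obtain x where x: "x \<in> A" "x \<in> F" by blast
      have xP: "x \<in> P" using x F(1) by blast
      have Abd: "A \<subseteq> bd v" using A Un by blast
      have "A \<inter> P = {x, kappa x} \<or> A \<inter> P = {x, sigma x}"
      proof (cases "A \<in> segs_in v")
        case True
        then have "A \<in> segs" by (simp add: segs_in_def)
        then show ?thesis using pairing_mate(1)[OF pairing_segs _ x(1) xP] unfolding sigma_def by blast
      next
        case False
        then have "A \<in> corner_arcs" using A v ni unfolding corner_arcs_def by blast
        then show ?thesis using pairing_mate(1)[OF pairing_corner_arcs _ x(1) xP] unfolding kappa_def by blast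
      qed
      then have "A \<inter> P \<subseteq> F" using F(2)[OF x(2)] x(2) by auto
      then show ?thesis using Abd by blast
    qed simp
  qed
  moreover have "F \<inter> bd v \<subseteq> P \<inter> bd v" using F(1) by blast
  ultimately have "F \<inter> bd v = {} \<or> F \<inter> bd v = P \<inter> bd v"
    by (intro conn[rule_format]) blast+
  then show ?thesis using Pv p q pP by blast
qed

end


lemma card_connected_components_eq_1_iff:
  assumes "topspace T \<noteq> {}"
  shows "card (connected_components_of T) = 1 \<longleftrightarrow> connected_space T"
proof
  assume "card (connected_components_of T) = 1"
  then obtain c where c: "connected_components_of T = {c}" by (rule card_1_singletonE)
  then have "c = topspace T" using Union_connected_components_of[of T] by simp
  moreover have "connectedin T c" using connectedin_connected_components_of[of c T] c by simp
  ultimately show "connected_space T" by (simp add: connectedin_topspace)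
next
  assume "connected_space T"
  then have "connected_components_of T = {topspace T}"
    using assms connected_components_of_connected_space[of T] by auto
  then show "card (connected_components_of T) = 1" by simp
qed

context ribbon
begin

lemma flags_of_disc:
  assumes D: "D \<in> V \<union> E" and F: "F \<subseteq> P" "\<And>p. p \<in> F \<Longrightarrow> kappa p \<in> F \<and> sigma p \<in> F \<and> eps p \<in> F"
    and p: "p \<in> F" "p \<in> D" and q: "q \<in> P" "q \<in> D"
  shows "q \<in> F"
proof (cases "D \<in> V")
  case True
  then show ?thesis using vertex_flags[of D F p q] F p q by blast
next
  case False
  then have DE: "D \<in> E" using D by simp
  have "p \<in> P" using p F by blast
  moreover have "ed p = D" "ed q = D" using ed_eq[OF DE] p q by simp_all
  ultimately have "q \<in> {p, sigma p, eps p, sigma (eps p)}" using edge_flags[of p q] q(1) by simp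
  then show ?thesis using F(2) p(1) by blast
qed

lemma seg_flag: "s \<in> segs \<Longrightarrow> \<exists>p. p \<in> s \<and> p \<in> P"
  using piece_flags[of s] unfolding pieces_def by blast

lemma bd_minus_segs_arcs:
  assumes D: "D \<in> V \<union> E"
  shows "bd D - \<Union>segs \<subseteq> \<Union>(arcs_of D)"
proof
  fix x assume x: "x \<in> bd D - \<Union>segs"
  have "\<Union>(disc_gaps D) = bd D - \<Union>segs"
    unfolding disc_gaps_def Union_connected_components_of using disc_subset[OF D] bd_subset[of D] by auto
  then obtain c where c: "c \<in> disc_gaps D" "x \<in> c" using x by blast
  have "c \<subseteq> topspace S" using gap_subset[OF D c(1)] disc_subset[OF D] bd_subset[of D] by blast
  then have "x \<in> S closure_of c" using c(2) closure_of_subset[of c S] by blast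
  then show "x \<in> \<Union>(arcs_of D)" using c(1) unfolding arcs_of_def by blast
qed

section \<open>Spanning ribbon subgraphs\<close>

definition spanned :: "'a set set \<Rightarrow> 'a set" where "spanned X = \<Union>V \<union> \<Union>X"

lemma open_without_discs: "\<D> \<subseteq> V \<union> E \<Longrightarrow> openin S (topspace S - \<Union>\<D>)"
proof -
  assume D: "\<D> \<subseteq> V \<union> E"
  then have "finite \<D>" using finite_V finite_E by (meson finite_Un finite_subset)
  then have "closedin S (\<Union>\<D>)" using disc_closed D by (intro closedin_Union) auto
  then show ?thesis by (rule openin_diff[OF openin_topspace])
qed

lemma spanned_closed: "X \<subseteq> E \<Longrightarrow> closedin S (spanned X)"
proof -
  assume X: "X \<subseteq> E"
  have "finite (V \<union> X)" using finite_V finite_E X finite_subset by blast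
  then have "closedin S (\<Union>(V \<union> X))" using disc_closed X by (intro closedin_Union) auto
  then show ?thesis by (simp add: spanned_def)
qed

lemma spanned_subset: "X \<subseteq> E \<Longrightarrow> spanned X \<subseteq> topspace S"
  using spanned_closed closedin_subset by metis

lemma near_vertex:
  assumes X: "X \<subseteq> E" and v: "v \<in> V" "z \<in> v" "z \<notin> \<Union>X"
  shows "z \<in> surface_boundary (subtopology S (spanned X)) \<longleftrightarrow> z \<in> bd v"
    "locally_like half_plane (subtopology S (spanned X)) z"
proof -
  let ?N = "topspace S - \<Union>((V - {v}) \<union> X)"
  have N: "openin S ?N" using X by (intro open_without_discs) auto
  have zv: "z \<notin> \<Union>(V - {v})" using V_disjoint v(1,2) by blast
  have vS: "v \<subseteq> topspace S" using disc_subset v(1) by blast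
  have eq: "spanned X \<inter> ?N = v \<inter> ?N" using v(1) unfolding spanned_def by blast
  have z: "z \<in> spanned X \<inter> ?N" using v zv vS unfolding spanned_def by blast
  show "z \<in> surface_boundary (subtopology S (spanned X)) \<longleftrightarrow> z \<in> bd v"
    unfolding disc_boundary_def by (rule surface_boundary_cong[OF N eq z spanned_subset[OF X] vS])
  have "locally_like half_plane (subtopology S v) z"
    using disc_locally_half_plane[OF disc Hausdorff v(2)] v(1) by blast
  then show "locally_like half_plane (subtopology S (spanned X)) z"
    using locally_like_cong[OF N eq z spanned_subset[OF X] vS] by blast
qed

lemma near_edge:
  assumes X: "X \<subseteq> E" and e: "e \<in> X" "z \<in> e" "z \<notin> \<Union>V"
  shows "z \<in> surface_boundary (subtopology S (spanned X)) \<longleftrightarrow> z \<in> bd e"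
    "locally_like half_plane (subtopology S (spanned X)) z"
proof -
  let ?N = "topspace S - \<Union>(V \<union> (X - {e}))"
  have eE: "e \<in> E" using X e(1) by blast
  have N: "openin S ?N" using X by (intro open_without_discs) auto
  have ze: "z \<notin> \<Union>(X - {e})" using E_disjoint[OF eE] e(2) X by blast
  have eS: "e \<subseteq> topspace S" using disc_subset eE by blast
  have eq: "spanned X \<inter> ?N = e \<inter> ?N" using e(1) unfolding spanned_def by blast
  have z: "z \<in> spanned X \<inter> ?N" using e ze eS unfolding spanned_def by blast
  show "z \<in> surface_boundary (subtopology S (spanned X)) \<longleftrightarrow> z \<in> bd e"
    unfolding disc_boundary_def by (rule surface_boundary_cong[OF N eq z spanned_subset[OF X] eS])
  have "locally_like half_plane (subtopology S e) z"
    using disc_locally_half_plane[OF disc Hausdorff e(2)] eE by blast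
  then show "locally_like half_plane (subtopology S (spanned X)) z"
    using locally_like_cong[OF N eq z spanned_subset[OF X] eS] by blast
qed

lemma near_segment:
  assumes X: "X \<subseteq> E" and v: "v \<in> V" "z \<in> v" and e: "e \<in> X" "z \<in> e"
  shows "locally_like A (subtopology S (spanned X)) z \<longleftrightarrow> locally_like A (subtopology S (v \<union> e)) z"
proof -
  let ?N = "topspace S - \<Union>((V - {v}) \<union> (X - {e}))"
  have eE: "e \<in> E" using X e(1) by blast
  have N: "openin S ?N" using X by (intro open_without_discs) auto
  have zv: "z \<notin> \<Union>(V - {v})" using V_disjoint v by blast
  have ze: "z \<notin> \<Union>(X - {e})" using E_disjoint[OF eE] e(2) X by blast
  have veS: "v \<union> e \<subseteq> topspace S" using disc_subset eE v(1) by blast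
  have eq: "spanned X \<inter> ?N = (v \<union> e) \<inter> ?N" using e(1) v(1) unfolding spanned_def by blast
  have z: "z \<in> spanned X \<inter> ?N" using v zv ze veS unfolding spanned_def by blast
  show ?thesis by (rule locally_like_cong[OF N eq z spanned_subset[OF X] veS])
qed

lemma spanned_E: "spanned E = topspace S" by (simp add: spanned_def topspace_S)

lemma spanned_cases:
  assumes "z \<in> spanned X"
  obtains (vertex) v where "v \<in> V" "z \<in> v" "z \<notin> \<Union>X"
    | (edge) e where "e \<in> X" "z \<in> e" "z \<notin> \<Union>V"
    | (both) v e where "v \<in> V" "z \<in> v" "e \<in> X" "z \<in> e"
  using assms unfolding spanned_def by blast

text \<open>Every point of a spanning ribbon subgraph sees either a single disc or the same surroundings
  as in the whole surface.\<close>

lemma surface_spanned: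
  assumes X: "X \<subseteq> E"
  shows "surface_with_boundary (subtopology S (spanned X))"
  unfolding surface_with_boundary_iff
proof (intro conjI ballI)
  have "second_countable S" using surface by (simp add: surface_with_boundary_def)
  then show "second_countable (subtopology S (spanned X))" by (rule second_countable_subtopology)
  show "Hausdorff_space (subtopology S (spanned X))" using Hausdorff by (rule Hausdorff_space_subtopology)
  fix z assume "z \<in> topspace (subtopology S (spanned X))"
  then have z: "z \<in> spanned X" by simp
  then show "locally_like half_plane (subtopology S (spanned X)) z"
  proof (cases rule: spanned_cases)
    case (vertex v)
    then show ?thesis by (rule near_vertex(2)[OF X])
  next
    case (edge e)
    then show ?thesis by (rule near_edge(2)[OF X])
  next
    case (both v e)
    have "z \<in> topspace S" using spanned_subset[OF X] z by blast
    then have "locally_like half_plane (subtopology S (spanned E)) z"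
      using surface by (simp add: spanned_E surface_with_boundary_iff)
    then show ?thesis
      using near_segment[OF X both] near_segment[OF order_refl both(1,2) _ both(4)] X both(3) by blast
  qed
qed

definition boundary_pieces :: "'a set set \<Rightarrow> 'a set set" where
  "boundary_pieces X = corner_arcs \<union> {s \<in> segs. s \<inter> \<Union>X = {}} \<union> \<Union>(arcs_of ` X)"

lemma boundary_pieces_subset: "X \<subseteq> E \<Longrightarrow> boundary_pieces X \<subseteq> pieces"
  using edge_nonisolated unfolding boundary_pieces_def corner_arcs_def pieces_def by blast

lemma flags_in_corner_arcs: "P \<subseteq> \<Union>corner_arcs"
  using mate_in_piece[OF pairing_corner_arcs] by blast

text \<open>Away from the attaching segments the boundary is that of a single disc. Inside a segment of a present
  edge two discs are glued, which gives a planar neighbourhood. The ends of such a segment belong to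
  the boundary because they are limits of corner points and the boundary is closed.\<close>

lemma surface_boundary_spanned:
  assumes X: "X \<subseteq> E" and ni: "V \<subseteq> nonisolated"
  shows "surface_boundary (subtopology S (spanned X)) = \<Union>(boundary_pieces X)" (is "?B = _")
proof
  have B_spanned: "?B \<subseteq> spanned X" by (auto simp: surface_boundary_def)
  show "?B \<subseteq> \<Union>(boundary_pieces X)"
  proof
    fix z assume zB: "z \<in> ?B"
    then have "z \<in> spanned X" using B_spanned by blast
    then show "z \<in> \<Union>(boundary_pieces X)"
    proof (cases rule: spanned_cases)
      case (vertex v)
      then have zv: "z \<in> bd v" using near_vertex(1)[OF X vertex] zB by blast
      show ?thesis
      proof (cases "z \<in> \<Union>segs")
        case True
        then obtain s where s: "s \<in> segs" "z \<in> s" by blast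
        have "s \<inter> \<Union>X = {}"
        proof (rule ccontr)
          assume "s \<inter> \<Union>X \<noteq> {}"
          then obtain e x where "e \<in> X" "x \<in> s" "x \<in> e" by blast
          then have "s \<subseteq> e" using seg_in_disc[OF s(1), of e x] X unfolding segs_in_def by blast
          then show False using s(2) vertex(3) \<open>e \<in> X\<close> by blast
        qed
        then show ?thesis using s unfolding boundary_pieces_def by blast
      next
        case False
        then have "z \<in> \<Union>(arcs_of v)" using zv bd_minus_segs_arcs[of v] vertex(1) by blast
        then show ?thesis using vertex(1) ni unfolding boundary_pieces_def corner_arcs_def by blast
      qed
    next
      case (edge e)
      then have "z \<in> bd e" using near_edge(1)[OF X edge] zB by blast
      moreover have "z \<notin> \<Union>segs" using edge(3) Union_segs by blast
      ultimately have "z \<in> \<Union>(arcs_of e)" using bd_minus_segs_arcs[of e] edge(1) X by blast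
      then show ?thesis using edge(1) unfolding boundary_pieces_def by blast
    next
      case (both v e)
      have eE: "e \<in> E" using both X by blast
      then have "z \<in> \<Union>segs" using both Union_segs by blast
      then obtain s where s: "s \<in> segs" "z \<in> s" by blast
      have "z \<in> ends S s"
      proof (rule ccontr)
        assume "z \<notin> ends S s"
        then have "z \<in> s - ends S s" using s(2) by blast
        moreover have "s \<subseteq> bd v" "s \<subseteq> bd e"
          using seg_in_bd[OF s(1) _ s(2)] both eE by blast+
        moreover have "topological_disc S v" "topological_disc S e" using disc both(1) eE by blast+
        ultimately have "locally_like UNIV (subtopology S (v \<union> e)) z"
          using glued_discs_planar[OF Hausdorff _ _ seg[OF s(1)]] vertex_edge_int[OF both(1) eE] by metis
        then have "locally_like UNIV (subtopology S (spanned X)) z" using near_segment[OF X both] by blast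
        then show False using zB by (simp add: surface_boundary_iff)
      qed
      then have "z \<in> P" using s by (auto simp: P_def)
      then show ?thesis using flags_in_corner_arcs unfolding boundary_pieces_def by blast
    qed
  qed
  have closedB: "closedin S ?B"
    using closedin_surface_boundary spanned_closed[OF X] by (rule closedin_trans_full)
  have closure: "S closure_of c \<subseteq> ?B" if "c \<subseteq> ?B" for c
    using that closedB by (rule closure_of_minimal)
  show "\<Union>(boundary_pieces X) \<subseteq> ?B"
  proof
    fix z assume "z \<in> \<Union>(boundary_pieces X)"
    then consider v c where "v \<in> V" "c \<in> disc_gaps v" "z \<in> S closure_of c"
      | s where "s \<in> segs" "s \<inter> \<Union>X = {}" "z \<in> s"
      | e c where "e \<in> X" "c \<in> disc_gaps e" "z \<in> S closure_of c"
      unfolding boundary_pieces_def corner_arcs_def arcs_of_def by blast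
    then show "z \<in> ?B"
    proof cases
      case (1 v c)
      have "c \<subseteq> ?B"
      proof
        fix x assume "x \<in> c"
        then have x: "x \<in> bd v" "x \<notin> \<Union>segs" using gap_subset[of v c] 1 by blast+
        then have xv: "x \<in> v" using bd_subset[of v] by blast
        then have "x \<notin> \<Union>X" using x(2) 1(1) X Union_segs by blast
        then show "x \<in> ?B" using near_vertex(1)[OF X 1(1) xv] x(1) by blast
      qed
      then show ?thesis using closure 1(3) by blast
    next
      case (2 s)
      then obtain v where v: "v \<in> V" "s \<subseteq> bd v" using seg_vertex by blast
      then have "z \<in> bd v" "z \<in> v" "z \<notin> \<Union>X" using 2 bd_subset[of v] by blast+
      then show ?thesis using near_vertex(1)[OF X v(1)] by blast
    next
      case (3 e c)
      have eE: "e \<in> V \<union> E" using 3 X by blast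
      have "c \<subseteq> ?B"
      proof
        fix x assume "x \<in> c"
        then have x: "x \<in> bd e" "x \<notin> \<Union>segs" using gap_subset[OF eE 3(2)] by blast+
        then have xe: "x \<in> e" using bd_subset[of e] by blast
        then have "x \<notin> \<Union>V" using x(2) 3(1) X Union_segs by blast
        then show "x \<in> ?B" using near_edge(1)[OF X 3(1) xe] x(1) by blast
      qed
      then show ?thesis using closure 3(3) by blast
    qed
  qed
qed

text \<open>Each boundary piece carries one pair of flags: a \<open>kappa\<close>-pair for a corner, an \<open>eps\<close>-pair for a side, a
  \<open>sigma\<close>-pair for a segment.\<close>

lemma boundary_pieces_closed_iff:
  assumes X: "X \<subseteq> E" and F: "F \<subseteq> P"
  shows "(\<forall>A\<in>boundary_pieces X. A \<inter> P \<subseteq> F \<or> A \<inter> F = {}) \<longleftrightarrow>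
    (\<forall>p\<in>F. kappa p \<in> F \<and> (if ed p \<in> X then eps p \<in> F else sigma p \<in> F))" (is "?L \<longleftrightarrow> ?R")
proof
  assume L: ?L
  show ?R
  proof
    fix p assume pF: "p \<in> F"
    then have p: "p \<in> P" using F by blast
    have use: "q \<in> F" if "A \<in> boundary_pieces X" "p \<in> A" "A \<inter> P = {p, q}" for A q
      using L that pF by blast
    obtain A where "A \<in> corner_arcs" "p \<in> A" "A \<inter> P = {p, kappa p}"
      using mate_in_piece[OF pairing_corner_arcs p] unfolding kappa_def by metis
    then have "kappa p \<in> F" using use[of A] unfolding boundary_pieces_def by blast
    moreover have "eps p \<in> F" if eX: "ed p \<in> X"
    proof -
      obtain A where A: "A \<in> side_arcs" "p \<in> A" "A \<inter> P = {p, eps p}"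
        using mate_in_piece[OF pairing_side_arcs p] unfolding eps_def by metis
      then obtain e where e: "e \<in> E" "A \<in> arcs_of e" unfolding side_arcs_def by blast
      then have "p \<in> e" using arc_subset_disc[OF edge_nonisolated] bd_subset[of e] A(2) by blast
      then have "e \<in> X" using ed_eq[OF e(1)] eX by blast
      then show ?thesis using use[of A] A e unfolding boundary_pieces_def by blast
    qed
    moreover have "sigma p \<in> F" if eX: "ed p \<notin> X"
    proof -
      obtain s where s: "s \<in> segs" "p \<in> s" "s \<inter> P = {p, sigma p}"
        using mate_in_piece[OF pairing_segs p] unfolding sigma_def by metis
      have "s \<inter> \<Union>X = {}"
      proof (rule ccontr)
        assume "s \<inter> \<Union>X \<noteq> {}"
        then obtain e x where e: "e \<in> X" "x \<in> s" "x \<in> e" by blast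
        then have "s \<subseteq> e" using seg_in_disc[OF s(1), of e x] X unfolding segs_in_def by blast
        then have "ed p = e" using ed_eq[of e p] e(1) X s(2) by blast
        then show False using e eX by blast
      qed
      then show ?thesis using use[of s] s unfolding boundary_pieces_def by blast
    qed
    ultimately show "kappa p \<in> F \<and> (if ed p \<in> X then eps p \<in> F else sigma p \<in> F)" by simp
  qed
next
  assume R: ?R
  show ?L
  proof
    fix A assume A: "A \<in> boundary_pieces X"
    show "A \<inter> P \<subseteq> F \<or> A \<inter> F = {}"
    proof (cases "A \<inter> F = {}")
      case False
      then obtain p where p: "p \<in> A" "p \<in> F" by blast
      then have pP: "p \<in> P" using F by blast
      note Rp = R[rule_format, OF p(2)]
      consider "A \<in> corner_arcs" | "A \<in> segs" "A \<inter> \<Union>X = {}" | e where "e \<in> X" "A \<in> arcs_of e"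
        using A unfolding boundary_pieces_def by blast
      then have "A \<inter> P \<subseteq> F"
      proof cases
        case 1
        then have "A \<inter> P = {p, kappa p}" using pairing_mate(1)[OF pairing_corner_arcs _ p(1) pP] by (simp add: kappa_def)
        then show ?thesis using Rp p(2) by simp
      next
        case 2
        have "ed p \<notin> X" using ed[OF pP] p(1) 2(2) by blast
        moreover have "A \<inter> P = {p, sigma p}"
          using pairing_mate(1)[OF pairing_segs 2(1) p(1) pP] by (simp add: sigma_def)
        ultimately show ?thesis using Rp p(2) by simp
      next
        case 3
        have eE: "e \<in> E" using 3(1) X by blast
        then have "p \<in> e" using arc_subset_disc[OF edge_nonisolated 3(2)] bd_subset[of e] p(1) by blast
        then have "ed p \<in> X" using ed_eq[OF eE] 3(1) by simp
        moreover have "A \<in> side_arcs" using 3(2) eE unfolding side_arcs_def by blast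
        then have "A \<inter> P = {p, eps p}"
          using pairing_mate(1)[OF pairing_side_arcs _ p(1) pP] by (simp add: eps_def)
        ultimately show ?thesis using Rp p(2) by simp
      qed
      then show ?thesis ..
    qed simp
  qed
qed

text \<open>Segments are finitely many disjoint compact connected sets, so any union of them has exactly these
  as components.\<close>

lemma attaching_segments_spanned:
  assumes X: "X \<subseteq> E"
  shows "attaching_segments (spanning_ribbon_subgraph G X) = {s \<in> segs. s \<inter> \<Union>X \<noteq> {}}" (is "_ = ?A")
proof -
  have Un: "\<Union>V \<inter> \<Union>X = \<Union>?A"
  proof
    show "\<Union>V \<inter> \<Union>X \<subseteq> \<Union>?A"
    proof
      fix x assume x: "x \<in> \<Union>V \<inter> \<Union>X"
      then have "x \<in> \<Union>segs" using X Union_segs by blast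
      then show "x \<in> \<Union>?A" using x by blast
    qed
    show "\<Union>?A \<subseteq> \<Union>V \<inter> \<Union>X"
    proof
      fix x assume "x \<in> \<Union>?A"
      then obtain s e y where s: "s \<in> segs" "x \<in> s" "e \<in> X" "y \<in> s" "y \<in> e" by blast
      then have "s \<subseteq> e" using seg_in_disc[OF s(1), of e y] X unfolding segs_in_def by blast
      moreover have "x \<in> \<Union>V" using s(1,2) Union_segs by blast
      ultimately show "x \<in> \<Union>V \<inter> \<Union>X" using s by blast
    qed
  qed
  have "attaching_segments (spanning_ribbon_subgraph G X) =
      connected_components_of (subtopology S (spanned X \<inter> (\<Union>V \<inter> \<Union>X)))"
    by (simp add: attaching_segments_def spanning_ribbon_subgraph_def subtopology_subtopology spanned_def)
  also have "spanned X \<inter> (\<Union>V \<inter> \<Union>X) = \<Union>?A" using Un unfolding spanned_def by blast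
  also have "connected_components_of (subtopology S (\<Union>?A)) = ?A"
  proof (rule connected_components_of_disjoint_closed_Union)
    show "finite ?A" using finite_segs by simp
    show "closedin S A \<and> connectedin S A \<and> A \<noteq> {}" if "A \<in> ?A" for A
      using that seg_nonempty piece_closed_connected[of A] unfolding pieces_def by blast
    show "A \<inter> B = {}" if "A \<in> ?A" "B \<in> ?A" "A \<noteq> B" for A B
      using that seg_disjoint by blast
  qed
  finally show ?thesis .
qed

lemma ribbon_graph_spanned:
  assumes X: "X \<subseteq> E"
  shows "ribbon_graph (spanning_ribbon_subgraph G X)"
proof -
  let ?H = "spanning_ribbon_subgraph G X"
  have sel: "surface ?H = subtopology S (spanned X)" "rverts ?H = V" "redges ?H = X"
    by (simp_all add: spanning_ribbon_subgraph_def spanned_def)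
  have sub: "subtopology (subtopology S (spanned X)) D = subtopology S D" if "D \<subseteq> spanned X" for D
    using that by (simp add: subtopology_subtopology Int_absorb1)
  have DM: "D \<subseteq> spanned X" if "D \<in> V \<union> X" for D using that unfolding spanned_def by blast
  have bdM: "disc_boundary (subtopology S (spanned X)) D = bd D" if "D \<in> V \<union> X" for D
    using sub[OF DM[OF that]] by (simp add: disc_boundary_def)
  have top: "topspace (subtopology S (spanned X)) = spanned X" using spanned_subset[OF X] by auto
  show ?thesis
    unfolding ribbon_graph_def sel attaching_segments_spanned[OF X] top
  proof (intro conjI ballI)
    show "surface_with_boundary (subtopology S (spanned X))" by (rule surface_spanned[OF X])
    show "finite V" "finite X" using finite_V finite_E X finite_subset by blast+
    show "spanned X = \<Union>V \<union> \<Union>X" by (simp add: spanned_def)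
    show "topological_disc (subtopology S (spanned X)) D" if "D \<in> V \<union> X" for D
    proof -
      have "topological_disc S D" using disc that X by blast
      then show ?thesis using sub[OF DM[OF that]] DM[OF that] top by (simp add: topological_disc_def)
    qed
    show "disjoint V" using ribbon_graph by (simp add: ribbon_graph_def)
    show "disjoint X" using ribbon_graph X by (meson disjoint_def pairwise_subset ribbon_graph_def)
  next
    fix s assume "s \<in> {s \<in> segs. s \<inter> \<Union>X \<noteq> {}}"
    then obtain e x where s: "s \<in> segs" and e: "e \<in> X" "x \<in> s" "x \<in> e" by blast
    obtain v where v: "v \<in> V" "s \<subseteq> bd v" using seg_vertex[OF s] by blast
    have sv: "s \<subseteq> v" using v(2) bd_subset[of v] by blast
    then have sM: "s \<subseteq> spanned X" using v(1) unfolding spanned_def by blast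
    show "line_segment (subtopology S (spanned X)) s"
      using seg[OF s] sub[OF sM] sM top by (simp add: line_segment_def)
    have se: "s \<subseteq> bd e" using seg_in_bd[OF s _ e(2,3)] X e(1) by blast
    show "\<exists>!v. v \<in> V \<and> s \<subseteq> disc_boundary (subtopology S (spanned X)) v"
    proof (rule ex1I[of _ v])
      show "v \<in> V \<and> s \<subseteq> disc_boundary (subtopology S (spanned X)) v" using v bdM by blast
      fix w assume w: "w \<in> V \<and> s \<subseteq> disc_boundary (subtopology S (spanned X)) w"
      then have "s \<subseteq> w" using bd_subset[of w] bdM[of w] by blast
      then show "w = v" using V_disjoint[of w v x] w v(1) sv e(2) by blast
    qed
    show "\<exists>!e. e \<in> X \<and> s \<subseteq> disc_boundary (subtopology S (spanned X)) e"
    proof (rule ex1I[of _ e])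
      show "e \<in> X \<and> s \<subseteq> disc_boundary (subtopology S (spanned X)) e" using e se bdM by blast
      fix w assume w: "w \<in> X \<and> s \<subseteq> disc_boundary (subtopology S (spanned X)) w"
      then have "s \<subseteq> w" using bd_subset[of w] bdM[of w] by blast
      then show "w = e" using E_disjoint[of w e x] w e X by blast
    qed
  next
    fix e assume e: "e \<in> X"
    have "{s \<in> {s \<in> segs. s \<inter> \<Union>X \<noteq> {}}. s \<subseteq> e} = segs_in e"
      using e seg_nonempty unfolding segs_in_def by blast
    then show "card {s \<in> {s \<in> segs. s \<inter> \<Union>X \<noteq> {}}. s \<subseteq> e} = 2" using card_segs_in[of e] e X by auto
  qed
qed

end

locale connected_ribbon = ribbon +
  assumes connected: "connected_space S" and E_nonempty: "E \<noteq> {}"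
begin

text \<open>A vertex that meets no edge would be a component of its own.\<close>

lemma vertex_nonisolated: "V \<subseteq> nonisolated"
proof
  fix v assume v: "v \<in> V"
  have "v \<inter> \<Union>E \<noteq> {}"
  proof
    assume empty: "v \<inter> \<Union>E = {}"
    let ?R = "\<Union>((V - {v}) \<union> E)"
    have "closedin S v" using disc_closed v by blast
    moreover have "closedin S ?R" using disc_closed finite_V finite_E by (intro closedin_Union) auto
    moreover have "topspace S \<subseteq> v \<union> ?R" using topspace_S by blast
    moreover have "v \<inter> ?R \<inter> topspace S = {}" using V_disjoint[OF v] empty by blast
    moreover have "connectedin S (topspace S)" using connected by (simp add: connectedin_topspace)
    ultimately have "v \<inter> topspace S = {} \<or> ?R \<inter> topspace S = {}"
      unfolding connectedin_closedin by metis
    moreover have "v \<noteq> {}" "v \<subseteq> topspace S" using disc_nonempty disc_subset v by blast+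
    moreover obtain e where "e \<in> E" using E_nonempty by blast
    then have "e \<noteq> {}" "e \<subseteq> topspace S" "e \<subseteq> ?R" using disc_nonempty[of e] disc_subset[of e] by blast+
    ultimately show False by blast
  qed
  then obtain x e where x: "x \<in> v" "e \<in> E" "x \<in> e" by blast
  then have "x \<in> \<Union>segs" using v Union_segs by blast
  then obtain s where "s \<in> segs" "x \<in> s" by blast
  then have "s \<in> segs_in v" using seg_in_disc[of s v x] v x by blast
  then show "v \<in> nonisolated" using v by (auto simp: nonisolated_def)
qed

lemma disc_flag: "D \<in> V \<union> E \<Longrightarrow> \<exists>p\<in>P. p \<in> D"
proof -
  assume "D \<in> V \<union> E"
  then have "D \<in> nonisolated" using vertex_nonisolated edge_nonisolated by blast
  then obtain s where "s \<in> segs" "s \<subseteq> D" by (auto simp: nonisolated_def segs_in_def)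
  then show ?thesis using seg_flag by blast
qed

lemma P_nonempty: "P \<noteq> {}"
  using E_nonempty disc_flag by blast

text \<open>A colouring of the flags that respects all three pairings is constant on each edge and, around its
  boundary circle, on each vertex; so it colours the discs of a connected surface.\<close>

lemma flags_connected:
  assumes F: "F \<subseteq> P" "\<And>p. p \<in> F \<Longrightarrow> kappa p \<in> F \<and> sigma p \<in> F \<and> eps p \<in> F"
  shows "F = {} \<or> F = P"
proof -
  let ?g = "\<lambda>D. D \<inter> F \<noteq> {}"
  have all: "q \<in> F" if "D \<in> V \<union> E" "?g D" "q \<in> P" "q \<in> D" for D q
  proof -
    obtain p where "p \<in> F" "p \<in> D" using \<open>?g D\<close> by blast
    then show ?thesis using flags_of_disc[OF \<open>D \<in> V \<union> E\<close> F] that by blast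
  qed
  have consistent: "\<forall>A\<in>V \<union> E. \<forall>B\<in>V \<union> E. A \<inter> B \<noteq> {} \<longrightarrow> ?g A = ?g B"
  proof (intro ballI impI)
    fix A B assume AB: "A \<in> V \<union> E" "B \<in> V \<union> E" "A \<inter> B \<noteq> {}"
    show "?g A = ?g B"
    proof (cases "A = B")
      case False
      obtain x where x: "x \<in> A" "x \<in> B" using AB(3) by blast
      then have "x \<in> \<Union>V \<inter> \<Union>E" using AB(1,2) False V_disjoint[of A B x] E_disjoint[of A B x] by blast
      then obtain s where s: "s \<in> segs" "x \<in> s" using Union_segs by blast
      then have "s \<subseteq> A" "s \<subseteq> B" using seg_in_disc[OF s(1) _ s(2)] AB(1,2) x unfolding segs_in_def by blast+
      moreover obtain p where "p \<in> s" "p \<in> P" using seg_flag[OF s(1)] by blast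
      ultimately have "p \<in> A" "p \<in> B" "p \<in> P" by blast+
      then show ?thesis using all[OF AB(1), of p] all[OF AB(2), of p] by blast
    qed simp
  qed
  have "connectedin S (\<Union>(V \<union> E))"
  proof -
    have "connectedin S (topspace S)" using connected by (simp add: connectedin_topspace)
    then show ?thesis by (simp add: topspace_S)
  qed
  moreover have "finite (V \<union> E)" using finite_V finite_E by simp
  moreover have "closedin S A \<and> connectedin S A \<and> A \<noteq> {}" if "A \<in> V \<union> E" for A
    using disc_closed[OF that] disc_connected[OF that] disc_nonempty[OF that] by blast
  ultimately have "\<forall>g :: 'a set \<Rightarrow> bool. (\<forall>A\<in>V \<union> E. \<forall>B\<in>V \<union> E. A \<inter> B \<noteq> {} \<longrightarrow> g A = g B) \<longrightarrow>
      (\<forall>A\<in>V \<union> E. \<forall>B\<in>V \<union> E. g A = g B)"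
    using connectedin_Union_iff[of "V \<union> E" S] by (simp only: simp_thms)
  from this[THEN spec, THEN mp, OF consistent]
  have const: "\<forall>A\<in>V \<union> E. \<forall>B\<in>V \<union> E. ?g A = ?g B" .
  show ?thesis
  proof (cases "F = {}")
    case False
    then obtain p where p: "p \<in> F" by blast
    then have pE: "ed p \<in> V \<union> E" "?g (ed p)" using ed F(1) by blast+
    have "P \<subseteq> F"
    proof
      fix q assume q: "q \<in> P"
      then have "ed q \<in> V \<union> E" "q \<in> ed q" using ed by blast+
      then show "q \<in> F" using all[of "ed q" q] const pE q by blast
    qed
    then show ?thesis using F(1) by blast
  qed simp
qed

text \<open>The boundary of a spanning ribbon subgraph consists of the corners, the segments of the
  missing edges and the sides of the present ones. It is connected iff the flags are connected under
  the corresponding pairings; then the subgraph is connected as well.\<close>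

lemma quasi_tree_iff:
  assumes X: "X \<subseteq> E"
  shows "quasi_tree (spanning_ribbon_subgraph G X) \<longleftrightarrow>
    (\<forall>F \<subseteq> P. (\<forall>p\<in>F. kappa p \<in> F \<and> (if ed p \<in> X then eps p \<in> F else sigma p \<in> F)) \<longrightarrow> F = {} \<or> F = P)"
    (is "_ \<longleftrightarrow> ?R")
proof -
  let ?H = "spanning_ribbon_subgraph G X"
  have sel: "surface ?H = subtopology S (spanned X)"
    by (simp add: spanning_ribbon_subgraph_def spanned_def)
  note B = surface_boundary_spanned[OF X vertex_nonisolated]
  have PB: "P \<inter> \<Union>(boundary_pieces X) = P" using flags_in_corner_arcs unfolding boundary_pieces_def by blast
  have BM: "\<Union>(boundary_pieces X) \<subseteq> spanned X" unfolding B[symmetric] by (auto simp: surface_boundary_def)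
  have BS: "\<Union>(boundary_pieces X) \<subseteq> topspace S" using BM spanned_subset[OF X] by blast
  have conn: "connectedin S (\<Union>(boundary_pieces X)) \<longleftrightarrow> ?R"
    unfolding connected_pieces_iff[OF boundary_pieces_subset[OF X]] PB
    using boundary_pieces_closed_iff[OF X] by (metis (no_types, lifting))
  have "boundary_components (surface ?H) = connected_components_of (subtopology S (\<Union>(boundary_pieces X)))"
    unfolding boundary_components_def sel B using BM by (simp add: subtopology_subtopology Int_absorb1)
  moreover have "topspace (subtopology S (\<Union>(boundary_pieces X))) \<noteq> {}"
    using P_nonempty PB BS by auto
  ultimately have "card (boundary_components (surface ?H)) = 1 \<longleftrightarrow> connected_space (subtopology S (\<Union>(boundary_pieces X)))"
    using card_connected_components_eq_1_iff by metis
  then have card: "card (boundary_components (surface ?H)) = 1 \<longleftrightarrow> connectedin S (\<Union>(boundary_pieces X))"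
    using BS by (simp only: connectedin_def simp_thms)
  have "connected_space (subtopology S (spanned X))" if R: ?R
  proof -
    have VX: "V \<union> X \<subseteq> V \<union> E" using X by blast
    have "connectedin S (\<Union>(V \<union> X)) \<longleftrightarrow>
      (\<forall>g :: 'a set \<Rightarrow> bool. (\<forall>A\<in>V \<union> X. \<forall>B\<in>V \<union> X. A \<inter> B \<noteq> {} \<longrightarrow> g A = g B) \<longrightarrow> (\<forall>A\<in>V \<union> X. \<forall>B\<in>V \<union> X. g A = g B))"
    proof (rule connectedin_Union_iff)
      show "finite (V \<union> X)" using finite_V finite_E X finite_subset by blast
      show "closedin S A \<and> connectedin S A \<and> A \<noteq> {}" if "A \<in> V \<union> X" for A
        using disc_closed disc_connected disc_nonempty that VX by blast
    qed
    moreover have "\<forall>A\<in>V \<union> X. \<forall>B\<in>V \<union> X. g A = g B"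
      if g: "\<forall>A\<in>V \<union> X. \<forall>B\<in>V \<union> X. A \<inter> B \<noteq> {} \<longrightarrow> g A = g B" for g :: "'a set \<Rightarrow> bool"
    proof -
      define F where "F = {p \<in> P. g (vt p)}"
      have ge: "g (ed p) = g (vt p)" if "p \<in> P" "ed p \<in> X" for p
      proof -
        have "ed p \<inter> vt p \<noteq> {}" "vt p \<in> V" using ed[OF that(1)] vt[OF that(1)] by blast+
        then show ?thesis using g[rule_format, of "ed p" "vt p"] that(2) by blast
      qed
      have "kappa p \<in> F \<and> (if ed p \<in> X then eps p \<in> F else sigma p \<in> F)" if "p \<in> F" for p
      proof -
        have p: "p \<in> P" "g (vt p)" using that by (simp_all add: F_def)
        have "eps p \<in> F" if eX: "ed p \<in> X"
          using ge[OF p(1) eX] ge[of "eps p"] eps[OF p(1)] eX p(2) by (simp add: F_def)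
        then show ?thesis using kappa[OF p(1)] sigma[OF p(1)] p(2) by (simp add: F_def)
      qed
      moreover have "F \<subseteq> P" by (auto simp: F_def)
      ultimately have or: "F = {} \<or> F = P" using R by blast
      have "g D \<longleftrightarrow> F \<noteq> {}" if D: "D \<in> V \<union> X" for D
      proof -
        obtain p where p: "p \<in> P" "p \<in> D" using disc_flag D VX by blast
        have "g D = g (vt p)"
        proof (cases "D \<in> V")
          case True
          then show ?thesis using vt_eq[OF True p(2)] by simp
        next
          case False
          then have "D \<in> X" "ed p = D" using D ed_eq[of D p] p(2) X by blast+
          then show ?thesis using ge[OF p(1)] by simp
        qed
        also have "\<dots> \<longleftrightarrow> p \<in> F" using p(1) by (simp add: F_def)
        also have "\<dots> \<longleftrightarrow> F \<noteq> {}" using or p(1) by blast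
        finally show ?thesis .
      qed
      then show ?thesis by simp
    qed
    ultimately have "connectedin S (\<Union>(V \<union> X))" by blast
    moreover have "\<Union>(V \<union> X) = spanned X" by (simp add: spanned_def)
    ultimately show ?thesis by (simp add: connectedin_def)
  qed
  note connected_spanned = this
  have taut: "((A \<and> C) \<and> R) = R" if A "R \<Longrightarrow> C" for A C R :: bool using that by blast
  show ?thesis
    unfolding quasi_tree_def connected_ribbon_graph_def card conn unfolding sel
    by (rule taut[OF ribbon_graph_spanned[OF X] connected_spanned])
qed

lemma corners_eq: "corners G = \<Union>(disc_gaps ` V)"
proof -
  have eq: "bd v - \<Union>E = bd v - \<Union>segs" if "v \<in> V" for v
    using that Union_segs bd_subset[of v] by blast
  have "v \<inter> \<Union>E \<noteq> {}" if v: "v \<in> V" for v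
  proof -
    obtain p where "p \<in> P" "p \<in> v" using disc_flag v by blast
    then show ?thesis using flag_in_VE by blast
  qed
  then have "{v \<in> V. v \<inter> \<Union>E \<noteq> {}} = V" by blast
  then show ?thesis unfolding corners_def disc_gaps_def using eq by simp
qed

lemma corner_arcs_eq: "corner_arcs = (\<lambda>c. S closure_of c) ` corners G"
proof -
  have "V \<inter> nonisolated = V" using vertex_nonisolated by blast
  then show ?thesis unfolding corner_arcs_def corners_eq arcs_of_def by blast
qed

lemma corner_arcs_flag:
  assumes "A \<in> corner_arcs"
  shows "\<exists>p. p \<in> P \<and> p \<in> A"
proof -
  obtain p q where "A \<inter> P = {p, q}" using pairing_corner_arcs assms unfolding pairing_def by metis
  then show ?thesis by blast
qed

text \<open>A corner itself avoids all edges, so its closure meets an edge only in one of its two flags.\<close>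

lemma medial_ends:
  assumes c: "c \<in> corners G" and p: "p \<in> P" "p \<in> S closure_of c"
  shows "mends (medial_graph G) c = {ed p, ed (kappa p)}"
proof -
  obtain v where v: "v \<in> V" "c \<in> disc_gaps v" using c corners_eq by blast
  have D: "v \<in> V \<union> E" "segs_in v \<noteq> {}" using v vertex_nonisolated by (auto simp: nonisolated_def)
  have "S closure_of c \<in> corner_arcs" using c corner_arcs_eq by blast
  then have cl: "S closure_of c \<inter> P = {p, kappa p}"
    using pairing_mate(1)[OF pairing_corner_arcs _ p(2,1)] by (simp add: kappa_def)
  have "e \<in> E \<and> S closure_of c \<inter> e \<noteq> {} \<longleftrightarrow> e = ed p \<or> e = ed (kappa p)" for e
  proof
    assume e: "e \<in> E \<and> S closure_of c \<inter> e \<noteq> {}"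
    then obtain z where z: "z \<in> S closure_of c" "z \<in> e" by blast
    have "z \<in> P"
    proof (rule ccontr)
      assume "z \<notin> P"
      have "v \<in> nonisolated" using v vertex_nonisolated by blast
      from arc_minus_P[OF this v(2) z(1) \<open>z \<notin> P\<close>] show False
        using e z(2) v(1) Union_segs by blast
    qed
    then have "z = p \<or> z = kappa p" using cl z(1) by blast
    then show "e = ed p \<or> e = ed (kappa p)" using ed_eq[of e z] e z(2) by blast
  next
    have mem: "p \<in> S closure_of c" "kappa p \<in> S closure_of c" "kappa p \<in> P" using cl by blast+
    assume "e = ed p \<or> e = ed (kappa p)"
    then show "e \<in> E \<and> S closure_of c \<inter> e \<noteq> {}" using ed[OF p(1)] ed[OF mem(3)] mem(1,2) by blast
  qed
  then show ?thesis unfolding medial_graph_def multigraph.select_convs by blast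
qed

lemma bipartite_medial_iff:
  "bipartite (medial_graph G) \<longleftrightarrow> (\<exists>A. \<forall>p\<in>P. ed (kappa p) \<in> A \<longleftrightarrow> ed p \<notin> A)"
proof
  assume "bipartite (medial_graph G)"
  then obtain A B where AB: "A \<inter> B = {}"
    "\<And>c. c \<in> corners G \<Longrightarrow> \<exists>a\<in>A. \<exists>b\<in>B. mends (medial_graph G) c = {a, b}"
    unfolding bipartite_def by (auto simp: medial_graph_def)
  have "ed (kappa p) \<in> A \<longleftrightarrow> ed p \<notin> A" if p: "p \<in> P" for p
  proof -
    obtain c where c: "c \<in> corners G" "p \<in> S closure_of c"
      using mate_in_piece[OF pairing_corner_arcs p] corner_arcs_eq by (metis imageE)
    obtain a b where ab: "a \<in> A" "b \<in> B" "{ed p, ed (kappa p)} = {a, b}"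
      using AB(2)[OF c(1)] medial_ends[OF c(1) p c(2)] by metis
    have "b \<notin> A" "a \<noteq> b" using ab(1,2) AB(1) by blast+
    then show ?thesis using ab(1,3) by (metis doubleton_eq_iff)
  qed
  then show "\<exists>A. \<forall>p\<in>P. ed (kappa p) \<in> A \<longleftrightarrow> ed p \<notin> A" by blast
next
  assume "\<exists>A. \<forall>p\<in>P. ed (kappa p) \<in> A \<longleftrightarrow> ed p \<notin> A"
  then obtain A where A: "\<And>p. p \<in> P \<Longrightarrow> ed (kappa p) \<in> A \<longleftrightarrow> ed p \<notin> A" by blast
  have "\<exists>a\<in>A \<inter> E. \<exists>b\<in>E - A. mends (medial_graph G) c = {a, b}" if c: "c \<in> corners G" for c
  proof -
    have "S closure_of c \<in> corner_arcs" using c corner_arcs_eq by blast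
    then obtain p where p: "p \<in> P" "p \<in> S closure_of c"
      using corner_arcs_flag by blast
    have e: "ed p \<in> E" "ed (kappa p) \<in> E" using ed p(1) kappa[OF p(1)] by blast+
    have m: "mends (medial_graph G) c = {ed p, ed (kappa p)}" using medial_ends[OF c p] .
    show ?thesis
    proof (cases "ed p \<in> A")
      case True
      then show ?thesis using A[OF p(1)] e m by blast
    next
      case False
      then have "ed (kappa p) \<in> A \<inter> E" "ed p \<in> E - A" using A[OF p(1)] e by blast+
      moreover have "mends (medial_graph G) c = {ed (kappa p), ed p}" using m by (simp add: insert_commute)
      ultimately show ?thesis by blast
    qed
  qed
  then show "bipartite (medial_graph G)"
    unfolding bipartite_def
    by (intro exI[of _ "A \<inter> E"] exI[of _ "E - A"]) (auto simp: medial_graph_def)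
qed

end



section \<open>Tight 3-matroids on \<open>E \<times> {1, 2, 3}\<close>\<close>

definition choice_set :: "'e set \<Rightarrow> ('e \<Rightarrow> nat) \<Rightarrow> ('e \<times> nat) set" where
  "choice_set E t = (\<lambda>e. (e, t e)) ` E"

definition on_Z3_carrier :: "'e set \<Rightarrow> ('e \<times> nat) multimatroid \<Rightarrow> bool" where
  "on_Z3_carrier E Z \<longleftrightarrow> carrier_set Z = Z3_carrier E \<and> skew_classes Z = Z3_skew_classes E"

lemma mem_choice_set [simp]: "(e, i) \<in> choice_set E t \<longleftrightarrow> e \<in> E \<and> i = t e"
  by (auto simp: choice_set_def)

lemma subtransversal_Z3_iff:
  assumes "on_Z3_carrier E Z"
  shows "subtransversal Z S \<longleftrightarrow> S \<subseteq> E \<times> {1, 2, 3} \<and> single_valued S"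
proof
  assume S: "subtransversal Z S"
  then have sub: "S \<subseteq> E \<times> {1, 2, 3}"
    using assms by (simp add: subtransversal_def on_Z3_carrier_def Z3_carrier_def)
  have "single_valued S"
  proof (rule single_valuedI)
    fix e i j assume ij: "(e, i) \<in> S" "(e, j) \<in> S"
    let ?w = "{(e, 1), (e, 2), (e, 3)} :: ('a \<times> nat) set"
    have "e \<in> E" using ij sub by auto
    then have "?w \<in> skew_classes Z"
      using assms by (auto simp: on_Z3_carrier_def Z3_skew_classes_def)
    then have "card (S \<inter> ?w) \<le> Suc 0" using S by (simp add: subtransversal_def One_nat_def)
    moreover have "(e, i) \<in> S \<inter> ?w" "(e, j) \<in> S \<inter> ?w" using ij sub by auto
    ultimately show "i = j"
      by (metis (no_types, lifting) Pair_inject card_le_Suc0_iff_eq finite_Int finite.emptyI finite_insert)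
  qed
  with sub show "S \<subseteq> E \<times> {1, 2, 3} \<and> single_valued S" by blast
next
  assume S: "S \<subseteq> E \<times> {1, 2, 3} \<and> single_valued S"
  have "card (S \<inter> w) \<le> 1" if "w \<in> skew_classes Z" for w
  proof -
    obtain e where w: "w = {(e, 1), (e, 2), (e, 3)}"
      using assms \<open>w \<in> skew_classes Z\<close> by (auto simp: on_Z3_carrier_def Z3_skew_classes_def)
    have "\<forall>x \<in> S \<inter> w. \<forall>y \<in> S \<inter> w. x = y"
    proof (intro ballI)
      fix x y assume "x \<in> S \<inter> w" "y \<in> S \<inter> w"
      then have "fst x = fst y" "(fst x, snd x) \<in> S" "(fst y, snd y) \<in> S" using w by auto
      then show "x = y" using S by (metis prod.collapse single_valuedD)
    qed
    moreover have "finite (S \<inter> w)" using w by simp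
    ultimately show ?thesis
      by (metis One_nat_def card_le_Suc0_iff_eq)
  qed
  then show "subtransversal Z S"
    using S assms by (simp add: subtransversal_def on_Z3_carrier_def Z3_carrier_def)
qed

lemma transversal_Z3_iff:
  assumes "on_Z3_carrier E Z"
  shows "transversal Z T \<longleftrightarrow> (\<exists>t. (\<forall>e\<in>E. t e \<in> {1, 2, 3}) \<and> T = choice_set E t)"
proof
  assume T: "transversal Z T"
  have card1: "card (T \<inter> {(e, 1), (e, 2), (e, 3)}) = 1" if "e \<in> E" for e
    using T assms that by (auto simp: transversal_def on_Z3_carrier_def Z3_skew_classes_def)
  have sub: "T \<subseteq> E \<times> {1, 2, 3}"
    using T assms by (simp add: transversal_def on_Z3_carrier_def Z3_carrier_def)
  have "\<exists>i. i \<in> {1,2,3} \<and> (\<forall>j. (e, j) \<in> T \<longleftrightarrow> j = i)" if e: "e \<in> E" for e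
  proof -
    obtain x where x: "T \<inter> {(e, 1), (e, 2), (e, 3)} = {x}"
      using card1[OF e] by (meson card_1_singletonE)
    then have "x \<in> T" "x = (e, 1) \<or> x = (e, 2) \<or> x = (e, 3)" by blast+
    then obtain i where i: "x = (e, i)" "i \<in> {1,2,3}" "(e, i) \<in> T" by (cases x) auto
    have "j = i" if "(e, j) \<in> T" for j
    proof -
      have "(e, j) \<in> T \<inter> {(e, 1), (e, 2), (e, 3)}" using that sub by auto
      then show ?thesis using x i by simp
    qed
    then show ?thesis using i by blast
  qed
  then obtain t where t: "\<And>e. e \<in> E \<Longrightarrow> t e \<in> {1,2,3} \<and> (\<forall>j. (e, j) \<in> T \<longleftrightarrow> j = t e)"
    by metis
  have "T = choice_set E t"
    using sub t by (auto simp: choice_set_def)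
  then show "\<exists>t. (\<forall>e\<in>E. t e \<in> {1, 2, 3}) \<and> T = choice_set E t" 
    using t by (intro exI[of _ t]) simp
next
  assume "\<exists>t. (\<forall>e\<in>E. t e \<in> {1, 2, 3}) \<and> T = choice_set E t"
  then obtain t where t: "\<And>e. e \<in> E \<Longrightarrow> t e \<in> {1,2,3}" and T: "T = choice_set E t" by auto
  have "T \<inter> {(e, 1), (e, 2), (e, 3)} = {(e, t e)}" if "e \<in> E" for e
    using t[OF that] that by (auto simp: T)
  then have "\<forall>\<omega>\<in>Z3_skew_classes E. card (T \<inter> \<omega>) = 1"
    by (auto simp: Z3_skew_classes_def)
  moreover have "T \<subseteq> E \<times> {1,2,3}" using t by (force simp: T choice_set_def)
  ultimately show "transversal Z T"
    using assms by (simp add: transversal_def on_Z3_carrier_def Z3_carrier_def)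
qed

lemma single_valued_extends:
  assumes "S \<subseteq> E \<times> {1, 2, 3 :: nat}" "single_valued S"
  obtains t where "\<forall>e\<in>E. t e \<in> {1, 2, 3}" "S \<subseteq> choice_set E t"
proof
  define t where "t e = (if \<exists>i. (e, i) \<in> S then THE i. (e, i) \<in> S else 1)" for e
  have val: "t e = i" if "(e, i) \<in> S" for e i
    using that assms(2) by (auto simp: t_def single_valued_def)
  show "\<forall>e\<in>E. t e \<in> {1, 2, 3}"
  proof
    fix e assume "e \<in> E"
    show "t e \<in> {1, 2, 3}"
    proof (cases "\<exists>i. (e, i) \<in> S")
      case True then show ?thesis using val assms(1) by fastforce
    qed (simp add: t_def)
  qed
  show "S \<subseteq> choice_set E t" using assms(1) val by auto
qed

lemma finite_choice_set: "finite E \<Longrightarrow> finite (choice_set E t)"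
  by (simp add: choice_set_def)

lemma single_valued_superset_of_choice_set:
  assumes "choice_set E t \<subseteq> S" "S \<subseteq> E \<times> A" "single_valued S"
  shows "S = choice_set E t"
proof
  show "S \<subseteq> choice_set E t"
  proof (rule subsetI, clarify)
    fix e i assume "(e, i) \<in> S"
    then show "(e, i) \<in> choice_set E t"
      using assms by (metis (no_types, lifting) mem_Sigma_iff mem_choice_set single_valuedD subsetD)
  qed
qed (fact assms(1))

locale Z3_multimatroid =
  fixes E :: "'e set" and Z :: "('e \<times> nat) multimatroid"
  assumes finite_ground: "finite E"
    and carrier: "on_Z3_carrier E Z"
    and multimatroid: "multimatroid Z"
begin

lemma indep_single_valued: "I \<in> indeps Z \<Longrightarrow> I \<subseteq> E \<times> {1, 2, 3} \<and> single_valued I"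
  using multimatroid subtransversal_Z3_iff[OF carrier] by (simp add: multimatroid_def)

lemma indep_subset:
  assumes "J \<in> indeps Z" "I \<subseteq> J"
  shows "I \<in> indeps Z"
proof -
  obtain t where "\<forall>e\<in>E. t e \<in> {1, 2, 3}" "J \<subseteq> choice_set E t"
    using indep_single_valued[OF assms(1)] single_valued_extends by metis
  then have t: "(\<forall>e\<in>E. t e \<in> {1, 2, 3})" "J \<subseteq> choice_set E t" by simp_all
  have "transversal Z (choice_set E t)"
    using transversal_Z3_iff[OF carrier, of "choice_set E t"] t(1) by (simp only:) (rule exI[of _ t], simp)
  then have "matroid (choice_set E t) (indeps Z \<inter> Pow (choice_set E t))"
    using multimatroid by (simp add: multimatroid_def)
  moreover have "J \<in> indeps Z \<inter> Pow (choice_set E t)" using t(2) assms(1) by simp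
  ultimately have "I \<in> indeps Z \<inter> Pow (choice_set E t)"
    using assms(2) unfolding matroid_def by meson
  then show ?thesis by simp
qed

lemma basis_choice_set_iff: "basis Z (choice_set E t) \<longleftrightarrow> choice_set E t \<in> indeps Z"
proof
  assume "choice_set E t \<in> indeps Z"
  then show "basis Z (choice_set E t)"
    unfolding basis_def using indep_single_valued single_valued_superset_of_choice_set by metis
qed (simp add: basis_def)

lemma delete_T3_basis_iff:
  assumes "\<forall>e\<in>E. t e \<in> {1, 2}"
  shows "basis (delete Z (E \<times> {3})) (choice_set E t) \<longleftrightarrow> choice_set E t \<in> indeps Z"
proof -
  have "choice_set E t \<subseteq> carrier_set Z - E \<times> {3}"
    using carrier assms by (auto simp: on_Z3_carrier_def Z3_carrier_def)
  moreover have "Y = choice_set E t" if "Y \<in> indeps Z" "choice_set E t \<subseteq> Y" for Y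
    using indep_single_valued[OF that(1)] single_valued_superset_of_choice_set[OF that(2)] by blast
  ultimately show ?thesis
    by (auto simp: basis_def delete_def)
qed

lemma indep_extend_class:
  assumes "I \<in> indeps Z" "e \<in> E" "\<And>i. (e, i) \<notin> I" "i \<in> {1,2,3}" "j \<in> {1,2,3}" "i \<noteq> j"
  shows "insert (e, i) I \<in> indeps Z \<or> insert (e, j) I \<in> indeps Z"
proof -
  let ?w = "{(e, 1), (e, 2), (e, 3)} :: ('e \<times> nat) set"
  have "?w \<in> skew_classes Z" "?w \<inter> I = {}" "(e, i) \<in> ?w" "(e, j) \<in> ?w" "(e, i) \<noteq> (e, j)"
    using carrier assms by (auto simp: on_Z3_carrier_def Z3_skew_classes_def)
  moreover have "\<forall>I \<in> indeps Z. \<forall>\<omega> \<in> skew_classes Z. \<forall>x \<in> \<omega>. \<forall>y \<in> \<omega>.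
        x \<noteq> y \<and> \<omega> \<inter> I = {} \<longrightarrow> insert x I \<in> indeps Z \<or> insert y I \<in> indeps Z"
    using multimatroid by (simp add: multimatroid_def)
  ultimately show ?thesis using assms(1) by metis
qed

text \<open>A largest independent superset meets every class, for otherwise it could be extended in a class of more
  than one element.\<close>

lemma indep_extends_to_choice_set:
  assumes "I \<in> indeps Z"
  obtains t where "\<forall>e\<in>E. t e \<in> {1, 2, 3}" "I \<subseteq> choice_set E t" "choice_set E t \<in> indeps Z"
proof -
  define Q where "Q J \<longleftrightarrow> J \<in> indeps Z \<and> I \<subseteq> J" for J
  have bound: "card J \<le> card (E \<times> {1,2,3::nat})" if "Q J" for J
    using that indep_single_valued finite_ground unfolding Q_def by (intro card_mono) auto
  have "Q I" using assms by (simp add: Q_def)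
  then obtain J where J: "Q J" and max: "\<And>K. Q K \<Longrightarrow> card K \<le> card J"
    using ex_has_greatest_nat[of Q I card "Suc (card (E \<times> {1,2,3::nat}))"] bound by (auto simp: less_Suc_eq_le)
  have JI: "J \<in> indeps Z" "I \<subseteq> J" using J by (auto simp: Q_def)
  have finJ: "finite J" 
    using indep_single_valued[OF JI(1)] finite_ground by (meson finite.emptyI finite_SigmaI finite_insert finite_subset)
  obtain t where t: "\<forall>e\<in>E. t e \<in> {1, 2, 3}" "J \<subseteq> choice_set E t"
    using indep_single_valued[OF JI(1)] single_valued_extends by metis
  have "\<exists>i. (e, i) \<in> J" if e: "e \<in> E" for e
  proof (rule ccontr)
    assume no: "\<nexists>i. (e, i) \<in> J"
    then obtain i where "insert (e, i) J \<in> indeps Z"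
      using indep_extend_class[OF JI(1) e, of 1 2] by auto
    then have "Q (insert (e, i) J)" using JI by (auto simp: Q_def)
    then have "card (insert (e, i) J) \<le> card J" by (rule max)
    then show False using no finJ by auto
  qed
  then have "choice_set E t \<subseteq> J" using t(2) by (fastforce simp: choice_set_def)
  then have "J = choice_set E t" using t(2) by blast
  then show thesis using that t JI by blast
qed

lemma none_or_two_of_three:
  assumes "\<And>i. i \<in> {1,2,3::nat} \<Longrightarrow> b i \<Longrightarrow> \<exists>!u. u \<in> {1,2,3} \<and> \<not> b u"
  shows "b 3 \<longleftrightarrow> (b 1 \<longleftrightarrow> \<not> b 2)"
proof -
  have ex: "\<exists>u. u \<in> {1,2,3} \<and> \<not> b u" if "i \<in> {1,2,3}" "b i" for i
    using assms[OF that] by (rule ex1_implies_ex)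
  have uniq: "u = v" if "i \<in> {1,2,3}" "b i" "u \<in> {1,2,3}" "\<not> b u" "v \<in> {1,2,3}" "\<not> b v" for i u v
    using assms[OF that(1,2)] that(3-) by (elim ex1E) metis
  show ?thesis
    using ex[of 1] uniq[of 1 2 3] uniq[of 2 1 3] uniq[of 3 1 2] by auto
qed

text \<open>Tightness makes the number of bases among the three transversals that differ in one skew
  class either none or two, so any two of them determine the third.\<close>

lemma tight_third:
  assumes "tight_3_matroid Z" "e \<in> E" "\<forall>e\<in>E. t e \<in> {1, 2, 3}"
  shows "choice_set E (t(e := 3)) \<in> indeps Z \<longleftrightarrow>
    (choice_set E (t(e := 1)) \<in> indeps Z \<longleftrightarrow> choice_set E (t(e := 2)) \<notin> indeps Z)"
proof -
  let ?w = "{(e, 1), (e, 2), (e, 3)} :: ('e \<times> nat) set"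
  let ?b = "\<lambda>i. choice_set E (t(e := i)) \<in> indeps Z"
  have w: "?w \<in> skew_classes Z"
    using carrier assms(2) by (auto simp: on_Z3_carrier_def Z3_skew_classes_def)
  have ins: "insert (e, j) (choice_set E (t(e := i)) - ?w) = choice_set E (t(e := j))" 
    if "i \<in> {1,2,3}" for i j
    using that assms(2) by (auto simp: choice_set_def split: if_splits)
  have one: "\<exists>!u. u \<in> {1,2,3} \<and> \<not> ?b u" if i: "i \<in> {1,2,3}" "?b i" for i
  proof -
    let ?Q = "\<lambda>u. u \<in> ?w \<and> \<not> basis Z (insert u (choice_set E (t(e := i)) - ?w))"
    have "\<exists>!u. ?Q u"
    proof -
      have tight: "\<exists>!u. u \<in> \<omega> \<and> \<not> basis Z (insert u (X - \<omega>))"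
        if "basis Z X" "\<omega> \<in> skew_classes Z" for X \<omega>
        using assms(1) that by (simp add: tight_3_matroid_def)
      have "basis Z (choice_set E (t(e := i)))" using i basis_choice_set_iff by simp
      from tight[OF this w] show ?thesis .
    qed
    then obtain u where u: "u \<in> ?w" "\<not> basis Z (insert u (choice_set E (t(e := i)) - ?w))"
      and uniq: "\<And>v. v \<in> ?w \<Longrightarrow> \<not> basis Z (insert v (choice_set E (t(e := i)) - ?w)) \<Longrightarrow> v = u"
      using ex1E[of ?Q] by metis
    obtain j where j: "u = (e, j)" "j \<in> {1,2,3}" using u(1) by auto
    show ?thesis
    proof (rule ex1I[of _ j])
      show "j \<in> {1,2,3} \<and> \<not> ?b j" using u j ins[OF i(1), of j] basis_choice_set_iff by (simp del: fun_upd_apply)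
      fix k assume k: "k \<in> {1,2,3} \<and> \<not> ?b k"
      then have "(e, k) \<in> ?w" "\<not> basis Z (insert (e, k) (choice_set E (t(e := i)) - ?w))"
        using ins[OF i(1), of k] basis_choice_set_iff by (auto simp del: fun_upd_apply)
      then show "k = j" using uniq[of "(e, k)"] j by simp
    qed
  qed
  then show ?thesis by (rule none_or_two_of_three)
qed

end

lemma tight_Z3_multimatroid:
  "finite E \<Longrightarrow> on_Z3_carrier E Z \<Longrightarrow> tight_3_matroid Z \<Longrightarrow> Z3_multimatroid E Z"
  by (simp add: Z3_multimatroid_def tight_3_matroid_def)

lemma split_as_choice_set:
  assumes "X \<subseteq> E"
  shows "(E - X) \<times> {1} \<union> X \<times> {2} = choice_set E (\<lambda>e. if e \<in> X then 2 else 1)"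
  using assms by (auto simp: choice_set_def)

text \<open>Both multimatroids have the same bases: by induction on the number of classes in which a transversal
  chooses index 3, since replacing such a choice by 1 and by 2 determines its status. The independent
  sets are the subsets of bases.\<close>

lemma tight_3_matroid_unique:
  assumes fin: "finite E"
    and Z: "on_Z3_carrier E Z" "tight_3_matroid Z"
    and Z': "on_Z3_carrier E Z'" "tight_3_matroid Z'"
    and eq: "induced_system E Z = induced_system E Z'"
  shows "Z = Z'"
proof -
  interpret A: Z3_multimatroid E Z using fin Z by (rule tight_Z3_multimatroid)
  interpret B: Z3_multimatroid E Z' using fin Z' by (rule tight_Z3_multimatroid)
  have bases: "choice_set E t \<in> indeps Z \<longleftrightarrow> choice_set E t \<in> indeps Z'"
    if "\<forall>e\<in>E. t e \<in> {1,2,3}" for t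
    using that
  proof (induction "card {e\<in>E. t e = 3}" arbitrary: t)
    case 0
    then have t: "\<forall>e\<in>E. t e \<in> {1,2}" using fin by auto
    define X where "X = {e\<in>E. t e = 2}"
    have X: "X \<subseteq> E" and cs: "choice_set E t = (E - X) \<times> {1} \<union> X \<times> {2}"
      using t split_as_choice_set[of X E] by (auto simp: X_def choice_set_def)
    have "X \<in> snd (induced_system E Z) \<longleftrightarrow> X \<in> snd (induced_system E Z')" using eq by simp
    then show ?case
      using A.delete_T3_basis_iff[OF t] B.delete_T3_basis_iff[OF t] X cs by (simp add: induced_system_def)
  next
    case (Suc n)
    have "{e\<in>E. t e = 3} \<noteq> {}" using Suc.hyps(2) by fastforce
    then obtain e where e: "e \<in> E" "t e = 3" by blast
    have less: "{x\<in>E. (t(e := i)) x = 3} = {e\<in>E. t e = 3} - {e}" if "i \<in> {1,2}" for i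
      using that by auto
    have n: "n = card {x\<in>E. (t(e := i)) x = 3}" if "i \<in> {1,2}" for i
      unfolding less[OF that] using Suc.hyps(2) e fin by simp
    have IH: "choice_set E (t(e := i)) \<in> indeps Z \<longleftrightarrow> choice_set E (t(e := i)) \<in> indeps Z'"
      if "i \<in> {1,2}" for i
    proof (rule Suc.hyps(1)[OF n[OF that]])
      show "\<forall>x\<in>E. (t(e := i)) x \<in> {1, 2, 3}" using Suc.prems that by auto
    qed
    have "t(e := 3) = t" using e by auto
    then show ?case
      using A.tight_third[OF Z(2) e(1) Suc.prems] B.tight_third[OF Z'(2) e(1) Suc.prems] IH by auto
  qed
  have "indeps Z = indeps Z'"
  proof (rule set_eqI, rule iffI)
    fix I assume "I \<in> indeps Z"
    then show "I \<in> indeps Z'"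
      by (metis A.indep_extends_to_choice_set bases B.indep_subset)
  next
    fix I assume "I \<in> indeps Z'"
    then show "I \<in> indeps Z"
      by (metis B.indep_extends_to_choice_set bases A.indep_subset)
  qed
  then show ?thesis using Z(1) Z'(1) by (simp add: on_Z3_carrier_def)
qed

lemma Z3_eqI:
  assumes "finite E" "on_Z3_carrier E Z" "tight_3_matroid Z" "induced_system E Z = D" "fst D = E"
  shows "Z3 D = Z"
  unfolding Z3_def
proof (rule the_equality)
  show "tight_3_matroid Z \<and> carrier_set Z = Z3_carrier (fst D) \<and>
    skew_classes Z = Z3_skew_classes (fst D) \<and> induced_system (fst D) Z = D"
    using assms by (simp add: on_Z3_carrier_def)
next
  fix Z' assume "tight_3_matroid Z' \<and> carrier_set Z' = Z3_carrier (fst D) \<and>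
    skew_classes Z' = Z3_skew_classes (fst D) \<and> induced_system (fst D) Z' = D"
  then show "Z' = Z"
    using assms tight_3_matroid_unique[of E Z' Z] by (simp add: on_Z3_carrier_def)
qed



section \<open>Involutions without fixed points\<close>

lemma card_involution_orbits:
  assumes "finite F" "\<And>p. p \<in> F \<Longrightarrow> f p \<in> F \<and> f p \<noteq> p \<and> f (f p) = p"
  shows "card F = 2 * card ((\<lambda>p. {p, f p}) ` F)"
proof -
  let ?O = "(\<lambda>p. {p, f p}) ` F"
  have "2 * card ?O = card (\<Union>?O)"
  proof (rule card_partition)
    show "finite ?O" "finite (\<Union>?O)" using assms by auto
    show "card c = 2" if "c \<in> ?O" for c using that assms(2) by fastforce
    show "c \<inter> d = {}" if cd: "c \<in> ?O" "d \<in> ?O" "c \<noteq> d" for c d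
    proof -
      obtain p q where pq: "c = {p, f p}" "d = {q, f q}" "p \<in> F" "q \<in> F" using cd(1,2) by auto
      have mem: "{r, f r} = {s, f s}" if "r \<in> {s, f s}" "s \<in> F" for r s
        using assms(2)[OF that(2)] that(1) by (elim insertE) auto
      show ?thesis
      proof (rule ccontr)
        assume "c \<inter> d \<noteq> {}"
        then obtain r where "r \<in> {p, f p}" "r \<in> {q, f q}" using pq by blast
        then have "{p, f p} = {q, f q}" using mem[of r p] mem[of r q] pq(3,4) by simp
        then show False using pq cd(3) by simp
      qed
    qed
  qed
  moreover have "\<Union>?O = F" using assms(2) by auto
  ultimately show ?thesis by simp
qed

lemma even_card_involution:
  assumes "finite F" "\<And>p. p \<in> F \<Longrightarrow> f p \<in> F \<and> f p \<noteq> p \<and> f (f p) = p"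
  shows "even (card F)"
  using card_involution_orbits[OF assms] by simp

lemma card_sym_diff:
  assumes "finite A" "finite B"
  shows "card (sym_diff A B) + 2 * card (A \<inter> B) = card A + card B"
proof -
  have "card (sym_diff A B) = card (A - B) + card (B - A)"
    using assms by (intro card_Un_disjoint) auto
  moreover have "card A = card (A - B) + card (A \<inter> B)"
    using card_Int_Diff[OF assms(1), of B] by simp
  moreover have "card B = card (B - A) + card (A \<inter> B)"
    using card_Int_Diff[OF assms(2), of A] by (simp add: Int_commute)
  ultimately show ?thesis by simp
qed

section \<open>Medial graphs as structures of flags\<close>

text \<open>The points of \<open>P\<close> are half-edges, \<open>ed\<close> sends them to their medial vertex, \<open>\<kappa>\<close> swaps the two halves of a
  medial edge, and \<open>\<sigma>\<close>, \<open>\<epsilon>\<close> and their composite are the three transitions.\<close>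

locale medial_flags =
  fixes P :: "'p set" and ed :: "'p \<Rightarrow> 'e" and \<kappa> \<sigma> \<epsilon> :: "'p \<Rightarrow> 'p"
  assumes finite_P: "finite P"
    and P_ne: "P \<noteq> {}"
    and kappa: "p \<in> P \<Longrightarrow> \<kappa> p \<in> P \<and> \<kappa> p \<noteq> p \<and> \<kappa> (\<kappa> p) = p"
    and sigma: "p \<in> P \<Longrightarrow> \<sigma> p \<in> P \<and> \<sigma> p \<noteq> p \<and> \<sigma> (\<sigma> p) = p \<and> ed (\<sigma> p) = ed p"
    and eps: "p \<in> P \<Longrightarrow> \<epsilon> p \<in> P \<and> \<epsilon> p \<noteq> p \<and> \<epsilon> (\<epsilon> p) = p \<and> ed (\<epsilon> p) = ed p"
    and sigma_ne_eps: "p \<in> P \<Longrightarrow> \<sigma> p \<noteq> \<epsilon> p"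
    and sigma_eps_commute: "p \<in> P \<Longrightarrow> \<sigma> (\<epsilon> p) = \<epsilon> (\<sigma> p)"
    and fibre_subset: "p \<in> P \<Longrightarrow> q \<in> P \<Longrightarrow> ed q = ed p \<Longrightarrow> q \<in> {p, \<sigma> p, \<epsilon> p, \<sigma> (\<epsilon> p)}"
    and connected: "F \<subseteq> P \<Longrightarrow> (\<And>p. p \<in> F \<Longrightarrow> \<kappa> p \<in> F \<and> \<sigma> p \<in> F \<and> \<epsilon> p \<in> F) \<Longrightarrow> F = {} \<or> F = P"
begin

definition E :: "'e set" where "E = ed ` P"

definition fib :: "'e \<Rightarrow> 'p set" where "fib e = {p \<in> P. ed p = e}"

text \<open>The three ways to pair the four half-edges at a medial vertex; the third one is the pairing
  obtained from a half-twisted ribbon.\<close>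

definition tr :: "nat \<Rightarrow> 'p \<Rightarrow> 'p" where
  "tr i = (if i = 1 then \<sigma> else if i = 2 then \<epsilon> else \<sigma> \<circ> \<epsilon>)"

definition kclosed :: "'p set \<Rightarrow> bool" where
  "kclosed F \<longleftrightarrow> F \<subseteq> P \<and> (\<forall>p\<in>F. \<kappa> p \<in> F)"

text \<open>The members of the cycle space of the medial graph over the field with two elements.\<close>

definition cyc :: "'p set \<Rightarrow> bool" where
  "cyc F \<longleftrightarrow> kclosed F \<and> (\<forall>e\<in>E. even (card (F \<inter> fib e)))"

text \<open>The transition \<open>i\<close> at the medial vertex \<open>e\<close> is recorded when the cycle uses exactly one of its two pairs.
  Symmetric difference of cycles corresponds to addition of vectors over the Klein four-group.\<close>

definition vec :: "'p set \<Rightarrow> ('e \<times> nat) set" where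
  "vec F = {(e, i). i \<in> {1, 2, 3} \<and> (\<exists>p \<in> fib e. F \<inter> fib e = {p, tr i p})}"

definition Zcyc :: "('e \<times> nat) multimatroid" where
  "Zcyc = \<lparr>carrier_set = Z3_carrier E, skew_classes = Z3_skew_classes E,
     indeps = {I. I \<subseteq> E \<times> {1, 2, 3} \<and> single_valued I \<and>
       (\<forall>F. cyc F \<and> vec F \<subseteq> I \<longrightarrow> vec F = {})}\<rparr>"

lemma finite_E: "finite E" by (simp add: E_def finite_P)
lemma finite_fib: "finite (fib e)" by (simp add: fib_def finite_P)
lemma fib_subset: "fib e \<subseteq> P" by (auto simp: fib_def)
lemma fib_disjoint: "p \<in> fib e \<Longrightarrow> p \<in> fib e' \<Longrightarrow> e = e'" by (simp add: fib_def)
lemma fib_nonempty: "e \<in> E \<Longrightarrow> fib e \<noteq> {}" by (auto simp: fib_def E_def)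

lemma tr_fib:
  assumes "p \<in> fib e" "i \<in> {1, 2, 3}"
  shows "tr i p \<in> fib e" "tr i p \<noteq> p" "tr i (tr i p) = p"
proof -
  have p: "p \<in> P" "ed p = e" using assms by (auto simp: fib_def)
  note s = sigma[OF p(1)] and t = eps[OF p(1)]
  note st = sigma[of "\<epsilon> p"] and ts = eps[of "\<sigma> p"]
  have "\<sigma> (\<epsilon> p) \<noteq> p"
  proof
    assume "\<sigma> (\<epsilon> p) = p"
    then have "\<epsilon> p = \<sigma> p" using st t by auto
    then show False using sigma_ne_eps[OF p(1)] by simp
  qed
  moreover have "\<sigma> (\<epsilon> (\<sigma> (\<epsilon> p))) = p"
    using s t sigma_eps_commute[of "\<epsilon> p"] by simp
  ultimately show "tr i p \<in> fib e" "tr i p \<noteq> p" "tr i (tr i p) = p"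
    using assms(2) p s t st ts by (auto simp: tr_def fib_def)
qed

lemma tr_inj_index:
  assumes "p \<in> fib e" "i \<in> {1, 2, 3}" "j \<in> {1, 2, 3}" "tr i p = tr j p"
  shows "i = j"
proof -
  have p: "p \<in> P" "ed p = e" using assms by (auto simp: fib_def)
  note s = sigma[OF p(1)] and t = eps[OF p(1)]
  have "\<sigma> (\<epsilon> p) \<noteq> \<epsilon> p" using sigma[of "\<epsilon> p"] t by simp
  moreover have "\<sigma> (\<epsilon> p) \<noteq> \<sigma> p" using sigma_eps_commute[OF p(1)] eps[of "\<sigma> p"] s by simp
  ultimately show ?thesis
    using assms(2-4) sigma_ne_eps[OF p(1)] by (auto simp: tr_def)
qed

lemma tr_cases:
  assumes "p \<in> fib e" "q \<in> fib e" "p \<noteq> q"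
  obtains i where "i \<in> {1,2,3}" "q = tr i p"
proof -
  have "q \<in> {p, \<sigma> p, \<epsilon> p, \<sigma> (\<epsilon> p)}" using assms fibre_subset[of p q] by (simp add: fib_def)
  then have "q = tr 1 p \<or> q = tr 2 p \<or> q = tr 3 p" using assms(3) by (auto simp: tr_def)
  then show thesis using that by blast
qed

lemma fib_eq: "p \<in> fib e \<Longrightarrow> fib e = {p, tr 1 p, tr 2 p, tr 3 p}"
proof
  assume p: "p \<in> fib e"
  show "fib e \<subseteq> {p, tr 1 p, tr 2 p, tr 3 p}"
    using tr_cases[OF p] by blast
  show "{p, tr 1 p, tr 2 p, tr 3 p} \<subseteq> fib e" using tr_fib[OF p] p by simp
qed

lemma card_fib: "e \<in> E \<Longrightarrow> card (fib e) = 4"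
proof -
  assume "e \<in> E"
  then obtain p where p: "p \<in> fib e" using fib_nonempty by blast
  have "tr i p \<noteq> p" "tr i p \<noteq> tr j p" if "i \<in> {1,2,3}" "j \<in> {1,2,3}" "i \<noteq> j" for i j
    using tr_fib(2)[OF p that(1)] tr_inj_index[OF p that(1,2)] that(3) by blast+
  note ne = this[of 1 2] this[of 2 3] this[of 3 1]
  have "distinct [p, tr 1 p, tr 2 p, tr 3 p]"
    using ne by simp
  then have "card (set [p, tr 1 p, tr 2 p, tr 3 p]) = 4" by (subst distinct_card) simp_all
  then show ?thesis using fib_eq[OF p] by simp
qed

text \<open>An even subset of four half-edges is empty, full, or a pair, and any two half-edges are paired by
  exactly one transition.\<close>

lemma cyc_fib_cases [consumes 2, case_names empty full pair]:
  assumes "cyc F" "e \<in> E"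
  obtains "F \<inter> fib e = {}" | "F \<inter> fib e = fib e"
    | i p where "i \<in> {1,2,3}" "p \<in> fib e" "F \<inter> fib e = {p, tr i p}"
proof -
  have "even (card (F \<inter> fib e))" using assms by (simp add: cyc_def)
  moreover have "card (F \<inter> fib e) \<le> 4" 
    using card_mono[OF finite_fib, of "F \<inter> fib e" e] card_fib[OF assms(2)] by simp
  moreover have "n = 0 \<or> n = 2 \<or> n = 4" if "even n" "n \<le> 4" for n :: nat
    using that by presburger
  ultimately have "card (F \<inter> fib e) = 0 \<or> card (F \<inter> fib e) = 2 \<or> card (F \<inter> fib e) = 4"
    by blast
  then consider "card (F \<inter> fib e) = 0" | "card (F \<inter> fib e) = 2" | "card (F \<inter> fib e) = 4"
    by (elim disjE)
  then show thesis
  proof cases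
    case 1
    then show thesis using that(1) finite_fib by simp
  next
    case 2
    then obtain p q where pq: "F \<inter> fib e = {p, q}" "p \<noteq> q" by (meson card_2_iff)
    then have "p \<in> fib e" "q \<in> fib e" by auto
    with tr_cases[OF this pq(2)] pq show thesis using that(3) by metis
  next
    case 3
    then show thesis using that(2) card_fib[OF assms(2)] finite_fib
      by (metis Int_lower2 card_subset_eq)
  qed
qed

text \<open>The two pairs of one pairing partition the half-edges, whereas pairs of two different pairings
  overlap in one half-edge.\<close>

lemma same_pairing:
  assumes "i \<in> {1,2,3}" "p \<in> fib e" "q \<in> fib e"
  shows "{p, tr i p} = {q, tr i q} \<or>
    {p, tr i p} \<inter> {q, tr i q} = {} \<and> {p, tr i p} \<union> {q, tr i q} = fib e"
proof (cases "q \<in> {p, tr i p}")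
  case True
  then show ?thesis using tr_fib(3)[OF assms(2,1)] by auto
next
  case False
  have e: "e \<in> E" using assms by (auto simp: fib_def E_def)
  have "tr i q \<notin> {p, tr i p}"
    using False tr_fib(3)[OF assms(2,1)] tr_fib(3)[OF assms(3,1)] by auto
  moreover from this have "card {p, tr i p, q, tr i q} = 4"
    using False tr_fib(2)[OF assms(2,1)] tr_fib(2)[OF assms(3,1)] by auto
  moreover have "{p, tr i p, q, tr i q} \<subseteq> fib e"
    using tr_fib(1)[OF assms(2,1)] tr_fib(1)[OF assms(3,1)] assms by simp
  ultimately show ?thesis
    using False card_fib[OF e] finite_fib[of e] card_subset_eq[of "fib e" "{p, tr i p, q, tr i q}"] by auto
qed

lemma complement_of_pair:
  assumes "i \<in> {1,2,3}" "p \<in> fib e"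
  obtains q where "q \<in> fib e" "fib e - {p, tr i p} = {q, tr i q}"
proof -
  have e: "e \<in> E" using assms by (auto simp: fib_def E_def)
  have "card {p, tr i p} \<noteq> 4" using card_insert_le_m1[of 2 "{tr i p}" p] by simp
  then have "{p, tr i p} \<noteq> fib e" using card_fib[OF e] by metis
  then obtain q where q: "q \<in> fib e" "q \<notin> {p, tr i p}" using assms tr_fib(1) by blast
  then have "fib e - {p, tr i p} = {q, tr i q}" using same_pairing[OF assms q(1)] by auto
  then show thesis using that q by blast
qed

lemma different_pairings:
  assumes "i \<in> {1,2,3}" "j \<in> {1,2,3}" "i \<noteq> j" "p \<in> fib e" "q \<in> fib e"
  shows "card ({p, tr i p} \<inter> {q, tr j q}) = 1"
proof -
  have "{p, tr i p} \<inter> {q, tr j q} \<noteq> {}"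
  proof
    assume *: "{p, tr i p} \<inter> {q, tr j q} = {}"
    obtain r where r: "r \<in> fib e" "fib e - {q, tr j q} = {r, tr j r}"
      using complement_of_pair[OF assms(2,5)] .
    then have "{p, tr i p} \<subseteq> {r, tr j r}" using * assms(4) tr_fib(1)[OF assms(4,1)] by blast
    then have "tr i p = tr j p"
      using tr_fib(3)[OF r(1) assms(2)] tr_fib(2)[OF assms(4,1)] by auto
    then show False using tr_inj_index assms by blast
  qed
  moreover have "\<not> {p, tr i p} \<subseteq> {q, tr j q}"
  proof
    assume *: "{p, tr i p} \<subseteq> {q, tr j q}"
    then have "tr i p = tr j p"
      using tr_fib(3)[OF assms(5,2)] tr_fib(2)[OF assms(4,1)] by auto
    then show False using tr_inj_index assms by blast
  qed
  then have "{p, tr i p} \<inter> {q, tr j q} \<subseteq> {p} \<or> {p, tr i p} \<inter> {q, tr j q} \<subseteq> {tr i p}" by blast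
  ultimately have "{p, tr i p} \<inter> {q, tr j q} = {p} \<or> {p, tr i p} \<inter> {q, tr j q} = {tr i p}" by blast
  then show ?thesis by auto
qed

lemma even_card_kclosed: "kclosed F \<Longrightarrow> even (card F)"
  using finite_P kappa by (intro even_card_involution[of F \<kappa>]) (auto simp: kclosed_def intro: finite_subset)

lemma kclosed_Int: "kclosed F \<Longrightarrow> kclosed G \<Longrightarrow> kclosed (F \<inter> G)"
  by (auto simp: kclosed_def)

lemma kclosed_sym_diff: "kclosed F \<Longrightarrow> kclosed G \<Longrightarrow> kclosed (sym_diff F G)"
  unfolding kclosed_def by (auto) (metis in_mono kappa)+

lemma finite_kclosed: "kclosed F \<Longrightarrow> finite F"
  using finite_P finite_subset by (auto simp: kclosed_def)

lemma sym_diff_Int_fib: "sym_diff F G \<inter> fib e = sym_diff (F \<inter> fib e) (G \<inter> fib e)"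
  by auto

lemma even_card_sym_diff:
  "finite A \<Longrightarrow> finite B \<Longrightarrow> even (card (sym_diff A B)) \<longleftrightarrow> (even (card A) \<longleftrightarrow> even (card B))"
  using card_sym_diff[of A B] by (metis even_add even_mult_iff dvd_refl)

lemma cyc_sym_diff: "cyc F \<Longrightarrow> cyc G \<Longrightarrow> cyc (sym_diff F G)"
  unfolding cyc_def by (simp add: kclosed_sym_diff sym_diff_Int_fib even_card_sym_diff finite_fib)

lemma card_by_fib: "A \<subseteq> P \<Longrightarrow> card A = (\<Sum>e\<in>E. card (A \<inter> fib e))"
proof -
  assume A: "A \<subseteq> P"
  have "A = (\<Union>e\<in>E. A \<inter> fib e)" using A by (auto simp: E_def fib_def)
  also have "card \<dots> = (\<Sum>e\<in>E. card (A \<inter> fib e))"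
    using finite_E finite_fib fib_disjoint by (intro card_UN_disjoint) auto
  finally show ?thesis .
qed

subsection \<open>The vector of a cycle\<close>

lemma mem_vec_iff:
  "(e, i) \<in> vec F \<longleftrightarrow> i \<in> {1,2,3} \<and> (\<exists>p \<in> fib e. F \<inter> fib e = {p, tr i p})"
  by (simp add: vec_def)

lemma vec_subset: "vec F \<subseteq> E \<times> {1,2,3}"
  by (auto simp: vec_def fib_def E_def)

lemma vec_single_valued: "single_valued (vec F)"
proof (rule single_valuedI)
  fix e i j assume "(e, i) \<in> vec F" "(e, j) \<in> vec F"
  then obtain p q where i: "i \<in> {1,2,3}" "p \<in> fib e" "F \<inter> fib e = {p, tr i p}"
    and j: "j \<in> {1,2,3}" "q \<in> fib e" "F \<inter> fib e = {q, tr j q}" by (auto simp: mem_vec_iff)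
  have eq: "{p, tr i p} = {q, tr j q}" using i j by simp
  show "i = j"
  proof (cases "p = q")
    case True
    then have "tr i p = tr j p" using eq tr_fib(2)[OF i(2,1)] by (auto simp: doubleton_eq_iff)
    then show ?thesis using tr_inj_index i j by blast
  next
    case False
    then have "p = tr j q" "tr i p = q" using eq by (auto simp: doubleton_eq_iff)
    then have "tr i p = tr j p" using tr_fib(3)[OF j(2,1)] by simp
    then show ?thesis using tr_inj_index i j by blast
  qed
qed

text \<open>Such a cycle meets each fibre in nothing or in everything, so it is closed under all pairings.\<close>

lemma vec_empty:
  assumes "cyc F" "vec F = {}"
  shows "F = {} \<or> F = P"
proof (rule connected)
  show "F \<subseteq> P" using assms by (simp add: cyc_def kclosed_def)
  fix p assume p: "p \<in> F"
  then have pP: "p \<in> P" using assms by (auto simp: cyc_def kclosed_def)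
  then have e: "ed p \<in> E" "p \<in> fib (ed p)" by (auto simp: E_def fib_def)
  have "F \<inter> fib (ed p) = fib (ed p)"
    using assms(1) e(1)
  proof (cases rule: cyc_fib_cases)
    case (pair i q)
    then have "(ed p, i) \<in> vec F" unfolding mem_vec_iff by blast
    then show ?thesis using assms(2) by simp
  qed (use p e in auto)
  moreover have "\<sigma> p \<in> fib (ed p)" "\<epsilon> p \<in> fib (ed p)"
    using sigma[OF pP] eps[OF pP] by (simp_all add: fib_def)
  ultimately show "\<kappa> p \<in> F \<and> \<sigma> p \<in> F \<and> \<epsilon> p \<in> F"
    using assms(1) p by (auto simp: cyc_def kclosed_def)
qed

lemma vec_eqI:
  assumes "i \<in> {1,2,3}" "p \<in> fib e" "F \<inter> fib e = {p, tr i p}"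
  shows "(e, j) \<in> vec F \<longleftrightarrow> j = i"
proof
  have "(e, i) \<in> vec F" unfolding mem_vec_iff using assms by blast
  then show "(e, j) \<in> vec F \<Longrightarrow> j = i" "j = i \<Longrightarrow> (e, j) \<in> vec F"
    using vec_single_valued by (auto dest: single_valuedD)
qed

lemma vec_trivial:
  assumes "F \<inter> fib e = {} \<or> F \<inter> fib e = fib e" "e \<in> E"
  shows "(e, j) \<notin> vec F"
proof
  assume "(e, j) \<in> vec F"
  then obtain p where "j \<in> {1,2,3}" "p \<in> fib e" "F \<inter> fib e = {p, tr j p}" by (auto simp: mem_vec_iff)
  moreover from this have "card {p, tr j p} = 2" using tr_fib(2) by (metis card_2_iff)
  ultimately show False using assms(1) card_fib[OF assms(2)] by auto
qed

text \<open>Where both cycles are nontrivial they contain pairs of the same transition, which cancel or make up the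
  whole fibre; adding a full fibre replaces a pair by the other pair of the same transition.\<close>

lemma vec_sym_diff:
  assumes F: "cyc F" "vec F \<subseteq> T" and G: "cyc G" "vec G \<subseteq> T" and T: "single_valued T"
  shows "vec (sym_diff F G) = sym_diff (vec F) (vec G)"
proof -
  have "(e, j) \<in> vec (sym_diff F G) \<longleftrightarrow> ((e, j) \<in> vec F \<longleftrightarrow> (e, j) \<notin> vec G)" if e: "e \<in> E" for e j
  proof -
    have triv: "(e, j) \<in> vec (sym_diff F G) \<longleftrightarrow> (e, j) \<in> vec A"
      if "sym_diff (F \<inter> fib e) (G \<inter> fib e) = A \<inter> fib e" for A
      unfolding mem_vec_iff sym_diff_Int_fib that ..
    have compl: "(e, j) \<in> vec (fib e - A) \<longleftrightarrow> (e, j) \<in> vec A" if "cyc A" for A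
      using that e
    proof (cases rule: cyc_fib_cases)
      case (pair i p)
      obtain q where q: "q \<in> fib e" "fib e - {p, tr i p} = {q, tr i q}"
        using complement_of_pair[OF pair(1,2)] .
      then have "(fib e - A) \<inter> fib e = {q, tr i q}" using pair(3) by auto
      then show ?thesis using vec_eqI[OF pair(1) q(1)] vec_eqI[OF pair] by simp
    next
      case empty
      then have "(fib e - A) \<inter> fib e = fib e" by auto
      then show ?thesis using vec_trivial empty e by metis
    next
      case full
      then have "(fib e - A) \<inter> fib e = {}" by auto
      then show ?thesis using vec_trivial full e by metis
    qed
    show ?thesis
      using F(1) e
    proof (cases rule: cyc_fib_cases)
      case empty
      have "(e, j) \<notin> vec F" using vec_trivial empty e by blast
      moreover have "sym_diff (F \<inter> fib e) (G \<inter> fib e) = G \<inter> fib e" using empty by auto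
      ultimately show ?thesis using triv by simp
    next
      case full
      have "(e, j) \<notin> vec F" using vec_trivial full e by blast
      moreover have "sym_diff (F \<inter> fib e) (G \<inter> fib e) = (fib e - G) \<inter> fib e" using full by auto
      ultimately show ?thesis using triv compl[OF G(1)] by simp
    next
      case (pair i p)
      note Fpair = pair
      show ?thesis using G(1) e
      proof (cases rule: cyc_fib_cases)
        case empty
        have "(e, j) \<notin> vec G" using vec_trivial empty e by blast
        moreover have "sym_diff (F \<inter> fib e) (G \<inter> fib e) = F \<inter> fib e" using empty by auto
        ultimately show ?thesis using triv by simp
      next
        case full
        have "(e, j) \<notin> vec G" using vec_trivial full e by blast
        moreover have "sym_diff (F \<inter> fib e) (G \<inter> fib e) = (fib e - F) \<inter> fib e" using full by auto
        ultimately show ?thesis using triv compl[OF F(1)] by simp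
      next
        case (pair k q)
        have "(e, i) \<in> T" "(e, k) \<in> T"
          using vec_eqI[OF Fpair] vec_eqI[OF pair] F(2) G(2) by auto
        then have ik: "i = k" using T by (auto dest: single_valuedD)
        have "sym_diff (F \<inter> fib e) (G \<inter> fib e) = {} \<or> sym_diff (F \<inter> fib e) (G \<inter> fib e) = fib e"
          using same_pairing[OF Fpair(1,2) pair(2)] unfolding Fpair pair ik by auto
        then have "(e, j) \<notin> vec (sym_diff F G)"
          using vec_trivial e unfolding sym_diff_Int_fib[symmetric] by simp
        then show ?thesis using vec_eqI[OF Fpair] vec_eqI[OF pair] ik by simp
      qed
    qed
  qed
  note iff = this
  show ?thesis
  proof (rule set_eqI)
    fix x :: "'e \<times> nat"
    obtain e j where x: "x = (e, j)" by (cases x)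
    show "x \<in> vec (sym_diff F G) \<longleftrightarrow> x \<in> sym_diff (vec F) (vec G)"
    proof (cases "e \<in> E")
      case True
      then show ?thesis using iff[OF True, of j] x by blast
    next
      case False
      then have "(e, j) \<notin> vec A" for A using vec_subset by blast
      then show ?thesis using x by simp
    qed
  qed
qed

text \<open>Total isotropy: \<open>\<kappa>\<close> pairs up the common points of two cycles, so their number is even,
  whereas at a vertex where the cycles take different transitions it is odd.\<close>

lemma isotropic:
  assumes F: "cyc F" "vec F \<subseteq> insert (e, i) I" "(e, i) \<in> vec F"
    and G: "cyc G" "vec G \<subseteq> insert (e, j) I" "(e, j) \<in> vec G"
    and I: "single_valued I" "\<And>k. (e, k) \<notin> I"
  shows "i = j"
proof (rule ccontr)
  assume ij: "i \<noteq> j"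
  obtain p where p: "i \<in> {1,2,3}" "p \<in> fib e" "F \<inter> fib e = {p, tr i p}"
    using F(3) by (auto simp: mem_vec_iff)
  obtain q where q: "j \<in> {1,2,3}" "q \<in> fib e" "G \<inter> fib e = {q, tr j q}"
    using G(3) by (auto simp: mem_vec_iff)
  have e: "e \<in> E" using F(3) vec_subset by auto
  have FG: "F \<inter> G \<subseteq> P" "even (card (F \<inter> G))"
    using F(1) G(1) even_card_kclosed kclosed_Int by (auto simp: cyc_def kclosed_def)
  have even: "even (card (F \<inter> G \<inter> fib x))" if x: "x \<in> E - {e}" for x
  proof -
    have FGx: "F \<inter> G \<inter> fib x = (F \<inter> fib x) \<inter> (G \<inter> fib x)" by auto
    have evenF: "even (card (F \<inter> fib x))" "even (card (G \<inter> fib x))"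
      using F(1) G(1) x by (auto simp: cyc_def)
    have "x \<in> E" using x by simp
    with F(1) show ?thesis
    proof (cases rule: cyc_fib_cases)
      case empty then show ?thesis using FGx by simp
    next
      case full 
      then have "F \<inter> G \<inter> fib x = G \<inter> fib x" by blast
      then show ?thesis using evenF by simp
    next
      case (pair k r)
      note Fpair = pair
      from G(1) \<open>x \<in> E\<close> show ?thesis
      proof (cases rule: cyc_fib_cases)
        case empty then show ?thesis using FGx by simp
      next
        case full 
        then have "F \<inter> G \<inter> fib x = F \<inter> fib x" by blast
        then show ?thesis using evenF by simp
      next
        case (pair l s)
        have "(x, k) \<in> I" "(x, l) \<in> I"
          using vec_eqI[OF Fpair] vec_eqI[OF pair] F(2) G(2) x by auto
        then have kl: "k = l" using I(1) by (auto dest: single_valuedD)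
        have "F \<inter> G \<inter> fib x = F \<inter> fib x \<or> F \<inter> G \<inter> fib x = {}"
          using same_pairing[OF Fpair(1,2) pair(2)] unfolding FGx Fpair pair kl by auto
        then show ?thesis using evenF by auto
      qed
    qed
  qed
  have odd: "odd (card (F \<inter> G \<inter> fib e))"
  proof -
    have "F \<inter> G \<inter> fib e = {p, tr i p} \<inter> {q, tr j q}" using p q by auto
    then show ?thesis using different_pairings[OF p(1) q(1) ij p(2) q(2)] by simp
  qed
  have "card (F \<inter> G) = card (F \<inter> G \<inter> fib e) + (\<Sum>x\<in>E - {e}. card (F \<inter> G \<inter> fib x))"
    using card_by_fib[OF FG(1)] sum.remove[OF finite_E e] by metis
  moreover have "even (\<Sum>x\<in>E - {e}. card (F \<inter> G \<inter> fib x))" using even by (rule dvd_sum)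
  ultimately show False using odd FG(2) by simp
qed


subsection \<open>The tight 3-matroid of the cycle space\<close>

lemma Zcyc_carrier: "on_Z3_carrier E Zcyc"
  by (simp add: on_Z3_carrier_def Zcyc_def)

lemma indep_iff: "I \<in> indeps Zcyc \<longleftrightarrow> I \<subseteq> E \<times> {1, 2, 3} \<and> single_valued I \<and>
       (\<forall>F. cyc F \<and> vec F \<subseteq> I \<longrightarrow> vec F = {})"
  by (simp add: Zcyc_def)

lemma single_valued_mono: "single_valued T \<Longrightarrow> S \<subseteq> T \<Longrightarrow> single_valued S"
  by (auto simp: single_valued_def)

lemma indep_mono: "J \<in> indeps Zcyc \<Longrightarrow> I \<subseteq> J \<Longrightarrow> I \<in> indeps Zcyc"
  unfolding indep_iff by (meson single_valued_mono subset_trans)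

lemma dependentE:
  assumes "I \<subseteq> E \<times> {1, 2, 3}" "single_valued I" "I \<notin> indeps Zcyc"
  obtains F where "cyc F" "vec F \<subseteq> I" "vec F \<noteq> {}"
  using assms unfolding indep_iff by blast

text \<open>Two cycles witnessing dependence would take different transitions at \<open>e\<close> and compatible ones elsewhere,
  against isotropy.\<close>

lemma indep_class_extension:
  assumes I: "I \<in> indeps Zcyc" "\<And>k. (e, k) \<notin> I" and e: "e \<in> E"
    and ij: "i \<in> {1,2,3}" "j \<in> {1,2,3}" "i \<noteq> j"
  shows "insert (e, i) I \<in> indeps Zcyc \<or> insert (e, j) I \<in> indeps Zcyc"
proof (rule ccontr)
  assume contra: "\<not> (insert (e, i) I \<in> indeps Zcyc \<or> insert (e, j) I \<in> indeps Zcyc)"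
  have I': "I \<subseteq> E \<times> {1,2,3}" "single_valued I" "\<And>F. cyc F \<Longrightarrow> vec F \<subseteq> I \<Longrightarrow> vec F = {}"
    using I(1) unfolding indep_iff by blast+
  have *: "\<exists>F. cyc F \<and> vec F \<subseteq> insert (e, k) I \<and> (e, k) \<in> vec F"
    if k: "k \<in> {1,2,3}" "insert (e, k) I \<notin> indeps Zcyc" for k
  proof -
    have "insert (e, k) I \<subseteq> E \<times> {1,2,3}" "single_valued (insert (e, k) I)"
      using I' I(2) e k(1) by (auto simp: single_valued_def)
    then obtain F where F: "cyc F" "vec F \<subseteq> insert (e, k) I" "vec F \<noteq> {}"
      using dependentE[of "insert (e, k) I"] k(2) by metis
    then have "(e, k) \<in> vec F" using I'(3)[of F] by blast
    then show ?thesis using F by blast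
  qed
  obtain F G where F: "cyc F" "vec F \<subseteq> insert (e, i) I" "(e, i) \<in> vec F"
    and G: "cyc G" "vec G \<subseteq> insert (e, j) I" "(e, j) \<in> vec G"
    using *[OF ij(1)] *[OF ij(2)] contra by blast
  show False using isotropic[OF F G I'(2) I(2)] ij(3) by simp
qed

text \<open>The independent subsets of a transversal \<open>T\<close> are represented by vectors modulo the cycle
  space. If no element of \<open>J\<close> could be added to \<open>I\<close>, every subset of \<open>J\<close> would be congruent to a
  subset of \<open>I\<close>, and distinct subsets of the independent set \<open>J\<close> to distinct ones, so that
  \<open>2 ^ card J \<le> 2 ^ card I\<close>.\<close>

lemma indep_augment:
  assumes T: "single_valued T" and I: "I \<in> indeps Zcyc" "I \<subseteq> T" and J: "J \<in> indeps Zcyc" "J \<subseteq> T"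
    and less: "card I < card J"
  shows "\<exists>x \<in> J - I. insert x I \<in> indeps Zcyc"
proof (rule ccontr)
  assume contra: "\<not> ?thesis"
  have fin: "finite I" "finite J"
    using I(1) J(1) finite_E unfolding indep_iff by (meson finite.emptyI finite_SigmaI finite_insert finite_subset)+
  define V where "V = {vec F | F. cyc F \<and> vec F \<subseteq> T}"
  have V_sym: "sym_diff A B \<in> V" if "A \<in> V" "B \<in> V" for A B
  proof -
    obtain F G where FG: "A = vec F" "B = vec G" "cyc F" "vec F \<subseteq> T" "cyc G" "vec G \<subseteq> T"
      using \<open>A \<in> V\<close> \<open>B \<in> V\<close> by (auto simp: V_def)
    then have "vec (sym_diff F G) = sym_diff A B" using vec_sym_diff[OF FG(3-6) T] by simp
    moreover have "sym_diff A B \<subseteq> T" using FG by auto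
    ultimately show ?thesis using cyc_sym_diff[OF FG(3,5)] unfolding V_def by (smt (verit) mem_Collect_eq)
  qed
  have V_empty: "{} \<in> V"
  proof -
    have "cyc {}" by (simp add: cyc_def kclosed_def)
    moreover have "vec {} = {}" by (simp add: vec_def)
    ultimately show ?thesis by (auto simp: V_def intro!: exI[of _ "{}"])
  qed
  have indV: "A = {}" if "A \<in> V" "A \<subseteq> J" for A
    using that J(1) unfolding V_def indep_iff by blast
  have step: "\<exists>B \<subseteq> I. sym_diff {x} B \<in> V" if x: "x \<in> J" for x
  proof (cases "x \<in> I")
    case True
    have "sym_diff {x} {x} \<in> V" using V_empty by simp
    then show ?thesis using True by blast
  next
    case False
    have "insert x I \<notin> indeps Zcyc" using contra x False by blast
    moreover have xT: "insert x I \<subseteq> T" using x I(2) J(2) by auto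
    moreover have "insert x I \<subseteq> E \<times> {1,2,3}" using x I(1) J(1) unfolding indep_iff by blast
    ultimately obtain F where F: "cyc F" "vec F \<subseteq> insert x I" "vec F \<noteq> {}"
      using dependentE single_valued_mono[OF T] by metis
    then have xF: "x \<in> vec F" using I(1) unfolding indep_iff by blast
    then have "sym_diff {x} (vec F - {x}) = vec F" by auto
    moreover have "vec F \<in> V" using F xT unfolding V_def by blast
    ultimately show ?thesis using F(2) by (intro exI[of _ "vec F - {x}"]) auto
  qed
  have rep: "\<exists>B \<subseteq> I. sym_diff A B \<in> V" if "A \<subseteq> J" for A
    using finite_subset[OF that fin(2)] that
  proof (induction A rule: finite_induct)
    case empty
    then show ?case using V_empty by (intro exI[of _ "{}"]) simp
  next
    case (insert x A)
    obtain B C where B: "B \<subseteq> I" "sym_diff A B \<in> V" and C: "C \<subseteq> I" "sym_diff {x} C \<in> V"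
      using insert step[of x] by auto
    have "sym_diff (insert x A) (sym_diff B C) = sym_diff (sym_diff A B) (sym_diff {x} C)"
      using insert(2) by auto
    then have "sym_diff (insert x A) (sym_diff B C) \<in> V" using V_sym[OF B(2) C(2)] by simp
    moreover have "sym_diff B C \<subseteq> I" using B C by auto
    ultimately show ?case by blast
  qed
  then obtain b where b: "\<And>A. A \<subseteq> J \<Longrightarrow> b A \<subseteq> I" "\<And>A. A \<subseteq> J \<Longrightarrow> sym_diff A (b A) \<in> V" by metis
  have "inj_on b (Pow J)"
  proof (rule inj_onI)
    fix A B assume AB: "A \<in> Pow J" "B \<in> Pow J" "b A = b B"
    have "sym_diff A B = sym_diff (sym_diff A (b A)) (sym_diff B (b B))" using AB(3) by auto
    then have "sym_diff A B \<in> V" using V_sym[OF b(2)[of A] b(2)[of B]] AB by simp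
    then have "sym_diff A B = {}" using indV AB by auto
    then show "A = B" by auto
  qed
  moreover have "b ` Pow J \<subseteq> Pow I" using b(1) by auto
  ultimately have "card (Pow J) \<le> card (Pow I)" using fin by (intro card_inj_on_le) auto
  then have "card J \<le> card I" using fin by (simp add: card_Pow)
  then show False using less by simp
qed

lemma empty_indep: "{} \<in> indeps Zcyc"
  unfolding indep_iff by (simp add: single_valued_def)

lemma partition_Z3: "partition_on (Z3_carrier E) (Z3_skew_classes E)"
  unfolding partition_on_def Z3_carrier_def Z3_skew_classes_def disjoint_def by auto

lemma multimatroid_Zcyc: "multimatroid Zcyc"
  unfolding multimatroid_def
proof (intro conjI ballI allI impI)
  show "finite (carrier_set Zcyc)" using finite_E by (simp add: Zcyc_def Z3_carrier_def)
  show "partition_on (carrier_set Zcyc) (skew_classes Zcyc)" using partition_Z3 by (simp add: Zcyc_def)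
  show "subtransversal Zcyc I" if "I \<in> indeps Zcyc" for I
    using that subtransversal_Z3_iff[OF Zcyc_carrier] by (simp add: indep_iff)
  show "matroid T (indeps Zcyc \<inter> Pow T)" if tT: "transversal Zcyc T" for T
  proof -
    obtain t where t: "T = choice_set E t" using tT transversal_Z3_iff[OF Zcyc_carrier, of T] by auto
    have T: "finite T" "single_valued T" using finite_E t by (auto simp: finite_choice_set single_valued_def)
    show ?thesis
      unfolding matroid_def
    proof (intro conjI allI ballI impI)
      show "finite T" by (rule T)
      show "indeps Zcyc \<inter> Pow T \<subseteq> Pow T" by blast
      show "{} \<in> indeps Zcyc \<inter> Pow T" using empty_indep by simp
      show "I \<in> indeps Zcyc \<inter> Pow T" if "J \<in> indeps Zcyc \<inter> Pow T \<and> I \<subseteq> J" for I J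
        using that indep_mono by blast
      show "\<exists>x\<in>J - I. insert x I \<in> indeps Zcyc \<inter> Pow T"
        if "I \<in> indeps Zcyc \<inter> Pow T" "J \<in> indeps Zcyc \<inter> Pow T" "card I < card J" for I J
        using indep_augment[OF T(2), of I J] that by auto
    qed
  qed
  fix I \<omega> x y
  assume I: "I \<in> indeps Zcyc" and w: "\<omega> \<in> skew_classes Zcyc" "x \<in> \<omega>" "y \<in> \<omega>" "x \<noteq> y \<and> \<omega> \<inter> I = {}"
  obtain e where e: "e \<in> E" "\<omega> = {(e, 1), (e, 2), (e, 3)}"
    using w(1) by (auto simp: Zcyc_def Z3_skew_classes_def)
  obtain i j where ij: "x = (e, i)" "y = (e, j)" "i \<in> {1,2,3}" "j \<in> {1,2,3}" "i \<noteq> j"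
    using w e by auto
  have sub: "I \<subseteq> E \<times> {1,2,3}" using I unfolding indep_iff by blast
  have "(e, k) \<notin> I" for k
  proof
    assume k: "(e, k) \<in> I"
    then have "(e, k) \<in> \<omega>" using sub e by auto
    then show False using k w by blast
  qed
  then show "insert x I \<in> indeps Zcyc \<or> insert y I \<in> indeps Zcyc"
    using indep_class_extension[OF I _ e(1) ij(3-5)] ij by simp
qed

definition tmap :: "('e \<Rightarrow> nat) \<Rightarrow> 'p \<Rightarrow> 'p" where "tmap t p = tr (t (ed p)) p"

lemma tmap:
  assumes "\<forall>e\<in>E. t e \<in> {1,2,3}" "p \<in> P"
  shows "tmap t p \<in> P" "ed (tmap t p) = ed p" "tmap t p \<noteq> p" "tmap t (tmap t p) = p"
proof -
  have p: "p \<in> fib (ed p)" "t (ed p) \<in> {1,2,3}" using assms by (auto simp: fib_def E_def)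
  note * = tr_fib[OF p]
  show "tmap t p \<in> P" "ed (tmap t p) = ed p" "tmap t p \<noteq> p" using * by (simp_all add: tmap_def fib_def)
  then show "tmap t (tmap t p) = p" using * by (simp add: tmap_def fib_def)
qed

lemma orbit_eq:
  assumes "p \<in> P" "q \<in> {p, f p}" "f (f p) = p"
  shows "{p, f p} = {q, f q}"
  using assms by auto

text \<open>The transitions \<open>t\<close> at the vertices other than \<open>e\<close> impose one condition per pair, and there are fewer
  pairs than corners, even after discarding one corner. So two different sets of corners violate the
  same conditions, and their sum violates none.\<close>

lemma exists_nontrivial_cycle:
  assumes t: "\<forall>e\<in>E. t e \<in> {1,2,3}" and e: "e \<in> E"
  obtains F where "kclosed F" "F \<noteq> {}" "F \<noteq> P" "\<And>p. p \<in> F \<Longrightarrow> ed p \<noteq> e \<Longrightarrow> tmap t p \<in> F"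
proof -
  define Q where "Q = P - fib e"
  define Ok where "Ok = (\<lambda>p. {p, \<kappa> p}) ` P"
  define Ot where "Ot = (\<lambda>p. {p, tmap t p}) ` Q"
  have cP: "card P = 2 * card Ok"
    unfolding Ok_def using finite_P kappa by (rule card_involution_orbits) blast
  have tQ: "tmap t p \<in> Q" if "p \<in> Q" for p
    using that tmap[OF t, of p] by (auto simp: Q_def fib_def)
  have cQ: "card Q = 2 * card Ot"
    unfolding Ot_def
  proof (rule card_involution_orbits)
    show "finite Q" using finite_P by (simp add: Q_def)
    show "tmap t p \<in> Q \<and> tmap t p \<noteq> p \<and> tmap t (tmap t p) = p" if "p \<in> Q" for p
      using that tQ[OF that] tmap[OF t, of p] by (auto simp: Q_def)
  qed
  have "card Q = card P - 4"
    unfolding Q_def using card_fib[OF e] fib_subset finite_fib by (simp add: card_Diff_subset)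
  moreover have "card P \<ge> 4" using card_mono[OF finite_P fib_subset, of e] card_fib[OF e] by simp
  ultimately have less: "card Ot < card Ok - 1" using cP cQ by simp
  (* Never using the orbit o0 keeps the cycle from being everything. *)
  obtain o0 where o0: "o0 \<in> Ok" using P_ne by (auto simp: Ok_def)
  have fin: "finite Ok" "finite Ot" using finite_P by (auto simp: Ok_def Ot_def Q_def)
  (* The transition pairs away from e on which the union of S is not constant. *)
  define viol where "viol S = {c \<in> Ot. \<exists>p \<in> c. \<exists>q \<in> c. p \<in> \<Union>S \<and> q \<notin> \<Union>S}" for S
  have "card (viol ` Pow (Ok - {o0})) \<le> card (Pow Ot)"
    using fin by (intro card_mono) (auto simp: viol_def)
  also have "\<dots> < card (Pow (Ok - {o0}))"
    using less fin o0 by (simp add: card_Pow)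
  finally have "\<not> inj_on viol (Pow (Ok - {o0}))"
    using card_image[of viol "Pow (Ok - {o0})"] by auto
  then obtain S S' where S: "S \<subseteq> Ok - {o0}" "S' \<subseteq> Ok - {o0}" "S \<noteq> S'" "viol S = viol S'"
    by (auto simp: inj_on_def)
  have kcl: "kclosed (\<Union>R)" if R: "R \<subseteq> Ok" for R
    unfolding kclosed_def
  proof (intro conjI ballI)
    show "\<Union>R \<subseteq> P" using R kappa unfolding Ok_def by auto
    fix p assume "p \<in> \<Union>R"
    then obtain c where c: "c \<in> R" "p \<in> c" by blast
    then obtain q where "q \<in> P" "c = {q, \<kappa> q}" using R unfolding Ok_def by auto
    then show "\<kappa> p \<in> \<Union>R" using c kappa[of q] by (intro UnionI[of c]) auto
  qed
  have mem: "p \<in> \<Union>R \<longleftrightarrow> {p, \<kappa> p} \<in> R" if R: "R \<subseteq> Ok" "p \<in> P" for R p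
  proof
    assume "p \<in> \<Union>R"
    then obtain q where q: "{q, \<kappa> q} \<in> R" "p \<in> {q, \<kappa> q}" "q \<in> P" using R unfolding Ok_def by fast
    then show "{p, \<kappa> p} \<in> R" using orbit_eq[where f = \<kappa>, OF q(3,2)] kappa[OF q(3)] by simp
  qed auto
  define F where "F = sym_diff (\<Union>S) (\<Union>S')"
  have sub: "S \<subseteq> Ok" "S' \<subseteq> Ok" using S by auto
  have F: "p \<in> F \<longleftrightarrow> ({p, \<kappa> p} \<in> S \<longleftrightarrow> {p, \<kappa> p} \<notin> S')" if "p \<in> P" for p
    unfolding F_def using mem[OF sub(1) that] mem[OF sub(2) that] by auto
  show thesis
  proof (rule that)
    show "kclosed F" unfolding F_def using kcl[OF sub(1)] kcl[OF sub(2)] by (rule kclosed_sym_diff)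
    show "F \<noteq> {}"
    proof -
      obtain c where "c \<in> Ok" "c \<in> S \<longleftrightarrow> c \<notin> S'" using S by blast
      then show ?thesis using F by (auto simp: Ok_def)
    qed
    show "F \<noteq> P"
    proof -
      obtain p where "p \<in> P" "o0 = {p, \<kappa> p}" using o0 by (auto simp: Ok_def)
      then have "p \<notin> F" using F S by blast
      then show ?thesis using \<open>p \<in> P\<close> by blast
    qed
    fix p assume p: "p \<in> F" "ed p \<noteq> e"
    have pP: "p \<in> P" using p \<open>kclosed F\<close> by (auto simp: kclosed_def)
    then have "p \<in> Q" using p by (simp add: Q_def fib_def)
    then have c: "{p, tmap t p} \<in> Ot" by (auto simp: Ot_def)
    then have "{p, tmap t p} \<in> viol S \<longleftrightarrow> {p, tmap t p} \<in> viol S'" using S(4) by simp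
    moreover have "{p, tmap t p} \<in> viol R \<longleftrightarrow> \<not> (p \<in> \<Union>R \<longleftrightarrow> tmap t p \<in> \<Union>R)" for R
      unfolding viol_def mem_Collect_eq using c by (simp only: bex_simps insert_iff simp_thms) metis
    ultimately have "(p \<in> \<Union>S \<longleftrightarrow> tmap t p \<in> \<Union>S) \<longleftrightarrow> (p \<in> \<Union>S' \<longleftrightarrow> tmap t p \<in> \<Union>S')"
      by metis
    then show "tmap t p \<in> F" using p(1) unfolding F_def by blast
  qed
qed


lemma vec_subset_choice_set:
  assumes t: "\<forall>e\<in>E. t e \<in> {1,2,3}" and F: "cyc F" and e: "e \<in> E"
    and sub: "\<And>i. (e, i) \<in> vec F \<Longrightarrow> i = t e" and p: "p \<in> F" "ed p = e"
  shows "tmap t p \<in> F"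
proof -
  have pf: "p \<in> fib e" "t e \<in> {1,2,3}" using p F e t by (auto simp: cyc_def kclosed_def fib_def)
  show ?thesis using F e
  proof (cases rule: cyc_fib_cases)
    case empty then show ?thesis using pf p by auto
  next
    case full then show ?thesis using tr_fib(1)[OF pf] p by (auto simp: tmap_def)
  next
    case (pair i q)
    have i: "i = t e" using vec_eqI[OF pair, of i] sub by simp
    have "p \<in> {q, tr i q}" using pair pf p by auto
    then have "tr i p \<in> {q, tr i q}" using tr_fib(3)[OF pair(2,1)] by auto
    then show ?thesis using pair(3) p i by (auto simp: tmap_def)
  qed
qed

text \<open>A set closed under a fixed-point-free involution is even, and it cannot be a single pair of another
  transition.\<close>

lemma closed_vec:
  assumes t: "\<forall>e\<in>E. t e \<in> {1,2,3}" and F: "F \<subseteq> P" 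
    and closed: "\<And>p. p \<in> F \<Longrightarrow> ed p = e \<Longrightarrow> tmap t p \<in> F"
  shows "even (card (F \<inter> fib e))" "(e, i) \<in> vec F \<Longrightarrow> i = t e"
proof -
  show "even (card (F \<inter> fib e))"
  proof (rule even_card_involution)
    show "finite (F \<inter> fib e)" using finite_fib by simp
    show "tmap t p \<in> F \<inter> fib e \<and> tmap t p \<noteq> p \<and> tmap t (tmap t p) = p" if "p \<in> F \<inter> fib e" for p
      using that closed[of p] tmap[OF t, of p] by (auto simp: fib_def)
  qed
  assume "(e, i) \<in> vec F"
  then obtain p where p: "i \<in> {1,2,3}" "p \<in> fib e" "F \<inter> fib e = {p, tr i p}" by (auto simp: mem_vec_iff)
  have e: "e \<in> E" "ed p = e" using p by (auto simp: fib_def E_def)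
  have te: "t e \<in> {1,2,3}" using t e by blast
  have "tr (t e) p \<in> F \<inter> fib e"
    using closed[of p] p e tr_fib(1)[OF p(2) te] by (auto simp: tmap_def)
  then have "tr (t e) p = tr i p" using p(3) tr_fib(2)[OF p(2) te] by auto
  then show "i = t e" using tr_inj_index[OF p(2) te p(1)] by simp
qed

text \<open>A cycle whose vector lies in the transversal of \<open>t\<close> is the same as a set of half-edges closed under \<open>\<kappa>\<close>
  and the transitions \<open>t\<close>, and the trivial cycles are those with an empty vector.\<close>

lemma choice_set_indep_iff:
  assumes t: "\<forall>e\<in>E. t e \<in> {1,2,3}"
  shows "choice_set E t \<in> indeps Zcyc \<longleftrightarrow>
    (\<forall>F. kclosed F \<and> (\<forall>p\<in>F. tmap t p \<in> F) \<longrightarrow> F = {} \<or> F = P)"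
proof
  assume ind: "choice_set E t \<in> indeps Zcyc"
  show "\<forall>F. kclosed F \<and> (\<forall>p\<in>F. tmap t p \<in> F) \<longrightarrow> F = {} \<or> F = P"
  proof (intro allI impI)
    fix F assume F: "kclosed F \<and> (\<forall>p\<in>F. tmap t p \<in> F)"
    then have FP: "F \<subseteq> P" by (simp add: kclosed_def)
    have cl: "even (card (F \<inter> fib e))" "(e, i) \<in> vec F \<Longrightarrow> i = t e" for e i
      using closed_vec[OF t FP] F by blast+
    then have "cyc F" using F by (simp add: cyc_def)
    moreover have "vec F \<subseteq> choice_set E t"
    proof (rule subsetI, clarify)
      fix e i assume "(e, i) \<in> vec F"
      then show "(e, i) \<in> choice_set E t" using cl(2) vec_subset[of F] by auto
    qed
    ultimately show "F = {} \<or> F = P" using ind vec_empty unfolding indep_iff by blast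
  qed
next
  assume *: "\<forall>F. kclosed F \<and> (\<forall>p\<in>F. tmap t p \<in> F) \<longrightarrow> F = {} \<or> F = P"
  have "vec F = {}" if F: "cyc F" "vec F \<subseteq> choice_set E t" for F
  proof -
    have "\<forall>p\<in>F. tmap t p \<in> F"
    proof
      fix p assume p: "p \<in> F"
      then have e: "ed p \<in> E" using F(1) by (auto simp: cyc_def kclosed_def E_def)
      have "i = t (ed p)" if "(ed p, i) \<in> vec F" for i
        using subsetD[OF F(2) that] by simp
      then show "tmap t p \<in> F"
        using vec_subset_choice_set[OF t F(1) e _ p refl] by simp
    qed
    then have "F = {} \<or> F = P" using * F(1) by (auto simp: cyc_def)
    then have triv: "F \<inter> fib e = {} \<or> F \<inter> fib e = fib e" for e using fib_subset by blast
    have "(e, i) \<notin> vec F" for e i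
      using vec_trivial[OF triv] vec_subset by blast
    then show ?thesis by auto
  qed
  moreover have "choice_set E t \<subseteq> E \<times> {1,2,3}" "single_valued (choice_set E t)"
    using t by (auto simp: single_valued_def)
  ultimately show "choice_set E t \<in> indeps Zcyc" unfolding indep_iff by blast
qed

text \<open>Isotropy allows at most one dependent extension at \<open>e\<close>. A nontrivial cycle that follows the chosen
  transitions away from \<open>e\<close> provides one: its degree at \<open>e\<close> is even because the total is, and its vector
  must use \<open>e\<close> because the rest is independent.\<close>

lemma tight_Zcyc: "tight_3_matroid Zcyc"
  unfolding tight_3_matroid_def
proof (intro conjI ballI allI impI)
  interpret M: Z3_multimatroid E Zcyc
    using finite_E Zcyc_carrier multimatroid_Zcyc by unfold_locales
  show "multimatroid Zcyc" by (rule multimatroid_Zcyc)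
  show "card \<omega> = 3" if w: "\<omega> \<in> skew_classes Zcyc" for \<omega>
  proof -
    obtain e where "\<omega> = {(e, 1), (e, 2), (e, 3)}" using w by (auto simp: Zcyc_def Z3_skew_classes_def)
    then show ?thesis by simp
  qed
  fix X \<omega> assume "basis Zcyc X \<and> \<omega> \<in> skew_classes Zcyc"
  then have X: "basis Zcyc X" "\<omega> \<in> skew_classes Zcyc" by blast+
  have Xi: "X \<in> indeps Zcyc" using X(1) by (simp add: basis_def)
  obtain t where t: "\<forall>e\<in>E. t e \<in> {1,2,3}" and Xt: "X \<subseteq> choice_set E t" "choice_set E t \<in> indeps Zcyc"
    using M.indep_extends_to_choice_set[OF Xi] .
  have X_eq: "X = choice_set E t" using X(1) Xt by (auto simp: basis_def)
  obtain e where e: "e \<in> E" "\<omega> = {(e, 1), (e, 2), (e, 3)}"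
    using X(2) by (auto simp: Zcyc_def Z3_skew_classes_def)
  define I where "I = choice_set E t - \<omega>"
  have I_mem: "(x, i) \<in> I \<longleftrightarrow> x \<in> E \<and> x \<noteq> e \<and> i = t x" for x i
    using t e by (auto simp: I_def)
  have I_sub: "I \<subseteq> choice_set E t" by (auto simp: I_def)
  have I_ind: "I \<in> indeps Zcyc" using indep_mono Xt(2) I_sub by blast
  have ins: "insert (e, i) I = choice_set E (t(e := i))" for i
    using I_mem e by auto
  have basis_ins: "basis Zcyc (insert (e, i) I) \<longleftrightarrow> insert (e, i) I \<in> indeps Zcyc" for i
    unfolding ins by (rule M.basis_choice_set_iff)
  have "\<exists>i\<in>{1,2,3}. insert (e, i) I \<notin> indeps Zcyc"
  proof -
    obtain F where F: "kclosed F" "F \<noteq> {}" "F \<noteq> P"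
      "\<And>p. p \<in> F \<Longrightarrow> ed p \<noteq> e \<Longrightarrow> tmap t p \<in> F"
      using exists_nontrivial_cycle[OF t e(1)] by metis
    have FP: "F \<subseteq> P" using F(1) by (simp add: kclosed_def)
    have other: "even (card (F \<inter> fib x))" "(x, i) \<in> vec F \<Longrightarrow> i = t x" if "x \<noteq> e" for x i
      using closed_vec[OF t FP, of x] F(4) that by blast+
    have "card F = card (F \<inter> fib e) + (\<Sum>x\<in>E - {e}. card (F \<inter> fib x))"
      using card_by_fib[OF FP] sum.remove[OF finite_E e(1)] by metis
    moreover have "even (\<Sum>x\<in>E - {e}. card (F \<inter> fib x))"
      using other(1) by (intro dvd_sum) auto
    ultimately have "even (card (F \<inter> fib e))" using even_card_kclosed[OF F(1)] by simp
    then have "even (card (F \<inter> fib x))" for x using other(1) by (cases "x = e") auto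
    then have cyc: "cyc F" using F(1) by (simp add: cyc_def)
    have ne: "vec F \<noteq> {}" using vec_empty[OF cyc] F by blast
    have "\<not> vec F \<subseteq> I" using I_ind cyc ne unfolding indep_iff by blast
    then obtain x i where xi: "(x, i) \<in> vec F" "(x, i) \<notin> I" by auto
    then have "x = e" using other(2)[of x i] I_mem[of x i] vec_subset by auto
    then have i: "i \<in> {1,2,3}" "(e, i) \<in> vec F" using xi vec_subset by auto
    have "vec F \<subseteq> insert (e, i) I"
    proof (rule subsetI, clarify)
      fix x j assume xj: "(x, j) \<in> vec F" "(x, j) \<notin> I"
      then have "x = e" using other(2)[of x j] I_mem[of x j] vec_subset by auto
      then show "x = e \<and> j = i" using xj i single_valuedD[OF vec_single_valued] by blast
    qed
    then have "insert (e, i) I \<notin> indeps Zcyc" using cyc ne unfolding indep_iff by blast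
    then show ?thesis using i by blast
  qed
  then obtain i where i: "i \<in> {1,2,3}" "insert (e, i) I \<notin> indeps Zcyc" by blast
  have uniq: "j = i" if j: "j \<in> {1,2,3}" "insert (e, j) I \<notin> indeps Zcyc" for j
    using indep_class_extension[OF I_ind _ e(1) j(1) i(1)] I_mem i j by auto
  have XI: "X - \<omega> = I" by (simp add: X_eq I_def)
  show "\<exists>!u. u \<in> \<omega> \<and> \<not> basis Zcyc (insert u (X - \<omega>))"
    unfolding XI
  proof (rule ex1I[of _ "(e, i)"])
    show "(e, i) \<in> \<omega> \<and> \<not> basis Zcyc (insert (e, i) I)"
      using i e(2) basis_ins by auto
    fix u assume u: "u \<in> \<omega> \<and> \<not> basis Zcyc (insert u I)"
    then obtain j where j: "u = (e, j)" "j \<in> {1,2,3}" using e(2) by auto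
    then have "insert (e, j) I \<notin> indeps Zcyc" using u basis_ins by simp
    then show "u = (e, i)" using uniq j by blast
  qed
qed

text \<open>The flags are connected under \<open>\<kappa>\<close>, \<open>\<epsilon>\<close> over \<open>X\<close> and \<open>\<sigma>\<close> elsewhere; this is the combinatorial form of
  having a single boundary component.\<close>

definition joined :: "'e set \<Rightarrow> bool" where
  "joined X \<longleftrightarrow> (\<forall>F \<subseteq> P. (\<forall>p\<in>F. \<kappa> p \<in> F \<and> (if ed p \<in> X then \<epsilon> p \<in> F else \<sigma> p \<in> F)) \<longrightarrow>
     F = {} \<or> F = P)"

lemma induced_Zcyc: "induced_system E Zcyc = (E, {X. X \<subseteq> E \<and> joined X})"
proof -
  interpret M: Z3_multimatroid E Zcyc
    using finite_E Zcyc_carrier multimatroid_Zcyc by unfold_locales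
  have "basis (delete Zcyc (E \<times> {3})) ((E - X) \<times> {1} \<union> X \<times> {2}) \<longleftrightarrow> joined X" if X: "X \<subseteq> E" for X
  proof -
    let ?t = "\<lambda>e. if e \<in> X then 2 else (1::nat)"
    have t: "\<forall>e\<in>E. ?t e \<in> {1,2}" "\<forall>e\<in>E. ?t e \<in> {1,2,3}" by auto
    have tm: "tmap ?t p = (if ed p \<in> X then \<epsilon> p else \<sigma> p)" for p
      by (simp add: tmap_def tr_def)
    show ?thesis
      unfolding split_as_choice_set[OF X] M.delete_T3_basis_iff[OF t(1)] choice_set_indep_iff[OF t(2)]
        joined_def kclosed_def tm
      by (simp add: if_distrib[of "\<lambda>x. x \<in> _"]) blast
  qed
  then show ?thesis unfolding induced_system_def by auto
qed

lemma Z3_eq: "Z3 (E, {X. X \<subseteq> E \<and> joined X}) = Zcyc"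
  using Z3_eqI[OF finite_E Zcyc_carrier tight_Zcyc induced_Zcyc] by simp

subsection \<open>Parity of circuits and of cycles\<close>

lemma circuit_iff:
  "circuit Zcyc C \<longleftrightarrow> C \<subseteq> E \<times> {1,2,3} \<and> single_valued C \<and> C \<notin> indeps Zcyc \<and> (\<forall>S. S \<subset> C \<longrightarrow> S \<in> indeps Zcyc)"
  by (simp add: circuit_def subtransversal_Z3_iff[OF Zcyc_carrier])

lemma vec_dependent: "cyc F \<Longrightarrow> vec F \<noteq> {} \<Longrightarrow> vec F \<notin> indeps Zcyc"
  unfolding indep_iff by blast

lemma circuit_is_vec:
  assumes "circuit Zcyc C"
  obtains F where "cyc F" "vec F = C"
proof -
  have C: "C \<subseteq> E \<times> {1,2,3}" "single_valued C" "C \<notin> indeps Zcyc" "\<And>S. S \<subset> C \<Longrightarrow> S \<in> indeps Zcyc"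
    using assms unfolding circuit_iff by blast+
  obtain F where F: "cyc F" "vec F \<subseteq> C" "vec F \<noteq> {}" using dependentE[OF C(1-3)] .
  then have "vec F = C" using C(4)[of "vec F"] vec_dependent by blast
  then show thesis using that F by blast
qed

lemma finite_vec: "finite (vec F)"
  using vec_subset finite_E by (meson finite.emptyI finite_SigmaI finite_insert finite_subset)

lemma contains_circuit:
  assumes "S \<subseteq> E \<times> {1,2,3}" "single_valued S" "S \<notin> indeps Zcyc"
  obtains C where "C \<subseteq> S" "circuit Zcyc C"
proof -
  have "finite S" using assms(1) finite_E by (meson finite.emptyI finite_SigmaI finite_insert finite_subset)
  then have "\<exists>C \<subseteq> S. circuit Zcyc C"
    using assms
  proof (induction S rule: finite_psubset_induct)
    case (psubset S)
    show ?case
    proof (cases "circuit Zcyc S")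
      case False
      then obtain R where R: "R \<subset> S" "R \<notin> indeps Zcyc"
        using psubset.prems unfolding circuit_iff by blast
      then have "\<exists>C \<subseteq> R. circuit Zcyc C"
        using psubset.IH[OF R(1)] psubset.prems single_valued_mono[of S R] by auto
      then show ?thesis using R(1) by (meson psubset_imp_subset subset_trans)
    qed blast
  qed
  then show thesis using that by blast
qed

text \<open>Subtracting from a vector a circuit contained in it leaves the vector of another cycle, so vectors are
  disjoint unions of circuits.\<close>

lemma circuits_even_iff:
  "(\<forall>C. circuit Zcyc C \<longrightarrow> even (card C)) \<longleftrightarrow> (\<forall>F. cyc F \<longrightarrow> even (card (vec F)))"
proof
  assume *: "\<forall>C. circuit Zcyc C \<longrightarrow> even (card C)"
  have "even (card (vec F))" if "cyc F" for F
    using that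
  proof (induction "card (vec F)" arbitrary: F rule: less_induct)
    case less
    show ?case
    proof (cases "vec F = {}")
      case False
      then obtain C where C: "C \<subseteq> vec F" "circuit Zcyc C"
        using contains_circuit[OF vec_subset vec_single_valued] vec_dependent less.prems by metis
      obtain G where G: "cyc G" "vec G = C" using circuit_is_vec[OF C(2)] .
      have "C \<noteq> {}" using C(2) empty_indep unfolding circuit_iff by blast
      have eq: "vec (sym_diff F G) = vec F - C"
        using vec_sym_diff[OF less.prems order_refl G(1) _ vec_single_valued] G C by auto
      have "card (vec F) = card C + card (vec F - C)"
        using C(1) finite_vec card_Int_Diff[of "vec F" C] by (simp add: Int_absorb1)
      moreover have "card C > 0" using \<open>C \<noteq> {}\<close> C(1) finite_vec by (simp add: card_gt_0_iff finite_subset)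
      ultimately have "card (vec (sym_diff F G)) < card (vec F)" using eq by simp
      then have "even (card (vec (sym_diff F G)))" using less.hyps cyc_sym_diff less.prems G(1) by blast
      then show ?thesis using \<open>card (vec F) = _\<close> eq * C(2) by simp
    qed simp
  qed
  then show "\<forall>F. cyc F \<longrightarrow> even (card (vec F))" by blast
next
  assume "\<forall>F. cyc F \<longrightarrow> even (card (vec F))"
  then show "\<forall>C. circuit Zcyc C \<longrightarrow> even (card C)" by (metis circuit_is_vec)
qed

text \<open>A cycle has two half-edges at each vertex of its vector and none or four elsewhere, while its number of
  medial edges is half its number of half-edges.\<close>

lemma even_card_vec_iff:
  assumes "cyc F"
  shows "even (card (vec F)) \<longleftrightarrow> 4 dvd card F"
proof -
  define S where "S = {e \<in> E. card (F \<inter> fib e) = 2}"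
  have two: "e \<in> S \<longleftrightarrow> (\<exists>i. (e, i) \<in> vec F)" and four: "e \<notin> S \<Longrightarrow> 4 dvd card (F \<inter> fib e)"
    if e: "e \<in> E" for e
  proof -
    show "e \<in> S \<longleftrightarrow> (\<exists>i. (e, i) \<in> vec F)" using assms e
    proof (cases rule: cyc_fib_cases)
      case (pair i p)
      then have "card (F \<inter> fib e) = 2" using tr_fib(2)[OF pair(2,1)] by simp
      then show ?thesis using vec_eqI[OF pair] e by (auto simp: S_def)
    qed (use vec_trivial card_fib[OF e] e in \<open>auto simp: S_def\<close>)
    show "4 dvd card (F \<inter> fib e)" if "e \<notin> S" using assms e
    proof (cases rule: cyc_fib_cases)
      case (pair i p)
      then have "card (F \<inter> fib e) = 2" using tr_fib(2)[OF pair(2,1)] by simp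
      then show ?thesis using \<open>e \<notin> S\<close> e by (simp add: S_def)
    qed (use card_fib[OF e] in auto)
  qed
  have "fst ` vec F = S" using two vec_subset by (force simp: S_def)
  moreover have "inj_on fst (vec F)"
    using single_valuedD[OF vec_single_valued] by (intro inj_onI) (metis prod.collapse)
  ultimately have cS: "card (vec F) = card S" using card_image by metis
  have "card F = (\<Sum>e\<in>E. card (F \<inter> fib e))"
    using assms by (intro card_by_fib) (simp add: cyc_def kclosed_def)
  also have "\<dots> = (\<Sum>e\<in>S. card (F \<inter> fib e)) + (\<Sum>e\<in>E - S. card (F \<inter> fib e))"
    using finite_E sum.subset_diff[of S E "\<lambda>e. card (F \<inter> fib e)"] by (simp add: S_def)
  also have "(\<Sum>e\<in>S. card (F \<inter> fib e)) = 2 * card S" by (simp add: S_def)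
  finally have "card F = 2 * card S + (\<Sum>e\<in>E - S. card (F \<inter> fib e))" .
  moreover have "4 dvd (\<Sum>e\<in>E - S. card (F \<inter> fib e))" using four by (intro dvd_sum) auto
  ultimately have "4 dvd card F \<longleftrightarrow> 4 dvd 2 * card S" by (metis dvd_add_left_iff)
  then show ?thesis unfolding cS by presburger
qed

text \<open>Bipartiteness of the medial graph, with \<open>A\<close> as one of the two colour classes.\<close>

definition two_colourable :: bool where
  "two_colourable \<longleftrightarrow> (\<exists>A. \<forall>p\<in>P. ed (\<kappa> p) \<in> A \<longleftrightarrow> ed p \<notin> A)"

text \<open>Half of the half-edges of a cycle lie at vertices of one colour class, where they are counted by even
  degrees.\<close>

lemma two_colourable_imp_cycles_even:
  assumes "two_colourable" "cyc F"
  shows "4 dvd card F"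
proof -
  obtain A where A: "\<And>p. p \<in> P \<Longrightarrow> ed (\<kappa> p) \<in> A \<longleftrightarrow> ed p \<notin> A" using assms(1) unfolding two_colourable_def by blast
  have F: "F \<subseteq> P" "\<And>p. p \<in> F \<Longrightarrow> \<kappa> p \<in> F" using assms(2) by (auto simp: cyc_def kclosed_def)
  define G where "G = {p \<in> F. ed p \<in> A}"
  have fin: "finite F" using F(1) finite_P by (rule finite_subset)
  have "bij_betw \<kappa> G (F - G)"
  proof (rule bij_betwI[where g = \<kappa>])
    show "\<kappa> \<in> G \<rightarrow> F - G" "\<kappa> \<in> F - G \<rightarrow> G" using F A by (auto simp: G_def)
    show "\<kappa> (\<kappa> p) = p" if "p \<in> G" for p using that kappa F(1) by (auto simp: G_def)
    show "\<kappa> (\<kappa> p) = p" if "p \<in> F - G" for p using that kappa F(1) by auto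
  qed
  then have "card (F - G) = card G" by (simp add: bij_betw_same_card)
  moreover have "F \<inter> G = G" by (auto simp: G_def)
  then have "card F = card G + card (F - G)"
    using card_Int_Diff[OF fin, of G] by simp
  ultimately have "card F = 2 * card G" by simp
  moreover have "even (card G)"
  proof -
    have "card G = (\<Sum>e\<in>E. card (G \<inter> fib e))" using F(1) by (intro card_by_fib) (auto simp: G_def)
    moreover have "even (card (G \<inter> fib e))" if "e \<in> E" for e
    proof -
      have "G \<inter> fib e = (if e \<in> A then F \<inter> fib e else {})" by (auto simp: G_def fib_def)
      then show ?thesis using assms(2) that by (simp add: cyc_def)
    qed
    ultimately show ?thesis by (simp add: dvd_sum)
  qed
  ultimately show ?thesis by presburger
qed

text \<open>Fixing a medial vertex \<open>a\<close>, a set of corners with odd degree exactly at \<open>a\<close> and \<open>e\<close> (nowhere if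
  they coincide) behaves like a walk from \<open>a\<close> to \<open>e\<close>; two of them differ by a cycle, so the parity of their sizes depends
  on \<open>e\<close> only.\<close>

definition walk :: "'e \<Rightarrow> 'e \<Rightarrow> 'p set \<Rightarrow> bool" where
  "walk a e F \<longleftrightarrow> kclosed F \<and> (\<forall>x\<in>E. odd (card (F \<inter> fib x)) \<longleftrightarrow> (x = a) \<noteq> (x = e))"

lemma four_dvd_sym_diff:
  assumes "kclosed F" "kclosed G"
  shows "4 dvd card (sym_diff F G) \<longleftrightarrow> (4 dvd card F \<longleftrightarrow> 4 dvd card G)"
proof -
  have "card (sym_diff F G) + 2 * card (F \<inter> G) = card F + card G"
    using assms finite_kclosed by (intro card_sym_diff) auto
  moreover have "even (card (F \<inter> G))" "even (card F)" "even (card G)"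
    using assms kclosed_Int even_card_kclosed by blast+
  ultimately show ?thesis by presburger
qed

lemma walk_step:
  assumes "walk a (ed p) F" "p \<in> P"
  shows "walk a (ed (\<kappa> p)) (sym_diff F {p, \<kappa> p})"
    "4 dvd card (sym_diff F {p, \<kappa> p}) \<longleftrightarrow> \<not> 4 dvd card F"
proof -
  have c: "kclosed {p, \<kappa> p}" using kappa[OF assms(2)] assms(2) by (simp add: kclosed_def)
  have F: "kclosed F" using assms(1) by (simp add: walk_def)
  have "card {p, \<kappa> p} = 2" using kappa[OF assms(2)] by (metis card_2_iff)
  then show "4 dvd card (sym_diff F {p, \<kappa> p}) \<longleftrightarrow> \<not> 4 dvd card F"
    using four_dvd_sym_diff[OF F c] by simp
  show "walk a (ed (\<kappa> p)) (sym_diff F {p, \<kappa> p})"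
    unfolding walk_def
  proof (intro conjI ballI)
    show "kclosed (sym_diff F {p, \<kappa> p})" using F c by (rule kclosed_sym_diff)
    fix x assume x: "x \<in> E"
    have "{p, \<kappa> p} \<inter> fib x = (if x = ed p then {p} else {}) \<union> (if x = ed (\<kappa> p) then {\<kappa> p} else {})"
      using assms(2) kappa[OF assms(2)] by (auto simp: fib_def)
    then have "odd (card ({p, \<kappa> p} \<inter> fib x)) \<longleftrightarrow> (x = ed p) \<noteq> (x = ed (\<kappa> p))"
      using kappa[OF assms(2)] by auto
    moreover have "odd (card (F \<inter> fib x)) \<longleftrightarrow> (x = a) \<noteq> (x = ed p)"
      using assms(1) x by (simp add: walk_def)
    ultimately show "odd (card (sym_diff F {p, \<kappa> p} \<inter> fib x)) \<longleftrightarrow> (x = a) \<noteq> (x = ed (\<kappa> p))"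
      unfolding sym_diff_Int_fib using even_card_sym_diff[of "F \<inter> fib x" "{p, \<kappa> p} \<inter> fib x"] finite_fib by auto
  qed
qed

lemma walks_exist:
  assumes a: "a \<in> E" and e: "e \<in> E"
  shows "\<exists>F. walk a e F"
proof -
  define R where "R = {p \<in> P. \<exists>F. walk a (ed p) F}"
  have "R = {} \<or> R = P"
  proof (rule connected)
    show "R \<subseteq> P" by (auto simp: R_def)
    fix p assume "p \<in> R"
    then have p: "p \<in> P" "\<exists>F. walk a (ed p) F" by (auto simp: R_def)
    then have "\<exists>F. walk a (ed (\<kappa> p)) F" using walk_step(1) by blast
    then show "\<kappa> p \<in> R \<and> \<sigma> p \<in> R \<and> \<epsilon> p \<in> R"
      using p kappa[OF p(1)] sigma[OF p(1)] eps[OF p(1)] by (simp add: R_def)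
  qed
  moreover have "R \<noteq> {}"
  proof -
    obtain p where "p \<in> P" "ed p = a" using a by (auto simp: E_def)
    moreover have "walk a a {}" by (simp add: walk_def kclosed_def)
    ultimately show ?thesis by (auto simp: R_def)
  qed
  moreover obtain p where "p \<in> P" "ed p = e" using e by (auto simp: E_def)
  ultimately show ?thesis by (auto simp: R_def)
qed

lemma cycles_even_imp_two_colourable:
  assumes even: "\<And>F. cyc F \<Longrightarrow> 4 dvd card F"
  shows "two_colourable"
proof -
  obtain a where a: "a \<in> E" using P_ne by (auto simp: E_def)
  have uniq: "4 dvd card F \<longleftrightarrow> 4 dvd card G" if FG: "walk a e F" "walk a e G" for e F G
  proof -
    have k: "kclosed F" "kclosed G" using FG by (auto simp: walk_def)
    have "cyc (sym_diff F G)"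
      unfolding cyc_def sym_diff_Int_fib
    proof (intro conjI ballI)
      show "kclosed (sym_diff F G)" using k by (rule kclosed_sym_diff)
      fix x assume "x \<in> E"
      then have "odd (card (F \<inter> fib x)) \<longleftrightarrow> odd (card (G \<inter> fib x))"
        using FG by (simp add: walk_def)
      then show "even (card (sym_diff (F \<inter> fib x) (G \<inter> fib x)))"
        using even_card_sym_diff[of "F \<inter> fib x" "G \<inter> fib x"] finite_fib by simp
    qed
    then show ?thesis using even four_dvd_sym_diff[OF k] by blast
  qed
  define A where "A = {e. \<exists>F. walk a e F \<and> 4 dvd card F}"
  have "ed (\<kappa> p) \<in> A \<longleftrightarrow> ed p \<notin> A" if p: "p \<in> P" for p
  proof -
    obtain F where F: "walk a (ed p) F" using walks_exist[OF a] p by (auto simp: E_def)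
    note step = walk_step[OF F p]
    have mem_A: "e \<in> A \<longleftrightarrow> 4 dvd card H" if "walk a e H" for e H
      unfolding A_def mem_Collect_eq using that uniq[OF that] by metis
    show ?thesis using mem_A[OF F] mem_A[OF step(1)] step(2) by simp
  qed
  then show ?thesis unfolding two_colourable_def by blast
qed

theorem Z3_bipartite_iff_two_colourable: "Z3_bipartite (E, {X. X \<subseteq> E \<and> joined X}) \<longleftrightarrow> two_colourable"
  unfolding Z3_bipartite_def Z3_eq circuits_even_iff
  using even_card_vec_iff two_colourable_imp_cycles_even cycles_even_imp_two_colourable by blast

end


section \<open>The medial graph and the delta-matroid of a ribbon graph\<close>

lemma (in connected_ribbon) flags: "medial_flags P ed kappa sigma eps"
proof
  show "finite P" "P \<noteq> {}" using finite_P P_nonempty by simp_all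
  show "F = {} \<or> F = P" if "F \<subseteq> P" "\<And>p. p \<in> F \<Longrightarrow> kappa p \<in> F \<and> sigma p \<in> F \<and> eps p \<in> F" for F
    using that by (rule flags_connected)
  fix p assume p: "p \<in> P"
  show "kappa p \<in> P \<and> kappa p \<noteq> p \<and> kappa (kappa p) = p" using kappa[OF p] by simp
  show "sigma p \<in> P \<and> sigma p \<noteq> p \<and> sigma (sigma p) = p \<and> ed (sigma p) = ed p" using sigma[OF p] by simp
  show "eps p \<in> P \<and> eps p \<noteq> p \<and> eps (eps p) = p \<and> ed (eps p) = ed p" using eps[OF p] .
  show "sigma p \<noteq> eps p" using sigma_ne_eps[OF p] .
  show "sigma (eps p) = eps (sigma p)" using sigma_eps_commute[OF p] .
  show "q \<in> {p, sigma p, eps p, sigma (eps p)}" if "q \<in> P" "ed q = ed p" for q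
    using edge_flags[OF p that] .
qed

theorem corollary5p10:
  fixes G :: "'a ribbon_graph"
  assumes "connected_ribbon_graph G"
    and "redges G \<noteq> {}"
  shows "Z3_bipartite (ribbon_delta_matroid G) \<longleftrightarrow> bipartite (medial_graph G)"
proof -
  interpret R: connected_ribbon G
    using assms by unfold_locales (simp_all add: connected_ribbon_graph_def)
  interpret F: medial_flags R.P R.ed R.kappa R.sigma R.eps by (rule R.flags)
  have E: "F.E = redges G"
    unfolding F.E_def using R.ed R.edge_has_flag by blast
  have "ribbon_delta_matroid G = (F.E, {X. X \<subseteq> F.E \<and> F.joined X})"
    unfolding ribbon_delta_matroid_def E F.joined_def using R.quasi_tree_iff by (simp cong: conj_cong)
  then show ?thesis
    using F.Z3_bipartite_iff_two_colourable R.bipartite_medial_iff by (simp add: F.two_colourable_def)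
qed

end
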